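(* Let $A$ be a finite-dimensional Leibniz algebra over a field of characteristic $0$. Then the Frattini subalgebra $F(A)$ is an ideal in $A$.
   Context: A (left) Leibniz algebra over a field is a vector space $A$ with a bilinear product satisfying $x(yz) = (xy)z + y(xz)$ for all $x,y,z \in A$ (so left multiplications are derivations). "Ideal" means two-sided ideal. The Frattini subalgebra $F(A)$ is the intersection of all maximal (proper) subalgebras of $A$. *)

theory Defs
  imports Complex_Main
begin

text \<open>The ground field is the type \<open>'k\<close> and the algebra is the whole type \<open>'a\<close>, with scalar
  multiplication \<open>scale\<close> as in the library locale \<^locale>\<open>vector_space\<close>.\<close>

locale leibniz_algebra = vector_space scale
  for scale :: "'k::field \<Rightarrow> 'a::ab_group_add \<Rightarrow> 'a" +
  fixes mult :: "'a \<Rightarrow> 'a \<Rightarrow> 'a"  (infixl \<open>\<cdot>\<close> 70)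
  assumes linear_mult_left: "Vector_Spaces.linear scale scale (\<lambda>y. x \<cdot> y)"
    and linear_mult_right: "Vector_Spaces.linear scale scale (\<lambda>x. x \<cdot> y)"
    and leibniz: "x \<cdot> (y \<cdot> z) = (x \<cdot> y) \<cdot> z + y \<cdot> (x \<cdot> z)"
begin

definition finite_dimensional :: bool
  where "finite_dimensional \<longleftrightarrow> (\<exists>B. finite B \<and> span B = UNIV)"

definition subalgebra :: "'a set \<Rightarrow> bool"
  where "subalgebra S \<longleftrightarrow> subspace S \<and> (\<forall>x\<in>S. \<forall>y\<in>S. x \<cdot> y \<in> S)"

definition two_sided_ideal :: "'a set \<Rightarrow> bool"
  where "two_sided_ideal I \<longleftrightarrow> subspace I \<and> (\<forall>a. \<forall>x\<in>I. a \<cdot> x \<in> I \<and> x \<cdot> a \<in> I)"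

definition maximal_subalgebra :: "'a set \<Rightarrow> bool"
  where "maximal_subalgebra M \<longleftrightarrow> subalgebra M \<and> M \<noteq> UNIV \<and>
    (\<forall>S. subalgebra S \<and> M \<subseteq> S \<longrightarrow> S = M \<or> S = UNIV)"

text \<open>If there is no maximal subalgebra (for finite-dimensional algebras: only the zero algebra),
  the empty intersection is the whole algebra.\<close>

definition frattini :: "'a set"
  where "frattini = \<Inter> {M. maximal_subalgebra M}"

end

end

theory Submission
  imports Defs "HOL-Algebra.Algebraic_Closure_Type" "HOL-Library.Function_Algebras"
begin

text \<open>Write \<open>A\<close> for the algebra, \<open>F\<close> for its Frattini subalgebra and \<open>L\<^sub>a\<close> for left multiplication by \<open>a\<close>.

The left half, \<open>A F \<subseteq> F\<close>. Automorphisms of \<open>A\<close> permute the maximal subalgebras and so preserve \<open>F\<close>.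
In characteristic \<open>0\<close>, a subspace preserved by all automorphisms of a finite-dimensional algebra is
preserved by all derivations (\<open>aut_invariant_imp_derivation_invariant\<close>), in particular by every \<open>L\<^sub>a\<close>.
To see this over a field \<open>k\<close> that need not be algebraically closed, split a derivation as \<open>D = S + N\<close> with
\<open>S\<close> semisimple and \<open>N\<close> nilpotent, both polynomials in \<open>D\<close> over \<open>k\<close> and both derivations
(\<open>jordan_decomposition\<close>). For \<open>N\<close> one uses the automorphism \<open>exp N\<close>. For \<open>S\<close> one needs an
automorphism that is a polynomial in \<open>D\<close> and in which \<open>S\<close> is in turn a polynomial. Over the algebraic closure
it can be taken to act on the \<open>\<alpha>\<close>-eigenspace of \<open>S\<close> by a scalar \<open>\<chi>(\<alpha>)\<close> such that
\<open>\<chi>(\<alpha> + \<beta>) = \<chi>(\<alpha>) \<chi>(\<beta>)\<close> and \<open>\<chi>\<close> is injective on the eigenvalues, and it is defined over \<open>k\<close>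
if \<open>\<chi>\<close> commutes with the \<open>k\<close>-endomorphisms of the closure. Such a \<open>\<chi>(\<alpha>)\<close> is the product of the powers
\<open>(s - \<beta>)\<^bsup>n(\<alpha>, \<beta>)\<^esup>\<close>, where \<open>\<beta>\<close> runs through the eigenvalues, \<open>s \<in> k\<close> is generic and \<open>n\<close> is an integral
form, additive in its first argument and invariant under those endomorphisms (\<open>equivariant_character\<close>).
In terms of algebraic groups, the torus generated by \<open>S\<close> has enough \<open>k\<close>-rational points because tori are
unirational.

The right half, \<open>F A \<subseteq> F\<close>. Let \<open>Z = {z. z A = 0}\<close>; it is an ideal, and \<open>ab + ba \<in> Z\<close> for all \<open>a\<close>, \<open>b\<close>.
Let \<open>x \<in> F\<close> and let \<open>S\<close> be the semisimple part of \<open>L\<^sub>x\<close>. Then \<open>ker S + Z\<close> is a subalgebra. It is not proper,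
for a maximal subalgebra above it would contain \<open>F\<close> and \<open>Z\<close>, hence \<open>x A \<subseteq> A x + Z\<close>, hence the image of \<open>S\<close> as
well as its kernel. So every \<open>L\<^sub>a\<close> equals some \<open>L\<^sub>b\<close> with \<open>S b = 0\<close> and therefore commutes with \<open>S\<close>. But \<open>x\<close> is
a sum of products because \<open>F \<subseteq> A\<^sup>2\<close>, so \<open>L\<^sub>x\<close> is a sum of commutators of left multiplications, and the trace of
\<open>L\<^sub>x\<close> times any operator commuting with all \<open>L\<^sub>a\<close> vanishes. Choosing as this operator the inverse of \<open>S\<close> on its
image, extended by \<open>0\<close>, one finds that the dimension of that image is \<open>0\<close>. Hence \<open>L\<^sub>x\<close> is nilpotent
(\<open>frattini_left_mult_nilpotent\<close>).

Now let \<open>M\<close> be a maximal subalgebra. If \<open>Z \<subseteq> M\<close>, then \<open>x a \<in> - a x + Z \<subseteq> M\<close>. Otherwise Engel's theorem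
(\<open>engel\<close>), applied to the action of \<open>F + Z\<close> on \<open>Z / (Z \<inter> M)\<close>, yields \<open>y \<in> Z\<close> outside \<open>M\<close> with
\<open>F y \<subseteq> M\<close>. The elements \<open>z \<in> Z\<close> with \<open>F z \<subseteq> M\<close> together with \<open>M\<close> span a subalgebra, which is larger
than \<open>M\<close> and hence all of \<open>A\<close>; therefore \<open>F A \<subseteq> M\<close> (\<open>frattini_right_mult\<close>).\<close>

section \<open>Field homomorphisms and their action on polynomials\<close>

locale field_hom =
  fixes h :: "'a::field \<Rightarrow> 'b::field"
  assumes one: "h 1 = 1"
    and add: "h (x + y) = h x + h y"
    and mult: "h (x * y) = h x * h y"
begin

lemma zero: "h 0 = 0"
  by (metis add add_cancel_right_right)

lemma neg: "h (- x) = - h x"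
  using add[of x "- x"] zero by (simp add: eq_neg_iff_add_eq_0 add.commute)

lemma diff: "h (x - y) = h x - h y"
  using add[of x "- y"] neg by simp

lemma eq_0_iff: "h x = 0 \<longleftrightarrow> x = 0"
proof
  assume "h x = 0"
  show "x = 0"
  proof (rule ccontr)
    assume "x \<noteq> 0"
    then have "h x * h (inverse x) = 1" by (simp add: mult[symmetric] one)
    then show False using \<open>h x = 0\<close> by simp
  qed
qed (simp add: zero)

lemma eq_iff: "h x = h y \<longleftrightarrow> x = y"
  using eq_0_iff[of "x - y"] by (simp add: diff)

lemma inverse: "h (inverse x) = inverse (h x)"
proof (cases "x = 0")
  case False
  then have "h x * h (inverse x) = 1" by (simp add: mult[symmetric] one)
  then show ?thesis by (metis inverse_unique)
qed (simp add: zero)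

lemma power: "h (x ^ n) = h x ^ n"
  by (induction n) (simp_all add: one mult)

lemma power_int: "h (x powi n) = h x powi n"
  by (simp add: power_int_def power inverse)

lemma sum: "h (sum f A) = (\<Sum>x\<in>A. h (f x))"
  by (induction A rule: infinite_finite_induct) (simp_all add: zero add)

lemma prod: "h (prod f A) = (\<Prod>x\<in>A. h (f x))"
  by (induction A rule: infinite_finite_induct) (simp_all add: one mult)

lemma coeff_map: "poly.coeff (map_poly h p) i = h (poly.coeff p i)"
  by (simp add: coeff_map_poly zero)

lemma degree_map: "degree (map_poly h p) = degree p"
  by (intro degree_map_poly) (simp add: eq_0_iff)

lemma map_eq_0_iff: "map_poly h p = 0 \<longleftrightarrow> p = 0"
  by (auto simp: poly_eq_iff coeff_map eq_0_iff)

lemma map_add: "map_poly h (p + q) = map_poly h p + map_poly h q"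
  by (rule poly_eqI) (simp add: coeff_map add)

lemma map_diff: "map_poly h (p - q) = map_poly h p - map_poly h q"
  by (rule poly_eqI) (simp add: coeff_map diff)

lemma map_mult: "map_poly h (p * q) = map_poly h p * map_poly h q"
  by (rule poly_eqI) (simp add: coeff_map coeff_mult sum mult)

lemma map_pCons: "map_poly h (pCons a p) = pCons (h a) (map_poly h p)"
  by (rule poly_eqI) (simp add: coeff_map coeff_pCons split: nat.split)

lemma map_const: "map_poly h [:a:] = [:h a:]"
  by (simp add: map_pCons)

lemma map_one: "map_poly h 1 = 1"
  by (simp add: one_pCons map_const one)

lemma map_power: "map_poly h (p ^ n) = map_poly h p ^ n"
  by (induction n) (simp_all add: map_one map_mult)

lemma map_sum: "map_poly h (sum f A) = (\<Sum>x\<in>A. map_poly h (f x))"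
  by (induction A rule: infinite_finite_induct) (simp_all add: map_add)

lemma map_prod: "map_poly h (prod f A) = (\<Prod>x\<in>A. map_poly h (f x))"
  by (induction A rule: infinite_finite_induct) (simp_all add: map_one map_mult)

lemma map_pcompose: "map_poly h (pcompose p q) = pcompose (map_poly h p) (map_poly h q)"
  by (induction p) (simp_all add: pcompose_pCons map_add map_mult map_pCons map_const)

lemma poly_map: "poly (map_poly h p) (h x) = h (poly p x)"
  by (induction p) (simp_all add: map_pCons zero add mult)

end

interpretation to_ac: field_hom "to_ac :: 'k::field \<Rightarrow> 'k alg_closure"
  by unfold_locales simp_all

section \<open>Endomorphisms of the algebraic closure\<close>

locale ac_endo = field_hom h for h :: "'k::field alg_closure \<Rightarrow> 'k alg_closure" +
  assumes to_ac: "h (to_ac c) = to_ac c"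
begin

lemma map_to_ac: "map_poly h (map_poly to_ac p) = map_poly to_ac p"
  by (rule poly_eqI) (simp add: coeff_map to_ac.coeff_map to_ac)

end

text \<open>A homomorphism over the ground field between subrings of the algebraic closure, given by its graph. The graph is a
subring of the product that contains the diagonal of the ground field and meets \<open>{0} \<times> UNIV\<close> only in \<open>0\<close>, and
unions of chains of graphs need no gluing argument.\<close>

locale partial_ac_endo =
  fixes G :: "('k::field alg_closure \<times> 'k alg_closure) set"
  assumes base: "(to_ac c, to_ac c) \<in> G"
    and add: "(a, b) \<in> G \<Longrightarrow> (a', b') \<in> G \<Longrightarrow> (a + a', b + b') \<in> G"
    and mult: "(a, b) \<in> G \<Longrightarrow> (a', b') \<in> G \<Longrightarrow> (a * a', b * b') \<in> G"
    and functional: "(0, b) \<in> G \<Longrightarrow> b = 0"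
begin

lemma zero: "(0, 0) \<in> G" and one: "(1, 1) \<in> G"
  using base[of 0] base[of 1] by simp_all

lemma diff: "(a, b) \<in> G \<Longrightarrow> (a', b') \<in> G \<Longrightarrow> (a - a', b - b') \<in> G"
  using add[OF _ mult[OF base[of "-1"]], of a b a' b'] by simp

lemma unique: "(a, b) \<in> G \<Longrightarrow> (a, b') \<in> G \<Longrightarrow> b = b'"
  using functional[of "b - b'"] diff[of a b a b'] by simp

lemma sum: "(\<And>i. i \<in> I \<Longrightarrow> (f i, g i) \<in> G) \<Longrightarrow> (sum f I, sum g I) \<in> G"
  by (induction I rule: infinite_finite_induct) (simp_all add: zero add)

lemma poly_base: "(a, b) \<in> G \<Longrightarrow> (poly (map_poly to_ac p) a, poly (map_poly to_ac p) b) \<in> G"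
  by (induction p) (simp_all add: zero add mult base to_ac.map_pCons)

text \<open>Every element of the algebraic closure is algebraic, so an inverse is a polynomial expression with
coefficients in the ground field. The domain of a partial endomorphism is therefore a field.\<close>

lemma inverse:
  assumes "(a, b) \<in> G" "a \<noteq> 0"
  shows "(inverse a, inverse b) \<in> G"
proof -
  obtain p :: "'k poly" where p: "p \<noteq> 0" "poly (map_poly to_ac p) a = 0"
    using alg_closure_algebraic by blast
  have "\<exists>r :: 'k poly. a * poly (map_poly to_ac r) a = 1"
    using p
  proof (induction p)
    case (pCons c p)
    show ?case
    proof (cases "c = 0")
      case True
      with pCons assms(2) show ?thesis by (auto simp: to_ac.map_pCons)
    next
      case False
      let ?r = "[:- inverse c:] * p"
      have "a * poly (map_poly to_ac p) a = - to_ac c"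
        using pCons.prems by (simp add: to_ac.map_pCons eq_neg_iff_add_eq_0 add.commute)
      then have "a * poly (map_poly to_ac ?r) a = 1"
        using False by (simp only: to_ac.map_mult to_ac.map_const) (simp add: field_simps)
      then show ?thesis by blast
    qed
  qed simp
  then obtain r :: "'k poly" where r: "a * poly (map_poly to_ac r) a = 1" by blast
  have "(a * poly (map_poly to_ac r) a, b * poly (map_poly to_ac r) b) \<in> G"
    using assms poly_base mult by blast
  then have "b * poly (map_poly to_ac r) b = 1"
    using r one unique by metis
  then have "inverse a = poly (map_poly to_ac r) a" "inverse b = poly (map_poly to_ac r) b"
    using r by (simp_all add: inverse_unique)
  then show ?thesis using poly_base assms(1) by simp
qed

text \<open>The polynomials over the ring \<open>G\<close>, each stored as its image under the two projections of \<open>G\<close>.\<close>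

definition polys :: "('k alg_closure poly \<times> 'k alg_closure poly) set"
  where "polys = {(p, q). \<forall>i. (poly.coeff p i, poly.coeff q i) \<in> G}"

lemma polys_add: "(p, q) \<in> polys \<Longrightarrow> (p', q') \<in> polys \<Longrightarrow> (p + p', q + q') \<in> polys"
  by (simp add: polys_def add)

lemma polys_diff: "(p, q) \<in> polys \<Longrightarrow> (p', q') \<in> polys \<Longrightarrow> (p - p', q - q') \<in> polys"
  by (simp add: polys_def diff)

lemma polys_mult: "(p, q) \<in> polys \<Longrightarrow> (p', q') \<in> polys \<Longrightarrow> (p * p', q * q') \<in> polys"
  by (simp add: polys_def coeff_mult sum mult)

lemma polys_monom: "(a, b) \<in> G \<Longrightarrow> (Polynomial.monom a n, Polynomial.monom b n) \<in> polys"
  by (simp add: polys_def zero)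

lemma polys_base: "(map_poly to_ac p, map_poly to_ac p) \<in> polys"
  by (simp add: polys_def to_ac.coeff_map base)

text \<open>The first component is the minimal polynomial of \<open>y\<close> over the domain of the partial endomorphism,
the second one its image under the partial endomorphism.\<close>

definition minimal_pair :: "'k alg_closure \<Rightarrow> 'k alg_closure poly \<Rightarrow> 'k alg_closure poly \<Rightarrow> bool"
  where "minimal_pair y m n \<longleftrightarrow> (m, n) \<in> polys \<and> poly m y = 0 \<and> Polynomial.lead_coeff m = 1 \<and>
    degree n = degree m \<and> degree m > 0 \<and>
    (\<forall>p q. (p, q) \<in> polys \<longrightarrow> p \<noteq> 0 \<longrightarrow> poly p y = 0 \<longrightarrow> degree m \<le> degree p)"

lemma minimal_pair_exists: "\<exists>m n. minimal_pair y m n"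
proof -
  let ?P = "\<lambda>d. \<exists>p q. (p, q) \<in> polys \<and> p \<noteq> 0 \<and> poly p y = 0 \<and> degree p = d"
  obtain p0 :: "'k poly" where "p0 \<noteq> 0" "poly (map_poly to_ac p0) y = 0"
    using alg_closure_algebraic by blast
  then have "?P (degree p0)"
    using polys_base by (metis to_ac.degree_map to_ac.map_eq_0_iff)
  then have ex: "?P (LEAST d. ?P d)" by (rule LeastI)
  have least: "(LEAST d. ?P d) \<le> degree p" if "(p, q) \<in> polys" "p \<noteq> 0" "poly p y = 0" for p q
    by (rule Least_le) (use that in blast)
  obtain p q where pq: "(p, q) \<in> polys" "p \<noteq> 0" "poly p y = 0" "degree p = (LEAST d. ?P d)"
    using ex by blast
  let ?a = "poly.coeff p (degree p)" and ?b = "poly.coeff q (degree p)"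
  have ab: "(?a, ?b) \<in> G" using pq(1) by (auto simp: polys_def)
  have a0: "?a \<noteq> 0" using pq(2) by simp
  have inv: "(inverse ?a, inverse ?b) \<in> G" using inverse[OF ab a0] .
  let ?m = "Polynomial.monom (inverse ?a) 0 * p" and ?n = "Polynomial.monom (inverse ?b) 0 * q"
  have mn: "(?m, ?n) \<in> polys" using polys_mult polys_monom inv pq(1) by blast
  have b1: "inverse ?b * ?b = 1"
    using mult[OF inv ab] one unique a0 by (metis field_class.field_inverse)
  have dm: "degree ?m = degree p" using a0 by (simp add: monom_0)
  have lm: "Polynomial.lead_coeff ?m = 1" using a0 by (simp add: dm[unfolded monom_0] monom_0)
  have cn: "poly.coeff ?n (degree p) = 1" using b1 by (simp add: monom_0)
  have "poly.coeff q i = 0" if "i > degree p" for i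
  proof -
    have "(poly.coeff p i, poly.coeff q i) \<in> G" using pq(1) by (auto simp: polys_def)
    moreover have "poly.coeff p i = 0" using that coeff_eq_0 by blast
    ultimately show ?thesis using functional by simp
  qed
  then have "degree ?n = degree p"
    using cn by (intro antisym degree_le le_degree) (simp_all add: monom_0)
  moreover have "degree p > 0"
  proof (rule ccontr)
    assume "\<not> degree p > 0"
    then obtain c where "p = [:c:]" using degree_0_id by (metis gr0I)
    then show False using pq(2,3) by simp
  qed
  moreover have "poly ?m y = 0" using pq(3) by simp
  ultimately have "minimal_pair y ?m ?n"
    unfolding minimal_pair_def using mn dm lm least pq(4) by metis
  then show ?thesis by blast
qed

text \<open>Division with remainder by the monic polynomial \<open>m\<close> can be carried out in \<open>polys\<close>, that is, in parallel
on both sides. A polynomial that vanishes at \<open>y\<close> leaves remainder \<open>0\<close> by minimality of the degree, so its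
image is a multiple of \<open>n\<close>.\<close>

lemma root_transfer:
  assumes min: "minimal_pair y m n"
    and z: "poly n z = 0"
    and pq: "(p, q) \<in> polys" "poly p y = 0"
  shows "poly q z = 0"
proof -
  have mn: "(m, n) \<in> polys" "poly m y = 0" "Polynomial.lead_coeff m = 1"
    and le: "\<And>p q. (p, q) \<in> polys \<Longrightarrow> p \<noteq> 0 \<Longrightarrow> poly p y = 0 \<Longrightarrow> degree m \<le> degree p"
    using min unfolding minimal_pair_def by blast+
  from pq show ?thesis
  proof (induction "if p = 0 then 0 else Suc (degree p)" arbitrary: p q rule: less_induct)
  case less
  show ?case
  proof (cases "p = 0")
    case True
    then have "poly.coeff q i = 0" for i
      using less.prems(1) functional by (auto simp: polys_def)
    then have "q = 0" by (simp add: poly_eq_iff)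
    then show ?thesis by simp
  next
    case False
    let ?a = "poly.coeff p (degree p)" and ?b = "poly.coeff q (degree p)"
    let ?k = "degree p - degree m"
    let ?p = "p - Polynomial.monom ?a ?k * m" and ?q = "q - Polynomial.monom ?b ?k * n"
    have ab: "(?a, ?b) \<in> G" using less.prems(1) by (auto simp: polys_def)
    have dm: "degree m \<le> degree p" using le[OF less.prems(1) False less.prems(2)] .
    have in': "(?p, ?q) \<in> polys"
      using polys_diff[OF less.prems(1) polys_mult[OF polys_monom[OF ab] mn(1)]] .
    have root: "poly ?p y = 0" using less.prems(2) mn(2) by simp
    have a0: "?a \<noteq> 0" using False by simp
    have m0: "m \<noteq> 0" using mn(3) by auto
    have deg: "degree (Polynomial.monom ?a ?k * m) = degree p"
      using a0 m0 dm by (simp add: degree_mult_eq degree_monom_eq)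
    have lead: "poly.coeff (Polynomial.monom ?a ?k * m) (degree p) = ?a"
      using coeff_mult_degree_sum[of "Polynomial.monom ?a ?k" m] dm mn(3) a0
      by (simp add: degree_monom_eq)
    have "poly.coeff ?p (degree p) = 0" using lead by simp
    moreover have "degree ?p \<le> degree p" using deg degree_diff_le[of p "degree p"] by simp
    ultimately have "?p = 0 \<or> degree ?p < degree p"
      by (metis leading_coeff_0_iff nat_less_le)
    then have "(if ?p = 0 then 0 else Suc (degree ?p)) < (if p = 0 then 0 else Suc (degree p))"
      using False by auto
    from less.hyps[OF this in' root] show ?thesis using z by simp
  qed
qed
qed

text \<open>\<open>root_transfer\<close> is what makes the map that sends the value at \<open>y\<close> of a polynomial to the value of its image
at \<open>z\<close> well defined.\<close>

lemma adjoin: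
  assumes min: "minimal_pair y m n"
    and z: "poly n z = 0"
  obtains G' where "partial_ac_endo G'" "G \<subseteq> G'" "(y, z) \<in> G'"
proof -
  let ?G = "{(poly p y, poly q z) | p q. (p, q) \<in> polys}"
  have sub: "G \<subseteq> ?G"
  proof
    fix ab assume "ab \<in> G"
    then obtain a b where "ab = (a, b)" "(a, b) \<in> G" by (cases ab) auto
    moreover from this have "([:a:], [:b:]) \<in> polys" using polys_monom[of a b 0] by (simp add: monom_0)
    moreover have "a = poly [:a:] y" "b = poly [:b:] z" by simp_all
    ultimately show "ab \<in> ?G" by blast
  qed
  have "y = poly (Polynomial.monom 1 1) y" "z = poly (Polynomial.monom 1 1) z"
    by (simp_all add: poly_monom)
  then have yz: "(y, z) \<in> ?G"
    using polys_monom[OF one, of 1] by blast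
  have "partial_ac_endo ?G"
  proof
    show "(to_ac c, to_ac c) \<in> ?G" for c using sub base by blast
    show "(a + a', b + b') \<in> ?G" if H: "(a, b) \<in> ?G" "(a', b') \<in> ?G" for a b a' b'
    proof -
      obtain p q p' q' where "(p, q) \<in> polys" "(p', q') \<in> polys" "a = poly p y" "b = poly q z"
        "a' = poly p' y" "b' = poly q' z" using H by blast
      then have "(a + a', b + b') = (poly (p + p') y, poly (q + q') z)" "(p + p', q + q') \<in> polys"
        using polys_add[of p q p' q'] by simp_all
      then show ?thesis by blast
    qed
    show "(a * a', b * b') \<in> ?G" if H: "(a, b) \<in> ?G" "(a', b') \<in> ?G" for a b a' b'
    proof -
      obtain p q p' q' where "(p, q) \<in> polys" "(p', q') \<in> polys" "a = poly p y" "b = poly q z"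
        "a' = poly p' y" "b' = poly q' z" using H by blast
      then have "(a * a', b * b') = (poly (p * p') y, poly (q * q') z)" "(p * p', q * q') \<in> polys"
        using polys_mult[of p q p' q'] by simp_all
      then show ?thesis by blast
    qed
    show "b = 0" if H: "(0, b) \<in> ?G" for b
    proof -
      obtain p q where pq: "(p, q) \<in> polys" "poly p y = 0" "b = poly q z" using H by force
      then show ?thesis using root_transfer[OF min z pq(1,2)] by blast
    qed
  qed
  with sub yz that show ?thesis by blast
qed

text \<open>By Zorn's lemma there is a maximal extension; it is total because \<open>adjoin\<close> can be applied to any missing
element.\<close>

lemma extend_to_endo:
  obtains h where "ac_endo h" "\<And>a b. (a, b) \<in> G \<Longrightarrow> h a = b"
proof -
  let ?A = "{H. partial_ac_endo H \<and> G \<subseteq> H}"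
  have GA: "G \<in> ?A" using partial_ac_endo_axioms by simp
  have "\<exists>M\<in>?A. \<forall>H\<in>?A. M \<subseteq> H \<longrightarrow> H = M"
  proof (rule subset_Zorn_nonempty)
    show "?A \<noteq> {}" using GA by blast
    fix C assume ne: "C \<noteq> {}" and ch: "subset.chain ?A C"
    have CA: "C \<subseteq> ?A" using ch by (simp add: subset.chain_def)
    have two: "\<exists>Z\<in>C. p \<in> Z \<and> q \<in> Z" if pq: "p \<in> \<Union>C" "q \<in> \<Union>C" for p q
    proof -
      obtain Y Z where YZ: "Y \<in> C" "p \<in> Y" "Z \<in> C" "q \<in> Z" using pq by blast
      then have "Y \<subseteq> Z \<or> Z \<subseteq> Y" using ch unfolding subset_chain_def by blast
      with YZ show ?thesis by blast
    qed
    have partial: "partial_ac_endo Z" if "Z \<in> C" for Z using that CA by blast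
    have "partial_ac_endo (\<Union>C)"
    proof
      obtain Z where "Z \<in> C" using ne by blast
      then show "(to_ac c, to_ac c) \<in> \<Union>C" for c
        using partial_ac_endo.base[OF partial] by blast
      show "(a + a', b + b') \<in> \<Union>C" if "(a, b) \<in> \<Union>C" "(a', b') \<in> \<Union>C" for a b a' b'
        using two[OF that] partial_ac_endo.add[OF partial] by blast
      show "(a * a', b * b') \<in> \<Union>C" if "(a, b) \<in> \<Union>C" "(a', b') \<in> \<Union>C" for a b a' b'
        using two[OF that] partial_ac_endo.mult[OF partial] by blast
      show "b = 0" if "(0, b) \<in> \<Union>C" for b
        using that partial_ac_endo.functional[OF partial] by blast
    qed
    then show "\<Union>C \<in> ?A" using ne CA by blast
  qed
  then obtain M where "M \<in> ?A" and max': "\<forall>H\<in>?A. M \<subseteq> H \<longrightarrow> H = M" by (rule bexE)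
  then have M: "partial_ac_endo M" "G \<subseteq> M" by simp_all
  have max: "H = M" if "partial_ac_endo H" "M \<subseteq> H" for H
    using max' that M(2) by simp
  interpret M: partial_ac_endo M by (rule M(1))
  have total: "\<exists>z. (y, z) \<in> M" for y
  proof -
    obtain m n where min: "M.minimal_pair y m n" using M.minimal_pair_exists by blast
    then have "degree n > 0" unfolding M.minimal_pair_def by simp
    then obtain z where z: "poly n z = 0" using alg_closed_imp_poly_has_root by blast
    obtain G' where "partial_ac_endo G'" "M \<subseteq> G'" "(y, z) \<in> G'"
      by (rule M.adjoin[OF min z])
    then show ?thesis using max by blast
  qed
  define h where "h y = (THE z. (y, z) \<in> M)" for y
  have h: "h a = b \<longleftrightarrow> (a, b) \<in> M" for a b
    unfolding h_def using total[of a] M.unique by (metis the_equality)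
  have "ac_endo h"
  proof
    show "h 1 = 1" using h M.one by blast
    show "h (x + y) = h x + h y" for x y using h M.add by blast
    show "h (x * y) = h x * h y" for x y using h M.mult by blast
    show "h (to_ac c) = to_ac c" for c using h M.base by blast
  qed
  moreover have "h a = b" if "(a, b) \<in> G" for a b using that h M(2) by blast
  ultimately show ?thesis using that by blast
qed

end

text \<open>The part of Galois theory on which all descent to the ground field rests. In characteristic \<open>0\<close> the
minimal polynomial of \<open>v\<close> has \<open>v\<close> as a simple root, so if its degree exceeds \<open>1\<close> it has a second root \<open>z\<close>.
The homomorphism that sends \<open>v\<close> to \<open>z\<close> extends to the whole closure.\<close>

theorem ac_endo_moves:
  fixes v :: "'k::field_char_0 alg_closure"
  assumes "v \<notin> range to_ac"
  obtains h where "ac_endo h" "h v \<noteq> v"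
proof -
  let ?G = "range (\<lambda>c :: 'k. (to_ac c, to_ac c))"
  interpret G: partial_ac_endo ?G
  proof
    show "(a + a', b + b') \<in> ?G" if "(a, b) \<in> ?G" "(a', b') \<in> ?G" for a b a' b'
      using that by (auto simp flip: to_ac_add)
    show "(a * a', b * b') \<in> ?G" if "(a, b) \<in> ?G" "(a', b') \<in> ?G" for a b a' b'
      using that by (auto simp flip: to_ac_mult)
  qed auto
  obtain m n where min: "G.minimal_pair v m n" using G.minimal_pair_exists by blast
  then have mn: "(m, n) \<in> G.polys" "poly m v = 0" "Polynomial.lead_coeff m = 1" and pos: "degree m > 0"
    and le: "\<And>p q. (p, q) \<in> G.polys \<Longrightarrow> p \<noteq> 0 \<Longrightarrow> poly p v = 0 \<Longrightarrow> degree m \<le> degree p"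
    unfolding G.minimal_pair_def by blast+
  have eq: "poly.coeff p i = poly.coeff q i" "poly.coeff p i \<in> range to_ac"
    if "(p, q) \<in> G.polys" for p q i
    using that unfolding G.polys_def by (auto simp: image_iff dest!: spec[of _ i])
  have nm: "n = m" using eq(1)[OF mn(1)] by (simp add: poly_eq_iff)
  have "degree m \<noteq> 1"
  proof
    assume "degree m = 1"
    then obtain a b where ab: "m = [:a, b:]" using degree1_coeffs by blast
    then have "b = 1" using \<open>degree m = 1\<close> mn(3) by simp
    then have "v = - a"
      using mn(2) ab by (simp add: eq_neg_iff_add_eq_0 add.commute)
    moreover obtain c where "a = to_ac c" using eq(2)[OF mn(1), of 0] ab by auto
    ultimately have "v = to_ac (- c)" by simp
    then show False using assms by blast
  qed
  then have d2: "degree m > 1" using pos by simp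
  \<comment> \<open>\<open>pderiv m\<close> has smaller degree and coefficients in the ground field\<close>
  have "poly (pderiv m) v \<noteq> 0"
  proof
    assume root: "poly (pderiv m) v = 0"
    have "(pderiv m, pderiv m) \<in> G.polys"
      unfolding G.polys_def
    proof (clarify)
      fix i
      obtain c where "poly.coeff m (Suc i) = to_ac c" using eq(2)[OF mn(1)] by blast
      then have "poly.coeff (pderiv m) i = to_ac (of_nat (Suc i) * c)" by (simp add: coeff_pderiv)
      then show "(poly.coeff (pderiv m) i, poly.coeff (pderiv m) i) \<in> ?G" by (intro range_eqI[of _ _ "of_nat (Suc i) * c"]) simp
    qed
    moreover have "pderiv m \<noteq> 0" using pos by (simp add: pderiv_eq_0_iff)
    ultimately have "degree m \<le> degree (pderiv m)" using le root by simp
    then show False using pos by (simp add: degree_pderiv)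
  qed
  moreover obtain u where u: "m = [:- v, 1:] * u" using mn(2) by (metis dvdE poly_eq_0_iff_dvd)
  moreover have "poly (pderiv m) v = poly u v" unfolding u pderiv_mult by (simp add: pderiv_pCons)
  ultimately have uv: "poly u v \<noteq> 0" by simp
  then have "u \<noteq> 0" by auto
  then have "degree u > 0" using d2 u by (simp add: degree_mult_eq del: mult_pCons_left)
  then obtain z where z: "poly u z = 0" using alg_closed_imp_poly_has_root by blast
  then have zv: "z \<noteq> v" and "poly n z = 0" using uv by (auto simp: u nm)
  obtain G' where G': "partial_ac_endo G'" "?G \<subseteq> G'" "(v, z) \<in> G'"
    by (rule G.adjoin[OF min \<open>poly n z = 0\<close>])
  obtain h where "ac_endo h" "h v = z"
    using partial_ac_endo.extend_to_endo[OF G'(1)] G'(3) by metis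
  with that zv show ?thesis by blast
qed

section \<open>Interpolation over the ground field\<close>

text \<open>Endomorphisms are enough in place of automorphisms: being injective, they permute every finite stable set.\<close>

lemma ac_endo_permutes:
  assumes "ac_endo h" "finite S" "h ` S \<subseteq> S"
  shows "bij_betw h S S"
proof -
  interpret ac_endo h by fact
  have "inj_on h S" by (simp add: inj_on_def eq_iff)
  with assms show ?thesis by (simp add: bij_betw_def endo_inj_surj)
qed

lemma fixed_by_endos_rational:
  fixes v :: "'k::field_char_0 alg_closure"
  assumes "\<And>h. ac_endo h \<Longrightarrow> h v = v"
  shows "v \<in> range to_ac"
  using ac_endo_moves assms by metis

definition lagrange_poly :: "'c::field set \<Rightarrow> 'c \<Rightarrow> 'c poly"
  where "lagrange_poly S \<alpha> = (\<Prod>\<beta>\<in>S - {\<alpha>}. [:inverse (\<alpha> - \<beta>):] * [:- \<beta>, 1:])"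

text \<open>For distinct nodes, \<open>1 - (1 - t\<^sup>m)\<^sup>m\<close> vanishes to order \<open>m\<close> at \<open>t = 0\<close> and is \<open>1\<close> to order \<open>m\<close> at \<open>t = 1\<close>.
Substituting the Lagrange polynomials for \<open>t\<close> gives the orthogonal idempotents of the polynomial ring modulo
the product of the \<open>(x - \<alpha>)\<^sup>m\<close> by an explicit formula, to which field homomorphisms can be applied.\<close>

definition primary_idem :: "'c::field set \<Rightarrow> nat \<Rightarrow> 'c \<Rightarrow> 'c poly"
  where "primary_idem S m \<alpha> = 1 - (1 - lagrange_poly S \<alpha> ^ m) ^ m"

lemma one_minus_dvd_one_minus_power: "1 - x dvd 1 - x ^ n" for x :: "'c::comm_ring_1"
  by (simp add: one_diff_power_eq)

lemma primary_idem_off: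
  assumes "finite S" "\<beta> \<in> S" "\<beta> \<noteq> \<alpha>"
  shows "[:- \<beta>, 1:] ^ m dvd primary_idem S m \<alpha>"
proof -
  have "[:inverse (\<alpha> - \<beta>):] * [:- \<beta>, 1:] dvd lagrange_poly S \<alpha>"
    unfolding lagrange_poly_def by (rule dvd_prodI) (use assms in auto)
  then have "[:- \<beta>, 1:] dvd lagrange_poly S \<alpha>" by (metis dvd_mult_right)
  then have "[:- \<beta>, 1:] ^ m dvd lagrange_poly S \<alpha> ^ m" by (rule dvd_power_same)
  moreover have "lagrange_poly S \<alpha> ^ m dvd primary_idem S m \<alpha>"
    using one_minus_dvd_one_minus_power[of "1 - lagrange_poly S \<alpha> ^ m" m]
    by (simp add: primary_idem_def)
  ultimately show ?thesis by (rule dvd_trans)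
qed

lemma primary_idem_on: "[:- \<alpha>, 1:] ^ m dvd primary_idem S m \<alpha> - 1"
proof -
  have "poly (lagrange_poly S \<alpha>) \<alpha> = 1"
    unfolding lagrange_poly_def poly_prod
  proof (rule prod.neutral, rule ballI)
    fix \<beta> assume "\<beta> \<in> S - {\<alpha>}"
    then have "\<alpha> - \<beta> \<noteq> 0" by auto
    moreover have "poly ([:inverse (\<alpha> - \<beta>):] * [:- \<beta>, 1:]) \<alpha> = inverse (\<alpha> - \<beta>) * (\<alpha> - \<beta>)"
      by (simp add: algebra_simps)
    ultimately show "poly ([:inverse (\<alpha> - \<beta>):] * [:- \<beta>, 1:]) \<alpha> = 1" by simp
  qed
  then have "[:- \<alpha>, 1:] dvd 1 - lagrange_poly S \<alpha>" by (simp add: poly_eq_0_iff_dvd[symmetric])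
  then have "[:- \<alpha>, 1:] dvd 1 - lagrange_poly S \<alpha> ^ m"
    using one_minus_dvd_one_minus_power by (rule dvd_trans)
  then have "[:- \<alpha>, 1:] ^ m dvd (1 - lagrange_poly S \<alpha> ^ m) ^ m" by (rule dvd_power_same)
  then show ?thesis by (simp add: primary_idem_def)
qed

lemma primary_idem_interpolates:
  assumes "finite S" "\<alpha> \<in> S"
  shows "[:- \<alpha>, 1:] ^ m dvd (\<Sum>\<beta>\<in>S. [:\<psi> \<beta>:] * primary_idem S m \<beta>) - [:\<psi> \<alpha>:]"
proof -
  let ?e = "primary_idem S m"
  have "(\<Sum>\<beta>\<in>S. [:\<psi> \<beta>:] * ?e \<beta>) = [:\<psi> \<alpha>:] * ?e \<alpha> + (\<Sum>\<beta>\<in>S - {\<alpha>}. [:\<psi> \<beta>:] * ?e \<beta>)"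
    using assms by (rule sum.remove)
  then have "(\<Sum>\<beta>\<in>S. [:\<psi> \<beta>:] * ?e \<beta>) - [:\<psi> \<alpha>:]
      = [:\<psi> \<alpha>:] * (?e \<alpha> - 1) + (\<Sum>\<beta>\<in>S - {\<alpha>}. [:\<psi> \<beta>:] * ?e \<beta>)"
    by (simp only: right_diff_distrib mult_1_right) (simp add: algebra_simps)
  moreover have "[:- \<alpha>, 1:] ^ m dvd [:\<psi> \<alpha>:] * (?e \<alpha> - 1)"
    using primary_idem_on by (rule dvd_mult)
  moreover have "[:- \<alpha>, 1:] ^ m dvd (\<Sum>\<beta>\<in>S - {\<alpha>}. [:\<psi> \<beta>:] * ?e \<beta>)"
    by (intro dvd_sum dvd_mult primary_idem_off) (use assms in auto)
  ultimately show ?thesis by (simp only: dvd_add)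
qed

text \<open>If the prescribed values are compatible with the endomorphisms of the closure, applying an endomorphism to the
interpolation polynomial only permutes its summands. The coefficients are therefore fixed and lie in the ground field.\<close>

lemma rational_interpolation:
  fixes S :: "'k::field_char_0 alg_closure set"
  assumes fin: "finite S"
    and stable: "\<And>h. ac_endo h \<Longrightarrow> h ` S \<subseteq> S"
    and equivariant: "\<And>h \<alpha>. ac_endo h \<Longrightarrow> \<alpha> \<in> S \<Longrightarrow> \<psi> (h \<alpha>) = h (\<psi> \<alpha>)"
  shows "\<exists>f :: 'k poly. \<forall>\<alpha>\<in>S. [:- \<alpha>, 1:] ^ m dvd map_poly to_ac f - [:\<psi> \<alpha>:]"
proof -
  define f where "f = (\<Sum>\<alpha>\<in>S. [:\<psi> \<alpha>:] * primary_idem S m \<alpha>)"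
  have "poly.coeff f i \<in> range to_ac" for i
  proof (rule fixed_by_endos_rational)
    fix h :: "'k alg_closure \<Rightarrow> 'k alg_closure" assume h: "ac_endo h"
    interpret h: ac_endo h by fact
    have bij: "bij_betw h S S" using ac_endo_permutes[OF h fin stable[OF h]] .
    have "map_poly h (lagrange_poly S \<alpha>) = lagrange_poly S (h \<alpha>)" if "\<alpha> \<in> S" for \<alpha>
    proof -
      have "bij_betw h (S - {\<alpha>}) (S - {h \<alpha>})"
        by (rule bij_betw_DiffI[OF bij]) (use that bij in \<open>auto simp: bij_betw_def\<close>)
      then have "lagrange_poly S (h \<alpha>) = (\<Prod>\<beta>\<in>S - {\<alpha>}. [:inverse (h \<alpha> - h \<beta>):] * [:- h \<beta>, 1:])"
        unfolding lagrange_poly_def by (rule prod.reindex_bij_betw[symmetric])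
      then show ?thesis
        unfolding lagrange_poly_def h.map_prod h.map_mult h.map_pCons
        by (simp add: h.inverse h.diff h.neg h.one)
    qed
    then have "map_poly h (primary_idem S m \<alpha>) = primary_idem S m (h \<alpha>)" if "\<alpha> \<in> S" for \<alpha>
      using that by (simp add: primary_idem_def h.map_diff h.map_power h.map_one)
    then have "map_poly h f = (\<Sum>\<alpha>\<in>S. [:\<psi> (h \<alpha>):] * primary_idem S m (h \<alpha>))"
      unfolding f_def h.map_sum h.map_mult h.map_const
      by (intro sum.cong refl) (simp add: equivariant[OF h])
    also have "\<dots> = f"
      unfolding f_def by (rule sum.reindex_bij_betw[OF bij])
    finally show "h (poly.coeff f i) = poly.coeff f i" by (metis h.coeff_map)
  qed
  then have "map_poly to_ac (map_poly of_ac f) = f"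
    by (intro poly_eqI) (simp add: to_ac.coeff_map coeff_map_poly to_ac_of_ac)
  moreover have "\<forall>\<alpha>\<in>S. [:- \<alpha>, 1:] ^ m dvd f - [:\<psi> \<alpha>:]"
    unfolding f_def using primary_idem_interpolates[OF fin] by blast
  ultimately show ?thesis by (intro exI[of _ "map_poly of_ac f"]) simp
qed

section \<open>Equivariant characters of a finite set of eigenvalues\<close>

text \<open>A field of characteristic \<open>0\<close> is a vector space over the rationals. For each nonzero \<open>d\<close> some linear functional
does not vanish at \<open>d\<close>, and finitely many functionals combine with generic coefficients.\<close>

lemma rational_functional_nonvanishing:
  fixes D :: "'c::field_char_0 set"
  assumes "finite D" "0 \<notin> D"
  shows "\<exists>\<phi> :: 'c \<Rightarrow> rat. (\<forall>x y. \<phi> (x + y) = \<phi> x + \<phi> y) \<and> (\<forall>d\<in>D. \<phi> d \<noteq> 0)"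
  using assms
proof (induction D rule: finite_induct)
  case empty
  show ?case by (rule exI[of _ "\<lambda>_. 0"]) simp
next
  case (insert d D)
  then obtain \<phi> :: "'c \<Rightarrow> rat" where \<phi>: "\<And>x y. \<phi> (x + y) = \<phi> x + \<phi> y" "\<And>d. d \<in> D \<Longrightarrow> \<phi> d \<noteq> 0"
    by auto
  interpret rat: vector_space "\<lambda>q (x :: 'c). of_rat q * x"
  proof
    fix a b :: rat and x y :: 'c
    show "of_rat a * (x + y) = of_rat a * x + of_rat a * y" by (rule distrib_left)
    show "of_rat (a + b) * x = of_rat a * x + of_rat b * x" by (simp only: of_rat_add distrib_right)
    show "of_rat a * (of_rat b * x) = of_rat (a * b) * x" by (simp only: of_rat_mult mult.assoc)
    show "of_rat 1 * x = x" by simp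
  qed
  have ind: "rat.independent {d}"
    using insert.prems rat.dependent_single by auto
  let ?B = "rat.extend_basis {d}"
  define \<omega> where "\<omega> x = rat.representation ?B x d" for x
  have B: "rat.independent ?B" "rat.span ?B = UNIV" "d \<in> ?B"
    using rat.independent_extend_basis[OF ind] rat.span_extend_basis[OF ind]
      rat.extend_basis_superset[OF ind] by auto
  have \<omega>: "\<omega> (x + y) = \<omega> x + \<omega> y" "\<omega> d = 1" for x y
    using B by (simp_all add: \<omega>_def rat.representation_add rat.representation_basis)
  obtain q where q: "q \<notin> (\<lambda>c. - \<phi> c / \<omega> c) ` insert d D"
    using ex_new_if_finite[OF infinite_UNIV_char_0, of "(\<lambda>c. - \<phi> c / \<omega> c) ` insert d D"] insert.hyps
    by auto
  have "\<phi> c + q * \<omega> c \<noteq> 0" if "c \<in> insert d D" for c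
  proof (cases "\<omega> c = 0")
    case True
    then show ?thesis using that \<omega>(2) \<phi>(2) by auto
  next
    case False
    then show ?thesis using q that by (force simp: field_simps eq_neg_iff_add_eq_0)
  qed
  then show ?case
    by (intro exI[of _ "\<lambda>x. \<phi> x + q * \<omega> x"]) (simp add: \<phi>(1) \<omega>(1) algebra_simps)
qed

lemma common_denominator:
  assumes "finite (A :: rat set)"
  shows "\<exists>N :: int. N > 0 \<and> (\<forall>r\<in>A. of_int N * r \<in> \<int>)"
  using assms
proof (induction A rule: finite_induct)
  case empty
  show ?case by (rule exI[of _ 1]) simp
next
  case (insert r A)
  then obtain N :: int where N: "N > 0" "\<And>r. r \<in> A \<Longrightarrow> of_int N * r \<in> \<int>" by auto
  obtain a b :: int where ab: "r = of_int a / of_int b" "b > 0"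
    by (metis Rat_cases Fract_of_int_quotient)
  have "of_int (N * b) * r = of_int (N * a)" using ab by (simp add: field_simps)
  then have "of_int (N * b) * r \<in> \<int>" by (metis Ints_of_int)
  moreover have "of_int (N * b) * s \<in> \<int>" if "s \<in> A" for s
    using Ints_mult[OF Ints_of_int[of b] N(2)[OF that]] by (simp add: mult_ac)
  ultimately show ?case using N(1) ab(2) by (intro exI[of _ "N * b"]) auto
qed

text \<open>The functional is made nonzero on all differences of elements of \<open>S\<close>, and its finitely many denominators are cleared.\<close>

lemma integral_additive_labelling:
  fixes S :: "'c::field_char_0 set"
  assumes "finite S"
  obtains \<nu> :: "'c \<Rightarrow> int" where "inj_on \<nu> S"
    and "\<And>\<alpha> \<beta>. \<alpha> \<in> S \<Longrightarrow> \<beta> \<in> S \<Longrightarrow> \<alpha> + \<beta> \<in> S \<Longrightarrow> \<nu> (\<alpha> + \<beta>) = \<nu> \<alpha> + \<nu> \<beta>"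
proof -
  let ?D = "(\<lambda>(\<alpha>, \<beta>). \<alpha> - \<beta>) ` {(\<alpha>, \<beta>) \<in> S \<times> S. \<alpha> \<noteq> \<beta>}"
  have "finite {(\<alpha>, \<beta>) \<in> S \<times> S. \<alpha> \<noteq> \<beta>}"
    by (rule finite_subset[of _ "S \<times> S"]) (use assms in auto)
  then have "finite ?D" by (rule finite_imageI)
  moreover have "0 \<notin> ?D" by auto
  ultimately obtain \<phi> :: "'c \<Rightarrow> rat"
    where \<phi>: "\<forall>x y. \<phi> (x + y) = \<phi> x + \<phi> y" "\<forall>d\<in>?D. \<phi> d \<noteq> 0"
    using rational_functional_nonvanishing[of ?D] by auto
  obtain N :: int where N: "N > 0" "\<And>r. r \<in> \<phi> ` S \<Longrightarrow> of_int N * r \<in> \<int>"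
    using common_denominator[of "\<phi> ` S"] assms by auto
  define \<nu> where "\<nu> \<alpha> = \<lfloor>of_int N * \<phi> \<alpha>\<rfloor>" for \<alpha>
  have \<nu>: "of_int (\<nu> \<alpha>) = of_int N * \<phi> \<alpha>" if "\<alpha> \<in> S" for \<alpha>
    unfolding \<nu>_def using N(2)[OF imageI[OF that]] by (intro of_int_floor_cancel[THEN iffD2]) (auto elim: Ints_cases)
  have diff: "\<phi> (\<alpha> - \<beta>) = \<phi> \<alpha> - \<phi> \<beta>" for \<alpha> \<beta>
    using \<phi>(1)[rule_format, of "\<alpha> - \<beta>" \<beta>] by simp
  show ?thesis
  proof (rule that[of \<nu>])
    show "inj_on \<nu> S"
    proof (rule inj_onI)
      fix \<alpha> \<beta> assume *: "\<alpha> \<in> S" "\<beta> \<in> S" "\<nu> \<alpha> = \<nu> \<beta>"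
      then have "\<phi> (\<alpha> - \<beta>) = 0" using \<nu>[of \<alpha>] \<nu>[of \<beta>] N(1) by (simp add: diff)
      then have "\<alpha> - \<beta> \<notin> ?D" using \<phi>(2) by blast
      then show "\<alpha> = \<beta>" using * by (auto simp: image_iff)
    qed
    show "\<nu> (\<alpha> + \<beta>) = \<nu> \<alpha> + \<nu> \<beta>" if "\<alpha> \<in> S" "\<beta> \<in> S" "\<alpha> + \<beta> \<in> S" for \<alpha> \<beta>
    proof -
      have "of_int (\<nu> (\<alpha> + \<beta>)) = (of_int (\<nu> \<alpha> + \<nu> \<beta>) :: rat)"
        using that by (simp add: \<nu> \<phi>(1) algebra_simps)
      then show ?thesis by (simp only: of_int_eq_iff)
    qed
  qed
qed

lemma ac_endo_comp: "ac_endo g \<Longrightarrow> ac_endo h \<Longrightarrow> ac_endo (g \<circ> h)"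
  by (simp add: ac_endo_def ac_endo_axioms_def field_hom_def)

text \<open>Averaging a labelling over the finite group by which the endomorphisms permute \<open>S\<close> would make it constant on
orbits. Averaging the product \<open>\<nu> \<alpha> * \<nu> \<beta>\<close> instead keeps enough information: the resulting invariant form is
a sum of squares on the diagonal, also at the formal difference of \<open>\<alpha>\<close> and \<open>\<alpha>'\<close>, so \<open>\<alpha>\<close> and \<open>\<alpha>'\<close> can pair equally with all of \<open>S\<close> only if \<open>\<nu> \<alpha> = \<nu> \<alpha>'\<close>.\<close>

lemma invariant_exponents:
  fixes S :: "'k::field_char_0 alg_closure set"
  assumes fin: "finite S"
    and stable: "\<And>h. ac_endo h \<Longrightarrow> h ` S \<subseteq> S"
  obtains n :: "'k alg_closure \<Rightarrow> 'k alg_closure \<Rightarrow> int"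
  where "\<And>h \<alpha> \<beta>. ac_endo h \<Longrightarrow> \<alpha> \<in> S \<Longrightarrow> \<beta> \<in> S \<Longrightarrow> n (h \<alpha>) (h \<beta>) = n \<alpha> \<beta>"
    and "\<And>\<alpha> \<alpha>' \<beta>. \<alpha> \<in> S \<Longrightarrow> \<alpha>' \<in> S \<Longrightarrow> \<alpha> + \<alpha>' \<in> S \<Longrightarrow> n (\<alpha> + \<alpha>') \<beta> = n \<alpha> \<beta> + n \<alpha>' \<beta>"
    and "\<And>\<alpha> \<alpha>'. \<alpha> \<in> S \<Longrightarrow> \<alpha>' \<in> S \<Longrightarrow> \<alpha> \<noteq> \<alpha>' \<Longrightarrow> \<exists>\<beta>\<in>S. n \<alpha> \<beta> \<noteq> n \<alpha>' \<beta>"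
proof -
  obtain \<nu> :: "'k alg_closure \<Rightarrow> int" where inj: "inj_on \<nu> S"
    and additive: "\<And>\<alpha> \<beta>. \<alpha> \<in> S \<Longrightarrow> \<beta> \<in> S \<Longrightarrow> \<alpha> + \<beta> \<in> S \<Longrightarrow> \<nu> (\<alpha> + \<beta>) = \<nu> \<alpha> + \<nu> \<beta>"
    using integral_additive_labelling[OF fin] by metis
  let ?G = "(\<lambda>h. restrict h S) ` Collect ac_endo"
  \<comment> \<open>restricting to \<open>S\<close> makes the set of endomorphisms finite\<close>
  define n where "n \<alpha> \<beta> = (\<Sum>\<sigma>\<in>?G. \<nu> (\<sigma> \<alpha>) * \<nu> (\<sigma> \<beta>))" for \<alpha> \<beta>
  have "h x \<in> S" if "ac_endo h" "x \<in> S" for h x using stable[OF that(1)] that(2) by blast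
  then have "?G \<subseteq> S \<rightarrow>\<^sub>E S" by auto
  then have finG: "finite ?G" using finite_PiE[OF fin, of "\<lambda>_. S"] fin finite_subset by blast
  have "ac_endo (\<lambda>x. x)" by unfold_locales auto
  then have idG: "restrict (\<lambda>x. x) S \<in> ?G" by blast
  show ?thesis
  proof (rule that[of n])
    fix h :: "'k alg_closure \<Rightarrow> 'k alg_closure" and \<alpha> \<beta>
    assume h: "ac_endo h" and ab: "\<alpha> \<in> S" "\<beta> \<in> S"
    have bij: "bij_betw h S S" using ac_endo_permutes[OF h fin stable[OF h]] .
    \<comment> \<open>\<open>\<sigma> \<mapsto> \<sigma> \<circ> h\<close> permutes the summands\<close>
    let ?\<tau> = "\<lambda>\<sigma>. restrict (\<sigma> \<circ> h) S"
    have into: "?\<tau> ` ?G \<subseteq> ?G"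
    proof (rule image_subsetI)
      fix \<sigma> assume "\<sigma> \<in> ?G"
      then obtain g where g: "ac_endo g" "\<sigma> = restrict g S" by blast
      then have "?\<tau> \<sigma> = restrict (g \<circ> h) S" using stable[OF h] by (auto simp: restrict_def fun_eq_iff)
      then show "?\<tau> \<sigma> \<in> ?G" using ac_endo_comp[OF g(1) h] by blast
    qed
    have "inj_on ?\<tau> ?G"
    proof (rule inj_onI)
      fix \<sigma> \<sigma>' assume s: "\<sigma> \<in> ?G" "\<sigma>' \<in> ?G" "?\<tau> \<sigma> = ?\<tau> \<sigma>'"
      have "\<sigma> x = \<sigma>' x" if "x \<in> S" for x
      proof -
        obtain y where y: "y \<in> S" "x = h y" using bij \<open>x \<in> S\<close> by (auto simp: bij_betw_def)
        then show ?thesis using fun_cong[OF s(3), of y] by simp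
      qed
      moreover have "\<sigma> \<in> extensional S" "\<sigma>' \<in> extensional S" using s by auto
      ultimately show "\<sigma> = \<sigma>'" by (metis extensionalityI)
    qed
    then have bijG: "bij_betw ?\<tau> ?G ?G" using into finG by (simp add: bij_betw_def endo_inj_surj)
    have "n (h \<alpha>) (h \<beta>) = (\<Sum>\<sigma>\<in>?G. \<nu> (?\<tau> \<sigma> \<alpha>) * \<nu> (?\<tau> \<sigma> \<beta>))"
      unfolding n_def using ab by simp
    also have "\<dots> = n \<alpha> \<beta>"
      unfolding n_def by (rule sum.reindex_bij_betw[OF bijG])
    finally show "n (h \<alpha>) (h \<beta>) = n \<alpha> \<beta>" .
  next
    fix \<alpha> \<alpha>' \<beta> assume a: "\<alpha> \<in> S" "\<alpha>' \<in> S" "\<alpha> + \<alpha>' \<in> S"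
    have "\<nu> (\<sigma> (\<alpha> + \<alpha>')) = \<nu> (\<sigma> \<alpha>) + \<nu> (\<sigma> \<alpha>')" if "\<sigma> \<in> ?G" for \<sigma>
    proof -
      obtain g where g: "ac_endo g" "\<sigma> = restrict g S" using \<open>\<sigma> \<in> ?G\<close> by blast
      interpret g: ac_endo g by fact
      have "g \<alpha> \<in> S" "g \<alpha>' \<in> S" "g \<alpha> + g \<alpha>' \<in> S"
        using stable[OF g(1)] a by (auto simp: g.add[symmetric])
      then show ?thesis using a g(2) additive by (simp add: g.add)
    qed
    then show "n (\<alpha> + \<alpha>') \<beta> = n \<alpha> \<beta> + n \<alpha>' \<beta>"
      by (simp add: n_def algebra_simps sum.distrib)
  next
    fix \<alpha> \<alpha>' assume a: "\<alpha> \<in> S" "\<alpha>' \<in> S" "\<alpha> \<noteq> \<alpha>'"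
    show "\<exists>\<beta>\<in>S. n \<alpha> \<beta> \<noteq> n \<alpha>' \<beta>"
    proof (rule ccontr)
      assume "\<not> ?thesis"
      then have "n \<alpha> \<alpha> = n \<alpha>' \<alpha>" "n \<alpha> \<alpha>' = n \<alpha>' \<alpha>'" using a by auto
      \<comment> \<open>the form at the formal difference of \<open>\<alpha>\<close> and \<open>\<alpha>'\<close>, expanded bilinearly\<close>
      moreover have "(\<Sum>\<sigma>\<in>?G. (\<nu> (\<sigma> \<alpha>) - \<nu> (\<sigma> \<alpha>'))\<^sup>2)
          = n \<alpha> \<alpha> - n \<alpha> \<alpha>' - n \<alpha>' \<alpha> + n \<alpha>' \<alpha>'"
        unfolding n_def sum_subtractf[symmetric] sum.distrib[symmetric]
        by (intro sum.cong refl) (simp add: power2_eq_square algebra_simps)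
      ultimately have "(\<Sum>\<sigma>\<in>?G. (\<nu> (\<sigma> \<alpha>) - \<nu> (\<sigma> \<alpha>'))\<^sup>2) = 0"
        by simp
      then have "\<forall>\<sigma>\<in>?G. (\<nu> (\<sigma> \<alpha>) - \<nu> (\<sigma> \<alpha>'))\<^sup>2 = 0"
        using finG by (subst (asm) sum_nonneg_eq_0_iff) auto
      from bspec[OF this idG] have "\<nu> \<alpha> = \<nu> \<alpha>'" using a by simp
      then show False using inj a by (auto simp: inj_on_def)
    qed
  qed
qed

text \<open>Separating positive and negative exponents turns the relation into an equation between two products of linear factors
with different sets of roots, hence into a nontrivial polynomial equation.\<close>

lemma finite_multiplicative_relation:
  fixes S :: "'c::field_char_0 set" and d :: "'c \<Rightarrow> int"
  assumes fin: "finite S" and \<beta>: "\<beta> \<in> S" "d \<beta> \<noteq> 0"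
  shows "finite {x. x \<notin> S \<and> (\<Prod>\<beta>\<in>S. (x - \<beta>) powi d \<beta>) = 1}"
proof -
  define P where "P d = (\<Prod>\<beta>\<in>S. [:- \<beta>, 1:] ^ nat (d \<beta>))" for d :: "'c \<Rightarrow> int"
  have root: "poly (P d) \<beta> = 0" if "d \<beta> > 0" for d
    unfolding P_def poly_prod using fin \<beta>(1) that by (intro prod_zero) (auto intro!: bexI[of _ \<beta>])
  have nonroot: "poly (P d) \<beta> \<noteq> 0" if "d \<beta> \<le> 0" for d
    unfolding P_def poly_prod using fin that by (auto simp: prod_zero_iff)
  have "P d - P (\<lambda>\<beta>. - d \<beta>) \<noteq> 0"
    using root[of d] nonroot[of d] root[of "\<lambda>\<beta>. - d \<beta>"] nonroot[of "\<lambda>\<beta>. - d \<beta>"] \<beta>(2)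
    by (cases "d \<beta> > 0") auto
  then have "finite {x. poly (P d - P (\<lambda>\<beta>. - d \<beta>)) x = 0}" by (rule poly_roots_finite)
  moreover have "poly (P d - P (\<lambda>\<beta>. - d \<beta>)) x = 0"
    if x: "x \<notin> S" "(\<Prod>\<beta>\<in>S. (x - \<beta>) powi d \<beta>) = 1" for x
  proof -
    have "(x - \<beta>) powi d \<beta> * (x - \<beta>) ^ nat (- d \<beta>) = (x - \<beta>) ^ nat (d \<beta>)" if "\<beta> \<in> S" for \<beta>
    proof -
      have "x - \<beta> \<noteq> 0" using that x(1) by auto
      then show ?thesis by (cases "d \<beta> \<ge> 0") (auto simp: power_int_def power_mult_distrib[symmetric])
    qed
    then have "(\<Prod>\<beta>\<in>S. (x - \<beta>) powi d \<beta>) * (\<Prod>\<beta>\<in>S. (x - \<beta>) ^ nat (- d \<beta>)) = (\<Prod>\<beta>\<in>S. (x - \<beta>) ^ nat (d \<beta>))"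
      unfolding prod.distrib[symmetric] by (rule prod.cong[OF refl])
    then show ?thesis using x(2) by (simp add: P_def poly_prod)
  qed
  ultimately show ?thesis by (auto intro: finite_subset[rotated])
qed

text \<open>With the exponents of \<open>invariant_exponents\<close>, the product of the \<open>(s - \<beta>) powi n \<alpha> \<beta>\<close> has all properties except
injectivity for every \<open>s\<close> of the ground field outside \<open>S\<close>; by \<open>finite_multiplicative_relation\<close> injectivity fails
for finitely many \<open>s\<close> only.\<close>

lemma equivariant_character:
  fixes S :: "'k::field_char_0 alg_closure set"
  assumes fin: "finite S"
    and stable: "\<And>h. ac_endo h \<Longrightarrow> h ` S \<subseteq> S"
  obtains \<chi> :: "'k alg_closure \<Rightarrow> 'k alg_closure"
  where "\<And>\<alpha>. \<alpha> \<in> S \<Longrightarrow> \<chi> \<alpha> \<noteq> 0"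
    and "inj_on \<chi> S"
    and "\<And>h \<alpha>. ac_endo h \<Longrightarrow> \<alpha> \<in> S \<Longrightarrow> \<chi> (h \<alpha>) = h (\<chi> \<alpha>)"
    and "\<And>\<alpha> \<beta>. \<alpha> \<in> S \<Longrightarrow> \<beta> \<in> S \<Longrightarrow> \<alpha> + \<beta> \<in> S \<Longrightarrow> \<chi> (\<alpha> + \<beta>) = \<chi> \<alpha> * \<chi> \<beta>"
proof (rule invariant_exponents[OF fin stable])
  fix n :: "'k alg_closure \<Rightarrow> 'k alg_closure \<Rightarrow> int"
  assume inv: "\<And>h \<alpha> \<beta>. ac_endo h \<Longrightarrow> \<alpha> \<in> S \<Longrightarrow> \<beta> \<in> S \<Longrightarrow> n (h \<alpha>) (h \<beta>) = n \<alpha> \<beta>"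
    and additive: "\<And>\<alpha> \<alpha>' \<beta>. \<alpha> \<in> S \<Longrightarrow> \<alpha>' \<in> S \<Longrightarrow> \<alpha> + \<alpha>' \<in> S \<Longrightarrow> n (\<alpha> + \<alpha>') \<beta> = n \<alpha> \<beta> + n \<alpha>' \<beta>"
    and sep: "\<And>\<alpha> \<alpha>'. \<alpha> \<in> S \<Longrightarrow> \<alpha>' \<in> S \<Longrightarrow> \<alpha> \<noteq> \<alpha>' \<Longrightarrow> \<exists>\<beta>\<in>S. n \<alpha> \<beta> \<noteq> n \<alpha>' \<beta>"
  let ?bad = "\<lambda>\<alpha> \<alpha>'. {x. x \<notin> S \<and> (\<Prod>\<beta>\<in>S. (x - \<beta>) powi (n \<alpha> \<beta> - n \<alpha>' \<beta>)) = 1}"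
  have "finite (?bad \<alpha> \<alpha>')" if "\<alpha> \<in> S" "\<alpha>' \<in> S" "\<alpha> \<noteq> \<alpha>'" for \<alpha> \<alpha>'
  proof -
    obtain \<beta> where "\<beta> \<in> S" "n \<alpha> \<beta> - n \<alpha>' \<beta> \<noteq> 0" using sep \<open>\<alpha> \<in> S\<close> \<open>\<alpha>' \<in> S\<close> \<open>\<alpha> \<noteq> \<alpha>'\<close> by force
    then show ?thesis by (rule finite_multiplicative_relation[OF fin])
  qed
  then have "finite (S \<union> (\<Union>\<alpha>\<in>S. \<Union>\<alpha>'\<in>S - {\<alpha>}. ?bad \<alpha> \<alpha>'))" using fin by auto
  then have "finite (to_ac -` (S \<union> (\<Union>\<alpha>\<in>S. \<Union>\<alpha>'\<in>S - {\<alpha>}. ?bad \<alpha> \<alpha>')))"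
    using inj_to_ac by (rule finite_vimageI)
  then obtain s :: 'k where "s \<notin> to_ac -` (S \<union> (\<Union>\<alpha>\<in>S. \<Union>\<alpha>'\<in>S - {\<alpha>}. ?bad \<alpha> \<alpha>'))"
    using ex_new_if_finite[OF infinite_UNIV_char_0] by blast
  then have s: "to_ac s \<notin> S"
    and good: "\<And>\<alpha> \<alpha>'. \<alpha> \<in> S \<Longrightarrow> \<alpha>' \<in> S \<Longrightarrow> \<alpha> \<noteq> \<alpha>' \<Longrightarrow>
      (\<Prod>\<beta>\<in>S. (to_ac s - \<beta>) powi (n \<alpha> \<beta> - n \<alpha>' \<beta>)) \<noteq> 1" by auto
  define \<chi> where "\<chi> \<alpha> = (\<Prod>\<beta>\<in>S. (to_ac s - \<beta>) powi n \<alpha> \<beta>)" for \<alpha>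
  have nz: "to_ac s - \<beta> \<noteq> 0" if "\<beta> \<in> S" for \<beta> using s that by auto
  then have \<chi>0: "\<chi> \<alpha> \<noteq> 0" for \<alpha> unfolding \<chi>_def using fin by (simp add: power_int_eq_0_iff)
  show ?thesis
  proof (rule that[of \<chi>, OF \<chi>0])
    show "inj_on \<chi> S"
    proof (rule inj_onI, rule ccontr)
      fix \<alpha> \<alpha>' assume a: "\<alpha> \<in> S" "\<alpha>' \<in> S" "\<chi> \<alpha> = \<chi> \<alpha>'" "\<alpha> \<noteq> \<alpha>'"
      have "(\<Prod>\<beta>\<in>S. (to_ac s - \<beta>) powi (n \<alpha> \<beta> - n \<alpha>' \<beta>)) = \<chi> \<alpha> / \<chi> \<alpha>'"
        unfolding \<chi>_def prod_dividef[symmetric]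
        by (intro prod.cong refl) (use nz in \<open>simp add: power_int_diff\<close>)
      then show False using good a \<chi>0 by simp
    qed
    show "\<chi> (h \<alpha>) = h (\<chi> \<alpha>)" if h: "ac_endo h" and \<alpha>: "\<alpha> \<in> S" for h \<alpha>
    proof -
      interpret h: ac_endo h by fact
      have bij: "bij_betw h S S" using ac_endo_permutes[OF h fin stable[OF h]] .
      have "\<chi> (h \<alpha>) = (\<Prod>\<beta>\<in>S. (to_ac s - h \<beta>) powi n (h \<alpha>) (h \<beta>))"
        unfolding \<chi>_def by (rule prod.reindex_bij_betw[OF bij, symmetric])
      also have "\<dots> = h (\<chi> \<alpha>)"
        unfolding \<chi>_def h.prod by (intro prod.cong refl)
          (simp add: inv[OF h \<alpha>] h.power_int h.diff h.to_ac)
      finally show ?thesis .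
    qed
    show "\<chi> (\<alpha> + \<beta>) = \<chi> \<alpha> * \<chi> \<beta>" if "\<alpha> \<in> S" "\<beta> \<in> S" "\<alpha> + \<beta> \<in> S" for \<alpha> \<beta>
      unfolding \<chi>_def prod.distrib[symmetric]
      by (intro prod.cong refl) (use nz that in \<open>simp add: additive power_int_add\<close>)
  qed
qed

section \<open>Polynomials in a linear operator\<close>

text \<open>A copy of \<^locale>\<open>vector_space\<close> that carries the additional notions. Declared in
\<^locale>\<open>vector_space\<close> itself, their names would be shadowed by its existing interpretations.\<close>

locale op_space = vector_space scale
  for scale :: "'a::field \<Rightarrow> 'b::ab_group_add \<Rightarrow> 'b"
begin

abbreviation lin_op :: "('b \<Rightarrow> 'b) \<Rightarrow> bool"
  where "lin_op T \<equiv> Vector_Spaces.linear scale scale T"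

lemma lin_iff: "lin_op T \<longleftrightarrow> (\<forall>x y. T (x + y) = T x + T y) \<and> (\<forall>c x. T (scale c x) = scale c (T x))"
  by (simp add: Vector_Spaces.linear_iff vector_space_axioms)

lemma lin_add: "lin_op T \<Longrightarrow> T (x + y) = T x + T y"
  and lin_scale: "lin_op T \<Longrightarrow> T (scale c x) = scale c (T x)"
  by (simp_all add: lin_iff)

lemma lin_zero: "lin_op T \<Longrightarrow> T 0 = 0"
  using lin_scale[of T 0 0] by simp

lemma lin_neg: "lin_op T \<Longrightarrow> T (- x) = - T x"
  using lin_scale[of T "- 1" x] by simp

lemma lin_diff: "lin_op T \<Longrightarrow> T (x - y) = T x - T y"
  using lin_add[of T x "- y"] by (simp add: lin_neg)

lemma lin_sum: "lin_op T \<Longrightarrow> T (sum f A) = (\<Sum>x\<in>A. T (f x))"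
  by (induction A rule: infinite_finite_induct) (simp_all add: lin_zero lin_add)

lemma lin_comp: "lin_op S \<Longrightarrow> lin_op T \<Longrightarrow> lin_op (\<lambda>x. S (T x))"
  by (simp add: lin_iff)

lemma lin_plus: "lin_op S \<Longrightarrow> lin_op T \<Longrightarrow> lin_op (\<lambda>x. S x + T x)"
  by (simp add: lin_iff algebra_simps scale_right_distrib)

lemma lin_minus: "lin_op S \<Longrightarrow> lin_op T \<Longrightarrow> lin_op (\<lambda>x. S x - T x)"
  by (simp add: lin_iff algebra_simps scale_right_diff_distrib)

lemma lin_funpow: "lin_op T \<Longrightarrow> lin_op (T ^^ n)"
  by (induction n) (simp_all add: lin_iff)

lemma funpow_commute:
  assumes "\<And>x. f (g x) = g (f x)"
  shows "(f ^^ n) (g x) = g ((f ^^ n) x)"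
  by (induction n) (simp_all add: assms)

definition poly_op :: "('b \<Rightarrow> 'b) \<Rightarrow> 'a poly \<Rightarrow> 'b \<Rightarrow> 'b"
  where "poly_op T p x = (\<Sum>i\<le>degree p. scale (poly.coeff p i) ((T ^^ i) x))"

lemma poly_op_pCons:
  assumes "lin_op T"
  shows "poly_op T (pCons a p) x = scale a x + T (poly_op T p x)"
proof (cases "p = 0")
  case True
  then show ?thesis by (simp add: poly_op_def lin_zero[OF assms])
next
  case False
  then have "poly_op T (pCons a p) x
      = (\<Sum>i\<le>Suc (degree p). scale (poly.coeff (pCons a p) i) ((T ^^ i) x))"
    by (simp add: poly_op_def)
  also have "\<dots> = scale a x + T (poly_op T p x)"
    unfolding sum.atMost_Suc_shift poly_op_def
    by (simp add: lin_sum[OF assms] lin_scale[OF assms])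
  finally show ?thesis .
qed

lemma poly_op_0: "poly_op T 0 x = 0"
  by (simp add: poly_op_def)

lemma poly_op_const: "poly_op T [:c:] x = scale c x"
  by (simp add: poly_op_def)

lemma poly_op_1: "poly_op T 1 x = x"
  using poly_op_const[of T 1 x] by (simp add: one_pCons)

lemma poly_op_add: "lin_op T \<Longrightarrow> poly_op T (p + q) x = poly_op T p x + poly_op T q x"
proof (induction p q rule: poly_induct2)
  case (pCons a p b q)
  then show ?case by (simp add: poly_op_pCons lin_add scale_left_distrib algebra_simps)
qed (simp add: poly_op_0)

lemma poly_op_smult: "lin_op T \<Longrightarrow> poly_op T ([:c:] * p) x = scale c (poly_op T p x)"
  by (induction p) (simp_all add: poly_op_0 poly_op_pCons lin_scale scale_right_distrib)

lemma poly_op_diff: "lin_op T \<Longrightarrow> poly_op T (p - q) x = poly_op T p x - poly_op T q x"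
  using poly_op_add[of T "p - q" q x] by simp

lemma poly_op_mult: "lin_op T \<Longrightarrow> poly_op T (p * q) x = poly_op T p (poly_op T q x)"
proof (induction p)
  case (pCons a p)
  have "pCons a p * q = [:a:] * q + pCons 0 (p * q)" by simp
  then have "poly_op T (pCons a p * q) x = poly_op T ([:a:] * q) x + poly_op T (pCons 0 (p * q)) x"
    using pCons.prems by (simp only: poly_op_add)
  then show ?case
    using pCons by (simp only: poly_op_smult poly_op_pCons) simp
qed (simp add: poly_op_0)

lemma poly_op_sum: "lin_op T \<Longrightarrow> poly_op T (sum f A) x = (\<Sum>a\<in>A. poly_op T (f a) x)"
  by (induction A rule: infinite_finite_induct) (simp_all add: poly_op_0 poly_op_add)

lemma poly_op_power: "lin_op T \<Longrightarrow> poly_op T (p ^ n) x = (poly_op T p ^^ n) x"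
  by (induction n arbitrary: x) (simp_all add: poly_op_1 poly_op_mult)

lemma poly_op_X: "lin_op T \<Longrightarrow> poly_op T [:0, 1:] x = T x"
  by (simp add: poly_op_pCons poly_op_const poly_op_0 lin_zero)

lemma poly_op_linear_factor: "lin_op T \<Longrightarrow> poly_op T [:- a, 1:] x = T x - scale a x"
  by (simp add: poly_op_pCons poly_op_0 lin_zero)

lemma poly_op_monom: "poly_op T (Polynomial.monom c n) x = scale c ((T ^^ n) x)"
proof (cases "c = 0")
  case False
  then have "poly_op T (Polynomial.monom c n) x = (\<Sum>i\<le>n. if i = n then scale c ((T ^^ n) x) else 0)"
    unfolding poly_op_def degree_monom_eq[OF False] by (intro sum.cong refl) auto
  then show ?thesis by simp
qed (simp add: poly_op_0)

lemma lin_poly_op: "lin_op T \<Longrightarrow> lin_op (poly_op T p)"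
proof (induction p)
  case 0
  then show ?case by (simp add: lin_iff poly_op_0)
next
  case (pCons a p)
  then show ?case
    by (simp add: lin_iff poly_op_pCons scale_right_distrib algebra_simps)
qed

lemma poly_op_commute:
  assumes "lin_op T" "lin_op U" "\<And>x. U (T x) = T (U x)"
  shows "U (poly_op T p x) = poly_op T p (U x)"
  using assms
  by (induction p) (simp_all add: poly_op_0 poly_op_pCons lin_zero lin_add lin_scale)

lemma poly_op_commute_poly_op:
  assumes "lin_op T" "lin_op U" "\<And>x. U (T x) = T (U x)"
  shows "poly_op U q (poly_op T p x) = poly_op T p (poly_op U q x)"
  by (intro poly_op_commute lin_poly_op assms poly_op_commute[symmetric] assms(3)[symmetric])

lemma poly_op_pcompose:
  assumes "lin_op T"
  shows "poly_op T (pcompose p q) x = poly_op (poly_op T q) p x"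
  by (induction p)
    (simp_all add: poly_op_0 poly_op_pCons pcompose_pCons poly_op_add poly_op_mult poly_op_const
      assms lin_poly_op)

lemma poly_op_mem:
  assumes "lin_op T" "subspace V" "\<And>x. x \<in> V \<Longrightarrow> T x \<in> V" "x \<in> V"
  shows "poly_op T p x \<in> V"
  using assms by (induction p) (simp_all add: poly_op_0 poly_op_pCons subspace_0 subspace_add subspace_scale)

lemma poly_op_cong_dvd:
  assumes "lin_op T" "\<And>y. poly_op T p y = 0" "p dvd q"
  shows "poly_op T q x = 0"
proof -
  obtain r where "q = p * r" using assms(3) by blast
  then show ?thesis by (simp add: poly_op_mult assms)
qed

lemma last_nonzero_iterate:
  assumes "lin_op N" "(N ^^ m) t = 0" "t \<noteq> 0"
  obtains j where "(N ^^ j) t \<noteq> 0" "N ((N ^^ j) t) = 0"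
proof -
  define k where "k = (LEAST k. (N ^^ k) t = 0)"
  have k: "(N ^^ k) t = 0" unfolding k_def using assms(2) by (rule LeastI)
  then have "k \<noteq> 0" using assms(3) by (cases k) auto
  then obtain j where j: "k = Suc j" by (cases k) auto
  then have "(N ^^ j) t \<noteq> 0" unfolding k_def using not_less_Least[of j] by (metis lessI)
  with k j that show ?thesis by simp
qed

text \<open>On the \<open>\<alpha>\<close>-part of \<open>U\<close> and the \<open>\<beta>\<close>-part of \<open>V\<close> the only generalized eigenvalue of \<open>U + V\<close> is \<open>\<alpha> + \<beta>\<close>.
The statement is that fact after subtracting the eigenvalues. Applying powers of \<open>U\<close> and \<open>V\<close> replaces a
nonzero \<open>t\<close> by a nonzero vector killed by both, on which \<open>W\<close> is the scalar \<open>c\<close>.\<close>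

lemma nilpotent_sum_shift_injective:
  assumes lin_op: "lin_op U" "lin_op V" "lin_op W"
    and comm: "\<And>v. U (V v) = V (U v)"
    and W: "\<And>v. W v = U v + V v + scale c v"
    and c: "c \<noteq> 0"
    and nil: "(U ^^ m) t = 0" "(V ^^ n) t = 0" "(W ^^ k) t = 0"
  shows "t = 0"
proof (rule ccontr)
  assume "t \<noteq> 0"
  have WU: "U (W v) = W (U v)" and WV: "V (W v) = W (V v)" for v
    by (simp_all add: W lin_op lin_add lin_scale comm)
  have swap: "(f ^^ i) ((g ^^ j) v) = (g ^^ j) ((f ^^ i) v)" if "\<And>v. f (g v) = g (f v)"
    for f g :: "'b \<Rightarrow> 'b" and i j v
    by (intro funpow_commute funpow_commute[symmetric] that[symmetric])
  obtain i where i: "(U ^^ i) t \<noteq> 0" "U ((U ^^ i) t) = 0"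
    using last_nonzero_iterate[OF lin_op(1) nil(1) \<open>t \<noteq> 0\<close>] by blast
  let ?t = "(U ^^ i) t"
  have "(V ^^ n) ?t = 0"
    using swap[of U V i n t] comm nil(2) lin_zero[OF lin_funpow[OF lin_op(1)]] by simp
  then obtain j where j: "(V ^^ j) ?t \<noteq> 0" "V ((V ^^ j) ?t) = 0"
    using last_nonzero_iterate[OF lin_op(2) _ i(1)] by blast
  let ?u = "(V ^^ j) ?t"
  have "U ?u = 0"
    using funpow_commute[of V U j ?t] comm i(2) lin_zero[OF lin_funpow[OF lin_op(2)]] by simp
  then have "W ?u = scale c ?u" by (simp add: W j(2))
  then have "(W ^^ l) ?u = scale (c ^ l) ?u" for l
    by (induction l) (simp_all add: lin_scale[OF lin_op(3)] mult.commute)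
  moreover have "(W ^^ k) ?u = 0"
  proof -
    have "(W ^^ k) ?t = 0"
      using swap[of U W i k t] WU nil(3) lin_zero[OF lin_funpow[OF lin_op(1)]] by simp
    then show ?thesis
      using swap[of V W j k ?t] WV lin_zero[OF lin_funpow[OF lin_op(2)]] by simp
  qed
  ultimately have "scale (c ^ k) ?u = 0" by simp
  then show False using c j(1) by simp
qed

text \<open>The idempotents split \<open>b\<close> into components on which \<open>U\<close>, \<open>V\<close> and \<open>W\<close> have single generalized eigenvalues
\<open>\<alpha>\<close>, \<open>\<beta>\<close> and \<open>\<gamma>\<close>, and on which \<open>f\<close> acts by the scalars \<open>\<psi> \<alpha>\<close>, \<open>\<psi> \<beta>\<close> and \<open>\<psi> \<gamma>\<close>. Only components with
\<open>\<gamma> = \<alpha> + \<beta>\<close> survive, so the rule for \<open>\<psi>\<close> on sums of eigenvalues becomes the same rule for \<open>f\<close> of \<open>W\<close>.\<close>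

lemma functional_calculus_of_sum:
  assumes lin_op: "lin_op U" "lin_op V" "lin_op W"
    and comm: "\<And>v. U (V v) = V (U v)"
    and W: "\<And>v. W v = U v + V v"
    and fin: "finite S"
    and kill: "\<And>p. (\<And>\<alpha>. \<alpha> \<in> S \<Longrightarrow> [:- \<alpha>, 1:] ^ m dvd p) \<Longrightarrow>
        poly_op U p b = 0 \<and> poly_op V p b = 0 \<and> poly_op W p b = 0"
    and f: "\<And>\<alpha>. \<alpha> \<in> S \<Longrightarrow> [:- \<alpha>, 1:] ^ m dvd f - [:\<psi> \<alpha>:]"
  shows "(\<And>\<alpha> \<beta>. \<alpha> \<in> S \<Longrightarrow> \<beta> \<in> S \<Longrightarrow> \<alpha> + \<beta> \<in> S \<Longrightarrow> \<psi> (\<alpha> + \<beta>) = \<psi> \<alpha> * \<psi> \<beta>) \<Longrightarrow>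
      poly_op W f b = poly_op U f (poly_op V f b)"
    and "(\<And>\<alpha> \<beta>. \<alpha> \<in> S \<Longrightarrow> \<beta> \<in> S \<Longrightarrow> \<alpha> + \<beta> \<in> S \<Longrightarrow> \<psi> (\<alpha> + \<beta>) = \<psi> \<alpha> + \<psi> \<beta>) \<Longrightarrow>
      poly_op W f b = poly_op U f b + poly_op V f b"
proof -
  let ?e = "primary_idem S m"
  define t where "t \<alpha> \<beta> \<gamma> = poly_op U (?e \<alpha>) (poly_op V (?e \<beta>) (poly_op W (?e \<gamma>) b))" for \<alpha> \<beta> \<gamma>
  have WU: "U (W v) = W (U v)" and WV: "V (W v) = W (V v)" for v
    by (simp_all add: W lin_op lin_add comm)
  note UV = poly_op_commute_poly_op[OF lin_op(2) lin_op(1) comm]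
  note UW = poly_op_commute_poly_op[OF lin_op(3) lin_op(1) WU]
  note VW = poly_op_commute_poly_op[OF lin_op(3) lin_op(2) WV]
  note zero = lin_zero[OF lin_poly_op[OF lin_op(1)]] lin_zero[OF lin_poly_op[OF lin_op(2)]]
    lin_zero[OF lin_poly_op[OF lin_op(3)]]
  have tU: "poly_op U p (t \<alpha> \<beta> \<gamma>) = poly_op V (?e \<beta>) (poly_op W (?e \<gamma>) (poly_op U (p * ?e \<alpha>) b))"
    and tV: "poly_op V p (t \<alpha> \<beta> \<gamma>) = poly_op U (?e \<alpha>) (poly_op W (?e \<gamma>) (poly_op V (p * ?e \<beta>) b))"
    and tW: "poly_op W p (t \<alpha> \<beta> \<gamma>) = poly_op U (?e \<alpha>) (poly_op V (?e \<beta>) (poly_op W (p * ?e \<gamma>) b))"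
    for p \<alpha> \<beta> \<gamma>
    by (simp_all only: t_def poly_op_mult[OF lin_op(1)] poly_op_mult[OF lin_op(2)] poly_op_mult[OF lin_op(3)] UV UW VW)
  have ideal: "\<delta> \<in> S \<Longrightarrow> [:- \<delta>, 1:] ^ m dvd p * ?e \<alpha>"
    if "\<alpha> \<in> S" "[:- \<alpha>, 1:] ^ m dvd p" for p \<alpha> \<delta>
    using that primary_idem_off[OF fin, of \<delta> \<alpha> m] by (cases "\<delta> = \<alpha>") auto
  have kU: "poly_op U p (t \<alpha> \<beta> \<gamma>) = 0" if "\<alpha> \<in> S" "[:- \<alpha>, 1:] ^ m dvd p" for p \<alpha> \<beta> \<gamma>
    unfolding tU using kill[of "p * ?e \<alpha>"] ideal[OF that] zero by simp
  have kV: "poly_op V p (t \<alpha> \<beta> \<gamma>) = 0" if "\<beta> \<in> S" "[:- \<beta>, 1:] ^ m dvd p" for p \<alpha> \<beta> \<gamma>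
    unfolding tV using kill[of "p * ?e \<beta>"] ideal[OF that] zero by simp
  have kW: "poly_op W p (t \<alpha> \<beta> \<gamma>) = 0" if "\<gamma> \<in> S" "[:- \<gamma>, 1:] ^ m dvd p" for p \<alpha> \<beta> \<gamma>
    unfolding tW using kill[of "p * ?e \<gamma>"] ideal[OF that] zero by simp
  have eU: "poly_op U f (t \<alpha> \<beta> \<gamma>) = scale (\<psi> \<alpha>) (t \<alpha> \<beta> \<gamma>)" if "\<alpha> \<in> S" for \<alpha> \<beta> \<gamma>
    using kU[OF that f[OF that]] by (simp add: poly_op_diff lin_op poly_op_const)
  have eV: "poly_op V f (t \<alpha> \<beta> \<gamma>) = scale (\<psi> \<beta>) (t \<alpha> \<beta> \<gamma>)" if "\<beta> \<in> S" for \<alpha> \<beta> \<gamma>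
    using kV[OF that f[OF that]] by (simp add: poly_op_diff lin_op poly_op_const)
  have eW: "poly_op W f (t \<alpha> \<beta> \<gamma>) = scale (\<psi> \<gamma>) (t \<alpha> \<beta> \<gamma>)" if "\<gamma> \<in> S" for \<alpha> \<beta> \<gamma>
    using kW[OF that f[OF that]] by (simp add: poly_op_diff lin_op poly_op_const)
  \<comment> \<open>generalized eigenvalues add up\<close>
  have vanish: "t \<alpha> \<beta> \<gamma> = 0" if S: "\<alpha> \<in> S" "\<beta> \<in> S" "\<gamma> \<in> S" and ne: "\<alpha> + \<beta> \<noteq> \<gamma>" for \<alpha> \<beta> \<gamma>
  proof (rule nilpotent_sum_shift_injective)
    let ?U = "poly_op U [:- \<alpha>, 1:]" and ?V = "poly_op V [:- \<beta>, 1:]" and ?W = "poly_op W [:- \<gamma>, 1:]"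
    show "lin_op ?U" "lin_op ?V" "lin_op ?W" by (intro lin_poly_op lin_op)+
    show "?U (?V v) = ?V (?U v)" for v by (rule UV)
    show "?W v = ?U v + ?V v + scale (\<alpha> + \<beta> - \<gamma>) v" for v
      by (simp add: poly_op_linear_factor lin_op W scale_left_distrib scale_left_diff_distrib)
    show "\<alpha> + \<beta> - \<gamma> \<noteq> 0" using ne by simp
    show "(?U ^^ m) (t \<alpha> \<beta> \<gamma>) = 0" using kU[OF S(1) dvd_refl] by (simp only: poly_op_power lin_op)
    show "(?V ^^ m) (t \<alpha> \<beta> \<gamma>) = 0" using kV[OF S(2) dvd_refl] by (simp only: poly_op_power lin_op)
    show "(?W ^^ m) (t \<alpha> \<beta> \<gamma>) = 0" using kW[OF S(3) dvd_refl] by (simp only: poly_op_power lin_op)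
  qed
  have unit: "[:- \<alpha>, 1:] ^ m dvd (\<Sum>\<beta>\<in>S. ?e \<beta>) - 1" if "\<alpha> \<in> S" for \<alpha>
    using primary_idem_interpolates[OF fin that, of m "\<lambda>_. 1"] by (simp add: one_pCons)
  have dU: "(\<Sum>\<alpha>\<in>S. poly_op U (?e \<alpha>) b) = b" and dV: "(\<Sum>\<alpha>\<in>S. poly_op V (?e \<alpha>) b) = b"
    and dW: "(\<Sum>\<alpha>\<in>S. poly_op W (?e \<alpha>) b) = b"
    using kill[OF unit] by (simp_all add: poly_op_diff poly_op_sum poly_op_1 lin_op)
  have "(\<Sum>\<alpha>\<in>S. \<Sum>\<beta>\<in>S. \<Sum>\<gamma>\<in>S. t \<alpha> \<beta> \<gamma>) = b"
    unfolding t_def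
    by (simp only: lin_sum[OF lin_poly_op[OF lin_op(1)], symmetric] lin_sum[OF lin_poly_op[OF lin_op(2)], symmetric]
        dU dV dW)
  then have b: "b = (\<Sum>\<alpha>\<in>S. \<Sum>\<beta>\<in>S. \<Sum>\<gamma>\<in>S. t \<alpha> \<beta> \<gamma>)" by (rule sym)
  have agree: "L b = M b"
    if LM: "lin_op L" "lin_op M" and eq: "\<And>\<alpha> \<beta>. \<alpha> \<in> S \<Longrightarrow> \<beta> \<in> S \<Longrightarrow> \<alpha> + \<beta> \<in> S \<Longrightarrow>
      L (t \<alpha> \<beta> (\<alpha> + \<beta>)) = M (t \<alpha> \<beta> (\<alpha> + \<beta>))" for L M
  proof -
    have "L (t \<alpha> \<beta> \<gamma>) = M (t \<alpha> \<beta> \<gamma>)" if "\<alpha> \<in> S" "\<beta> \<in> S" "\<gamma> \<in> S" for \<alpha> \<beta> \<gamma>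
      using eq[OF that(1,2)] vanish[OF that] that(3) LM by (cases "\<alpha> + \<beta> = \<gamma>") (auto simp: lin_zero)
    then show ?thesis by (subst (1 2) b) (simp add: lin_sum LM)
  qed
  show "poly_op W f b = poly_op U f (poly_op V f b)"
    if mult: "\<And>\<alpha> \<beta>. \<alpha> \<in> S \<Longrightarrow> \<beta> \<in> S \<Longrightarrow> \<alpha> + \<beta> \<in> S \<Longrightarrow> \<psi> (\<alpha> + \<beta>) = \<psi> \<alpha> * \<psi> \<beta>"
    by (rule agree) (use mult in \<open>simp_all add: eU eV eW lin_op lin_poly_op lin_comp lin_scale mult.commute\<close>)
  show "poly_op W f b = poly_op U f b + poly_op V f b"
    if add: "\<And>\<alpha> \<beta>. \<alpha> \<in> S \<Longrightarrow> \<beta> \<in> S \<Longrightarrow> \<alpha> + \<beta> \<in> S \<Longrightarrow> \<psi> (\<alpha> + \<beta>) = \<psi> \<alpha> + \<psi> \<beta>"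
    by (rule agree) (use add in \<open>simp_all add: eU eV eW lin_op lin_poly_op lin_plus scale_left_distrib\<close>)
qed

end

section \<open>Functionals with values in the algebraic closure\<close>

text \<open>Scalars are extended on the dual side. Functionals with values in the closure form a vector space over the closure,
so eigenvalues outside the ground field are available without a tensor product. Operators act on functionals by
composition.\<close>

interpretation fun_op: op_space "\<lambda>c (\<xi> :: 'b \<Rightarrow> 'c::field) x. c * \<xi> x"
  by unfold_locales (auto simp: fun_eq_iff algebra_simps)

lemma lin_pullback: "fun_op.lin_op (\<lambda>\<xi> x. \<xi> (d x))"
  by (simp add: fun_op.lin_iff fun_eq_iff)

lemma pullback_pCons:
  "fun_op.poly_op (\<lambda>\<xi> x. \<xi> (d x)) (pCons a p) \<xi> x = a * \<xi> x + fun_op.poly_op (\<lambda>\<xi> x. \<xi> (d x)) p \<xi> (d x)"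
  by (simp add: fun_op.poly_op_pCons[OF lin_pullback])

text \<open>This transports polynomials in an operator along any map \<open>j\<close> that intertwines the underlying maps; it is used to fix
one argument of a function of two variables.\<close>

lemma pullback_natural:
  assumes "\<And>z. d (j z) = j (d' z)"
  shows "fun_op.poly_op (\<lambda>\<xi> x. \<xi> (d x)) p \<xi> (j z) = fun_op.poly_op (\<lambda>\<xi> x. \<xi> (d' x)) p (\<lambda>z. \<xi> (j z)) z"
  by (induction p arbitrary: z) (simp_all add: fun_op.poly_op_0 pullback_pCons assms)

context op_space
begin

definition ac_functional :: "('b \<Rightarrow> 'a alg_closure) \<Rightarrow> bool"
  where "ac_functional \<xi> \<longleftrightarrow> (\<forall>x y. \<xi> (x + y) = \<xi> x + \<xi> y) \<and> (\<forall>c x. \<xi> (scale c x) = to_ac c * \<xi> x)"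

lemma ac_functional_add: "ac_functional \<xi> \<Longrightarrow> \<xi> (x + y) = \<xi> x + \<xi> y"
  and ac_functional_scale: "ac_functional \<xi> \<Longrightarrow> \<xi> (scale c x) = to_ac c * \<xi> x"
  by (simp_all add: ac_functional_def)

lemma ac_functional_zero: "ac_functional \<xi> \<Longrightarrow> \<xi> 0 = 0"
  using ac_functional_scale[of \<xi> 0 0] by simp

lemma ac_functional_diff: "ac_functional \<xi> \<Longrightarrow> \<xi> (x - y) = \<xi> x - \<xi> y"
  using ac_functional_add[of \<xi> "x - y" y] by simp

lemma ac_functionals_separate:
  assumes "\<And>\<xi>. ac_functional \<xi> \<Longrightarrow> \<xi> x = 0"
  shows "x = 0"
proof (rule ccontr)
  assume "x \<noteq> 0"
  then have ind: "independent {x}" using dependent_single by auto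
  let ?B = "extend_basis {x}"
  have B: "independent ?B" "span ?B = UNIV" "x \<in> ?B"
    using independent_extend_basis[OF ind] span_extend_basis[OF ind] extend_basis_superset[OF ind]
    by auto
  have "ac_functional (\<lambda>v. to_ac (representation ?B v x))"
    using B by (simp add: ac_functional_def representation_add representation_scale)
  from assms[OF this] show False using B by (simp add: representation_basis)
qed

lemma pullback_ac_functional:
  assumes D: "lin_op D" and \<xi>: "ac_functional \<xi>"
  shows "fun_op.poly_op (\<lambda>\<xi> x. \<xi> (D x)) (map_poly to_ac p) \<xi> x = \<xi> (poly_op D p x)"
proof (induction p arbitrary: x)
  case 0
  then show ?case by (simp add: fun_op.poly_op_0 poly_op_0 ac_functional_zero \<xi>)
next
  case (pCons a p)
  then show ?case
    using poly_op_commute[OF D D, of p x]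
    by (simp add: to_ac.map_pCons pullback_pCons poly_op_pCons D
        ac_functional_add[OF \<xi>] ac_functional_scale[OF \<xi>])
qed

section \<open>Annihilating polynomials\<close>

text \<open>The vectors \<open>(T ^^ i) x\<close> for \<open>i \<le> card B\<close> are either not distinct or too many to be independent.\<close>

lemma annihilating_polynomial_at:
  assumes T: "lin_op T" and B: "finite B" "span B = UNIV"
  shows "\<exists>p. p \<noteq> 0 \<and> poly_op T p x = 0"
proof (cases "inj_on (\<lambda>i. (T ^^ i) x) {..card B}")
  case False
  then obtain i j where ij: "i \<noteq> j" "(T ^^ i) x = (T ^^ j) x" unfolding inj_on_def by blast
  have "Polynomial.monom 1 i - Polynomial.monom 1 j \<noteq> (0 :: 'a poly)"
  proof
    assume "Polynomial.monom 1 i - Polynomial.monom 1 j = (0 :: 'a poly)"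
    from arg_cong[OF this, of "\<lambda>p. poly.coeff p i"] show False using ij(1) by simp
  qed
  moreover have "poly_op T (Polynomial.monom 1 i - Polynomial.monom 1 j) x = 0"
    using ij(2) by (simp add: poly_op_diff T poly_op_monom)
  ultimately show ?thesis by blast
next
  case True
  let ?f = "\<lambda>i. (T ^^ i) x" and ?I = "{..card B}"
  have "dependent (?f ` ?I)"
  proof (rule ccontr)
    assume "independent (?f ` ?I)"
    then have "card (?f ` ?I) \<le> card B" using independent_span_bound B by auto
    then show False using card_image[OF True] by simp
  qed
  then obtain u where u: "\<exists>v\<in>?f ` ?I. u v \<noteq> 0" "(\<Sum>v\<in>?f ` ?I. scale (u v) v) = 0"
    using dependent_finite[of "?f ` ?I"] by auto
  let ?p = "\<Sum>i\<in>?I. Polynomial.monom (u (?f i)) i"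
  obtain i where i: "i \<in> ?I" "u (?f i) \<noteq> 0" using u(1) by blast
  have "poly.coeff ?p i = (\<Sum>j\<in>?I. if j = i then u (?f i) else 0)"
    unfolding coeff_sum by (intro sum.cong refl) auto
  then have "poly.coeff ?p i \<noteq> 0" using i by simp
  then have "?p \<noteq> 0" by auto
  moreover have "poly_op T ?p x = (\<Sum>v\<in>?f ` ?I. scale (u v) v)"
    by (simp add: poly_op_sum T poly_op_monom sum.reindex[OF True])
  ultimately show ?thesis using u(2) by metis
qed

lemma annihilating_polynomial:
  assumes T: "lin_op T" and B: "finite B" "span B = UNIV"
  obtains p where "p \<noteq> 0" "\<And>x. poly_op T p x = 0"
proof -
  have "\<forall>x. \<exists>p. p \<noteq> 0 \<and> poly_op T p x = 0" using annihilating_polynomial_at[OF T B] by blast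
  then obtain q where q: "\<And>x. q x \<noteq> 0" "\<And>x. poly_op T (q x) x = 0" by metis
  let ?p = "prod q B"
  have "?p \<noteq> 0" using q(1) B(1) by simp
  moreover have "poly_op T ?p x = 0" for x
  proof -
    have "x \<in> span B" using B by simp
    then show ?thesis
    proof (induction rule: span_induct_alt)
      case base
      then show ?case by (rule lin_zero[OF lin_poly_op[OF T]])
    next
      case (step c b y)
      have "?p = prod q (B - {b}) * q b"
        using prod.remove[OF B(1) step(1), of q] by (simp add: mult.commute)
      then have "poly_op T ?p b = 0"
        by (simp add: poly_op_mult T q(2) lin_zero lin_poly_op)
      then show ?case
        using step by (simp add: lin_add[OF lin_poly_op[OF T]] lin_scale[OF lin_poly_op[OF T]])
    qed
  qed
  ultimately show ?thesis using that by blast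
qed

end

text \<open>Over an algebraically closed field \<open>p\<close> is a product of linear factors, so comparing multiplicities decides
divisibility; the common linear factors are removed one at a time.\<close>

lemma split_poly_dvd:
  fixes p q :: "'c::alg_closed_field poly"
  assumes "p \<noteq> 0" "q \<noteq> 0" "\<And>\<alpha>. Polynomial.order \<alpha> p \<le> Polynomial.order \<alpha> q"
  shows "p dvd q"
  using assms
proof (induction "degree p" arbitrary: p q)
  case 0
  then have "is_unit p" by (simp add: is_unit_iff_degree)
  then show ?case by (rule unit_imp_dvd)
next
  case (Suc n)
  obtain \<alpha> where \<alpha>: "poly p \<alpha> = 0"
    using alg_closed_imp_poly_has_root[of p] Suc.hyps(2) by auto
  then have "poly q \<alpha> = 0"
    using Suc.prems by (metis order_root le_zero_eq)
  with \<alpha> obtain p' q' where pq: "p = [:- \<alpha>, 1:] * p'" "q = [:- \<alpha>, 1:] * q'"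
    by (metis dvdE poly_eq_0_iff_dvd)
  have nz: "[:- \<alpha>, 1:] * p' \<noteq> 0" "[:- \<alpha>, 1:] * q' \<noteq> 0" "p' \<noteq> 0" "q' \<noteq> 0"
    using Suc.prems(1,2) pq by auto
  have "degree p' = n"
    using Suc.hyps(2) nz unfolding pq(1) by (subst (asm) degree_mult_eq) auto
  moreover have "Polynomial.order \<beta> p' \<le> Polynomial.order \<beta> q'" for \<beta>
    using Suc.prems(3)[of \<beta>] unfolding pq order_mult[OF nz(1)] order_mult[OF nz(2)] by simp
  ultimately have "p' dvd q'" using Suc.hyps(1) nz by blast
  then show ?case unfolding pq by (rule mult_dvd_mono[OF dvd_refl])
qed

text \<open>The roots of an annihilating polynomial \<open>P\<close> in the closure stand for the eigenvalues of \<open>D\<close>, which are among them, and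
\<open>degree P\<close> bounds all multiplicities.\<close>

locale annihilated_operator = op_space scale
  for scale :: "'k::field_char_0 \<Rightarrow> 'a::ab_group_add \<Rightarrow> 'a" +
  fixes D :: "'a \<Rightarrow> 'a" and P :: "'k poly"
  assumes lin: "lin_op D"
    and P_nonzero: "P \<noteq> 0"
    and annihilates: "poly_op D P x = 0"
begin

abbreviation eigenvalues :: "'k alg_closure set"
  where "eigenvalues \<equiv> {\<alpha>. poly (map_poly to_ac P) \<alpha> = 0}"

abbreviation vanishing :: "'k alg_closure poly \<Rightarrow> bool"
  where "vanishing p \<equiv> \<forall>\<alpha>\<in>eigenvalues. [:- \<alpha>, 1:] ^ degree P dvd p"

lemma finite_eigenvalues: "finite eigenvalues"
  using P_nonzero by (intro poly_roots_finite) (simp add: to_ac.map_eq_0_iff)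

lemma eigenvalues_stable:
  assumes "ac_endo h"
  shows "h ` eigenvalues \<subseteq> eigenvalues"
proof (rule image_subsetI)
  fix \<alpha> assume \<alpha>: "\<alpha> \<in> eigenvalues"
  interpret ac_endo h by fact
  have "poly (map_poly to_ac P) (h \<alpha>) = h (poly (map_poly to_ac P) \<alpha>)"
    using poly_map[of "map_poly to_ac P" \<alpha>] by (simp add: map_to_ac)
  then show "h \<alpha> \<in> eigenvalues" using \<alpha> by (simp add: zero)
qed

lemma vanishing_dvd:
  assumes "vanishing p"
  shows "map_poly to_ac P dvd p"
proof (cases "p = 0")
  case False
  have nz: "map_poly to_ac P \<noteq> 0" using P_nonzero by (simp add: to_ac.map_eq_0_iff)
  have "Polynomial.order \<alpha> (map_poly to_ac P) \<le> Polynomial.order \<alpha> p" for \<alpha>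
  proof (cases "\<alpha> \<in> eigenvalues")
    case True
    then have "degree P \<le> Polynomial.order \<alpha> p" using assms False by (simp add: order_divides)
    moreover have "Polynomial.order \<alpha> (map_poly to_ac P) \<le> degree P"
      using order_degree[OF nz] by (simp add: to_ac.degree_map)
    ultimately show ?thesis by (rule le_trans[rotated])
  next
    case False
    then show ?thesis by (simp add: order_0I)
  qed
  then show ?thesis by (rule split_poly_dvd[OF nz False])
qed simp

lemma vanishing_pullback:
  assumes "vanishing p" "ac_functional \<xi>"
  shows "fun_op.poly_op (\<lambda>\<xi> x. \<xi> (D x)) p \<xi> x = 0"
proof -
  obtain q where q: "p = q * map_poly to_ac P"
    using vanishing_dvd[OF assms(1)] by (metis dvdE mult.commute)
  have "fun_op.poly_op (\<lambda>\<xi> x. \<xi> (D x)) (map_poly to_ac P) \<xi> = 0"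
    by (rule ext) (simp add: pullback_ac_functional[OF lin assms(2)] annihilates ac_functional_zero assms(2))
  then show ?thesis
    by (simp add: q fun_op.poly_op_mult[OF lin_pullback] fun_op.lin_zero[OF fun_op.lin_poly_op[OF lin_pullback]])
qed

lemma vanishing_rational:
  assumes "vanishing (map_poly to_ac p)"
  shows "poly_op D p x = 0"
  by (rule ac_functionals_separate)
    (simp flip: pullback_ac_functional[OF lin] add: vanishing_pullback[OF assms])

lemma interpolation:
  assumes "\<And>h \<alpha>. ac_endo h \<Longrightarrow> \<alpha> \<in> eigenvalues \<Longrightarrow> \<psi> (h \<alpha>) = h (\<psi> \<alpha>)"
  shows "\<exists>f :: 'k poly. \<forall>\<alpha>\<in>eigenvalues. [:- \<alpha>, 1:] ^ degree P dvd map_poly to_ac f - [:\<psi> \<alpha>:]"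
  by (rule rational_interpolation[OF finite_eigenvalues eigenvalues_stable assms])

end

section \<open>Derivations and automorphisms\<close>

locale bilinear_algebra = op_space scale
  for scale :: "'k::field_char_0 \<Rightarrow> 'a::ab_group_add \<Rightarrow> 'a" +
  fixes mult :: "'a \<Rightarrow> 'a \<Rightarrow> 'a"  (infixl \<open>\<cdot>\<close> 70)
  assumes lin_mult_left: "lin_op (\<lambda>y. x \<cdot> y)"
    and lin_mult_right: "lin_op (\<lambda>x. x \<cdot> y)"
begin

definition derivation :: "('a \<Rightarrow> 'a) \<Rightarrow> bool"
  where "derivation D \<longleftrightarrow> lin_op D \<and> (\<forall>x y. D (x \<cdot> y) = D x \<cdot> y + x \<cdot> D y)"

definition automorphism :: "('a \<Rightarrow> 'a) \<Rightarrow> bool"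
  where "automorphism \<theta> \<longleftrightarrow> lin_op \<theta> \<and> bij \<theta> \<and> (\<forall>x y. \<theta> (x \<cdot> y) = \<theta> x \<cdot> \<theta> y)"

definition aut_invariant :: "'a set \<Rightarrow> bool"
  where "aut_invariant V \<longleftrightarrow> subspace V \<and> (\<forall>\<theta>. automorphism \<theta> \<longrightarrow> (\<forall>x\<in>V. \<theta> x \<in> V))"

lemmas mult_add_right = lin_add[OF lin_mult_left]
  and mult_add_left = lin_add[OF lin_mult_right]
  and mult_scale_right = lin_scale[OF lin_mult_left]
  and mult_scale_left = lin_scale[OF lin_mult_right]
  and mult_zero_right = lin_zero[OF lin_mult_left]
  and mult_zero_left = lin_zero[OF lin_mult_right]
  and mult_diff_right = lin_diff[OF lin_mult_left]
  and mult_diff_left = lin_diff[OF lin_mult_right]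
  and mult_sum_right = lin_sum[OF lin_mult_left]
  and mult_sum_left = lin_sum[OF lin_mult_right]

lemma derivation_minus:
  "derivation D \<Longrightarrow> derivation E \<Longrightarrow> derivation (\<lambda>x. D x - E x)"
  by (simp add: derivation_def lin_minus mult_diff_left mult_diff_right algebra_simps)

lemma ac_functional_mult:
  assumes "ac_functional \<xi>"
  shows "ac_functional (\<lambda>x. \<xi> (x \<cdot> y))" "ac_functional (\<lambda>y. \<xi> (x \<cdot> y))"
  using assms
  by (simp_all add: ac_functional_def mult_add_left mult_add_right mult_scale_left mult_scale_right)

text \<open>Two elements of the algebra are equal if all functionals \<open>\<xi>\<close> agree on them. On the bilinear forms \<open>\<xi> (x \<cdot> y)\<close> the
derivation \<open>D\<close> acts through the first argument, through the second, and through the product. The derivation rule says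
that the third action is the sum of the first two, so \<open>functional_calculus_of_sum\<close> applies.\<close>

lemma functional_calculus_of_derivation:
  fixes D P
  assumes D: "derivation D" and P: "P \<noteq> 0" "\<And>x. poly_op D P x = 0"
    and f: "\<And>\<alpha>. poly (map_poly to_ac P) \<alpha> = 0 \<Longrightarrow>
      [:- \<alpha>, 1:] ^ degree P dvd map_poly to_ac f - [:\<psi> \<alpha>:]"
  shows "(\<And>\<alpha> \<beta>. poly (map_poly to_ac P) \<alpha> = 0 \<Longrightarrow> poly (map_poly to_ac P) \<beta> = 0 \<Longrightarrow>
        poly (map_poly to_ac P) (\<alpha> + \<beta>) = 0 \<Longrightarrow> \<psi> (\<alpha> + \<beta>) = \<psi> \<alpha> * \<psi> \<beta>) \<Longrightarrow>
      poly_op D f (x \<cdot> y) = poly_op D f x \<cdot> poly_op D f y"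
    and "(\<And>\<alpha> \<beta>. poly (map_poly to_ac P) \<alpha> = 0 \<Longrightarrow> poly (map_poly to_ac P) \<beta> = 0 \<Longrightarrow>
        poly (map_poly to_ac P) (\<alpha> + \<beta>) = 0 \<Longrightarrow> \<psi> (\<alpha> + \<beta>) = \<psi> \<alpha> + \<psi> \<beta>) \<Longrightarrow>
      poly_op D f (x \<cdot> y) = poly_op D f x \<cdot> y + x \<cdot> poly_op D f y"
proof -
  have lin: "lin_op D" and leib: "\<And>x y. D (x \<cdot> y) = D x \<cdot> y + x \<cdot> D y"
    using D by (simp_all add: derivation_def)
  interpret A: annihilated_operator scale D P
    by (intro annihilated_operator.intro op_space_axioms annihilated_operator_axioms.intro lin P)
  let ?T = "\<lambda>\<xi> :: 'a \<Rightarrow> 'k alg_closure. \<lambda>x. \<xi> (D x)"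
  let ?B = "\<lambda>\<xi> :: 'a \<Rightarrow> 'k alg_closure. \<lambda>(x, y). \<xi> (x \<cdot> y)"
  let ?dU = "\<lambda>(x, y :: 'a). (D x, y)" and ?dV = "\<lambda>(x :: 'a, y). (x, D y)"
  let ?U = "\<lambda>\<beta> :: 'a \<times> 'a \<Rightarrow> 'k alg_closure. \<lambda>z. \<beta> (?dU z)"
  let ?V = "\<lambda>\<beta> :: 'a \<times> 'a \<Rightarrow> 'k alg_closure. \<lambda>z. \<beta> (?dV z)"
  let ?W = "\<lambda>\<beta>. \<lambda>z. ?U \<beta> z + ?V \<beta> z"
  let ?f = "map_poly to_ac f"
  have linW: "fun_op.lin_op ?W"
    by (simp add: fun_op.lin_iff fun_eq_iff algebra_simps)
  have Ux: "fun_op.poly_op ?U p \<beta> (x, y) = fun_op.poly_op ?T p (\<lambda>x. \<beta> (x, y)) x" for p \<beta> x y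
    using pullback_natural[of ?dU "\<lambda>x. (x, y)" D p \<beta> x] by simp
  have Vy: "fun_op.poly_op ?V p \<beta> (x, y) = fun_op.poly_op ?T p (\<lambda>y. \<beta> (x, y)) y" for p \<beta> x y
    using pullback_natural[of ?dV "\<lambda>y. (x, y)" D p \<beta> y] by simp
  have add_pull: "fun_op.poly_op ?T p \<xi> (x + y) = fun_op.poly_op ?T p \<xi> x + fun_op.poly_op ?T p \<xi> y"
    if "ac_functional \<xi>" for p \<xi> x y
    by (induction p arbitrary: x y)
      (simp_all add: fun_op.poly_op_0 pullback_pCons ac_functional_add[OF that] lin_add[OF lin] algebra_simps)
  have WB: "fun_op.poly_op ?W p (?B \<xi>) = ?B (fun_op.poly_op ?T p \<xi>)" if "ac_functional \<xi>" for p \<xi>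
    by (induction p)
      (simp_all add: fun_op.poly_op_0 fun_op.poly_op_pCons[OF linW] pullback_pCons fun_eq_iff
        leib add_pull[OF that] algebra_simps)
  have kill: "fun_op.poly_op ?U p (?B \<xi>) = 0 \<and> fun_op.poly_op ?V p (?B \<xi>) = 0 \<and> fun_op.poly_op ?W p (?B \<xi>) = 0"
    if \<xi>: "ac_functional \<xi>" and p: "\<And>\<alpha>. \<alpha> \<in> A.eigenvalues \<Longrightarrow> [:- \<alpha>, 1:] ^ degree P dvd p" for p \<xi>
    using p ac_functional_mult[OF \<xi>] \<xi>
    by (auto simp: fun_eq_iff Ux Vy WB A.vanishing_pullback)
  note calculus = fun_op.functional_calculus_of_sum[OF lin_pullback lin_pullback linW, of ?dV ?dU A.eigenvalues
      "degree P" _ ?f \<psi>, OF _ _ A.finite_eigenvalues]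
  have fW: "fun_op.poly_op ?W ?f (?B \<xi>) (x, y) = \<xi> (poly_op D f (x \<cdot> y))"
    if "ac_functional \<xi>" for \<xi>
    by (simp add: WB that pullback_ac_functional[OF lin])
  have fV: "fun_op.poly_op ?V ?f (?B \<xi>) (x, y) = \<xi> (x \<cdot> poly_op D f y)"
    if "ac_functional \<xi>" for \<xi> x
    using pullback_ac_functional[OF lin ac_functional_mult(2)[OF that]] by (simp add: Vy)
  have fU: "fun_op.poly_op ?U ?f (?B \<xi>) (x, y) = \<xi> (poly_op D f x \<cdot> y)"
    if "ac_functional \<xi>" for \<xi> x y
    using pullback_ac_functional[OF lin ac_functional_mult(1)[OF that]] by (simp add: Ux)
  have fUV: "fun_op.poly_op ?U ?f (fun_op.poly_op ?V ?f (?B \<xi>)) (x, y) = \<xi> (poly_op D f x \<cdot> poly_op D f y)"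
    if \<xi>: "ac_functional \<xi>" for \<xi>
    using pullback_ac_functional[OF lin ac_functional_mult(1)[OF \<xi>]] by (simp add: Ux fV[OF \<xi>])
  show "poly_op D f (x \<cdot> y) = poly_op D f x \<cdot> poly_op D f y"
    if mult: "\<And>\<alpha> \<beta>. poly (map_poly to_ac P) \<alpha> = 0 \<Longrightarrow> poly (map_poly to_ac P) \<beta> = 0 \<Longrightarrow>
        poly (map_poly to_ac P) (\<alpha> + \<beta>) = 0 \<Longrightarrow> \<psi> (\<alpha> + \<beta>) = \<psi> \<alpha> * \<psi> \<beta>"
  proof -
    have "\<xi> (poly_op D f (x \<cdot> y) - poly_op D f x \<cdot> poly_op D f y) = 0" if \<xi>: "ac_functional \<xi>" for \<xi>
    proof -
      have "fun_op.poly_op ?W ?f (?B \<xi>) = fun_op.poly_op ?U ?f (fun_op.poly_op ?V ?f (?B \<xi>))"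
        by (rule calculus(1)) (use kill[OF \<xi>] f mult in \<open>auto simp: fun_eq_iff\<close>)
      from fun_cong[OF this, of "(x, y)"] show ?thesis
        by (simp only: fW[OF \<xi>] fUV[OF \<xi>] ac_functional_diff[OF \<xi>]) simp
    qed
    then show ?thesis using ac_functionals_separate by (metis eq_iff_diff_eq_0)
  qed
  show "poly_op D f (x \<cdot> y) = poly_op D f x \<cdot> y + x \<cdot> poly_op D f y"
    if add: "\<And>\<alpha> \<beta>. poly (map_poly to_ac P) \<alpha> = 0 \<Longrightarrow> poly (map_poly to_ac P) \<beta> = 0 \<Longrightarrow>
        poly (map_poly to_ac P) (\<alpha> + \<beta>) = 0 \<Longrightarrow> \<psi> (\<alpha> + \<beta>) = \<psi> \<alpha> + \<psi> \<beta>"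
  proof -
    have "\<xi> (poly_op D f (x \<cdot> y) - (poly_op D f x \<cdot> y + x \<cdot> poly_op D f y)) = 0" if \<xi>: "ac_functional \<xi>" for \<xi>
    proof -
      have "fun_op.poly_op ?W ?f (?B \<xi>) = fun_op.poly_op ?U ?f (?B \<xi>) + fun_op.poly_op ?V ?f (?B \<xi>)"
        by (rule calculus(2)) (use kill[OF \<xi>] f add in \<open>auto simp: fun_eq_iff\<close>)
      from fun_cong[OF this, of "(x, y)"] show ?thesis
        by (simp only: plus_fun_apply fW[OF \<xi>] fU[OF \<xi>] fV[OF \<xi>] ac_functional_diff[OF \<xi>] ac_functional_add[OF \<xi>]) simp
    qed
    then show ?thesis using ac_functionals_separate by (metis eq_iff_diff_eq_0)
  qed
qed

end

text \<open>Polynomials respect congruences; \<open>[:poly u a:]\<close> is the composition of \<open>u\<close> with the constant \<open>[:a:]\<close>.\<close>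

lemma pcompose_congruence: "g - [:a:] dvd pcompose u g - [:poly u a:]" for g :: "'c::comm_ring_1 poly"
proof (induction u)
  case (pCons c u)
  have "pcompose (pCons c u) g - [:poly (pCons c u) a:]
      = g * (pcompose u g - [:poly u a:]) + (g - [:a:]) * [:poly u a:]"
  proof -
    have ring: "(c + g * v) - (c + a * w) = g * (v - w) + (g - a) * w" for c g v a w :: "'c poly"
      by (simp add: algebra_simps)
    have "[:poly (pCons c u) a:] = [:c:] + [:a:] * [:poly u a:]" by simp
    then show ?thesis by (simp only: pcompose_pCons ring)
  qed
  then show ?case using pCons.IH by (simp only: dvd_add dvd_mult dvd_triv_left)
qed simp

context bilinear_algebra
begin

text \<open>\<open>S = poly_op D g\<close> is the semisimple part of \<open>D\<close>, where \<open>g\<close> interpolates the identity on the eigenvalues. The second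
conclusion says that \<open>D - S\<close> is nilpotent. In the third one \<open>u\<close> interpolates inversion, with
\<open>1/0 = 0\<close>, so that \<open>poly_op D (pcompose u g)\<close> inverts \<open>S\<close> on its image. The last one comes from the
character of \<open>equivariant_character\<close>: interpolating its values gives an automorphism, and interpolating its inverse
function expresses \<open>S\<close> as a polynomial in that automorphism.\<close>

theorem jordan_decomposition:
  assumes D: "derivation D" and fin: "finite B" "span B = UNIV"
  obtains g u m where "derivation (poly_op D g)"
    and "\<And>x. poly_op D (([:0, 1:] - g) ^ m) x = 0"
    and "\<And>x. poly_op D g (poly_op D g (poly_op D (pcompose u g) x)) = poly_op D g x"
    and "\<And>V x. aut_invariant V \<Longrightarrow> x \<in> V \<Longrightarrow> poly_op D g x \<in> V"
proof -
  have lin: "lin_op D" using D by (simp add: derivation_def)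
  obtain P where P: "P \<noteq> 0" "\<And>x. poly_op D P x = 0"
    using annihilating_polynomial[OF lin fin] by blast
  interpret A: annihilated_operator scale D P
    by (intro annihilated_operator.intro op_space_axioms annihilated_operator_axioms.intro lin P)
  let ?S = "A.eigenvalues" and ?m = "degree P"
  \<comment> \<open>semisimple part: the eigenvalue \<open>\<alpha>\<close> on the generalized eigenspace of \<open>\<alpha>\<close>\<close>
  obtain g where g: "\<And>\<alpha>. \<alpha> \<in> ?S \<Longrightarrow> [:- \<alpha>, 1:] ^ ?m dvd map_poly to_ac g - [:\<alpha>:]"
    using A.interpolation[of "\<lambda>\<alpha>. \<alpha>"] by blast
  let ?g = "map_poly to_ac g"
  have compose: "[:- \<alpha>, 1:] ^ ?m dvd pcompose u (map_poly to_ac f) - [:poly u \<beta>:]"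
    if "[:- \<alpha>, 1:] ^ ?m dvd map_poly to_ac f - [:\<beta>:]" for u f \<alpha> \<beta>
    using that pcompose_congruence by (rule dvd_trans)
  have "poly_op D g (x \<cdot> y) = poly_op D g x \<cdot> y + x \<cdot> poly_op D g y" for x y
    by (rule functional_calculus_of_derivation(2)[OF D P, where \<psi> = "\<lambda>\<alpha>. \<alpha>"]) (use g in auto)
  then have der: "derivation (poly_op D g)" by (simp add: derivation_def lin_poly_op lin)
  have nil: "poly_op D (([:0, 1:] - g) ^ ?m) x = 0" for x
  proof (rule A.vanishing_rational, rule ballI)
    fix \<alpha> assume \<alpha>: "\<alpha> \<in> ?S"
    have "?m \<noteq> 0"
    proof
      assume "?m = 0"
      then obtain c where "P = [:c:]" by (rule degree_eq_zeroE)
      then show False using P(1) \<alpha> by (simp add: to_ac.map_const)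
    qed
    then have "[:- \<alpha>, 1:] dvd [:- \<alpha>, 1:] ^ ?m" by (simp add: dvd_power)
    then have "[:- \<alpha>, 1:] dvd ?g - [:\<alpha>:]" using g[OF \<alpha>] by (rule dvd_trans)
    then have "[:- \<alpha>, 1:] dvd [:- \<alpha>, 1:] - (?g - [:\<alpha>:])" by simp
    also have "[:- \<alpha>, 1:] - (?g - [:\<alpha>:]) = map_poly to_ac ([:0, 1:] - g)"
      by (simp add: to_ac.map_diff to_ac.map_pCons)
    finally show "[:- \<alpha>, 1:] ^ ?m dvd map_poly to_ac (([:0, 1:] - g) ^ ?m)"
      unfolding to_ac.map_power by (rule dvd_power_same)
  qed
  obtain u :: "'k poly" where u: "\<And>\<alpha>. \<alpha> \<in> ?S \<Longrightarrow> poly (map_poly to_ac u) \<alpha> = inverse \<alpha>"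
  proof -
    have "\<exists>u :: 'k poly. \<forall>\<alpha>\<in>?S. [:- \<alpha>, 1:] ^ 1 dvd map_poly to_ac u - [:inverse \<alpha>:]"
    proof (rule rational_interpolation[OF A.finite_eigenvalues A.eigenvalues_stable])
      show "inverse (h \<alpha>) = h (inverse \<alpha>)" if "ac_endo h" for h :: "'k alg_closure \<Rightarrow> 'k alg_closure" and \<alpha>
      proof -
        interpret ac_endo h by fact
        show ?thesis by (simp add: inverse)
      qed
    qed
    then show ?thesis using that by (auto simp: poly_eq_0_iff_dvd[symmetric])
  qed
  have pseudo: "poly_op D g (poly_op D g (poly_op D (pcompose u g) x)) = poly_op D g x" for x
  proof -
    have "poly_op D (g * (g * pcompose u g) - g) x = 0"
    proof (rule A.vanishing_rational, rule ballI)
      fix \<alpha> assume \<alpha>: "\<alpha> \<in> ?S"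
      let ?w = "pcompose (map_poly to_ac u) ?g"
      have w: "[:- \<alpha>, 1:] ^ ?m dvd ?w - [:inverse \<alpha>:]"
        using compose[OF g[OF \<alpha>], of "map_poly to_ac u"] by (simp only: u[OF \<alpha>])
      have "map_poly to_ac (g * (g * pcompose u g) - g) = ?g * (?g * ?w) - ?g"
        by (simp add: to_ac.map_diff to_ac.map_mult to_ac.map_pcompose)
      also have "\<dots> = ?g * ?g * (?w - [:inverse \<alpha>:]) + ?g * (?g * [:inverse \<alpha>:] - 1)"
        by (simp add: algebra_simps)
      also have "?g * (?g * [:inverse \<alpha>:] - 1)
          = (if \<alpha> = 0 then - (?g - [:\<alpha>:]) else ?g * [:inverse \<alpha>:] * (?g - [:\<alpha>:]))"
      proof (cases "\<alpha> = 0")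
        case False
        then have "[:inverse \<alpha>:] * [:\<alpha>:] = 1" by (simp add: one_pCons)
        then show ?thesis using False by (simp add: right_diff_distrib mult.assoc del: mult_pCons_left mult_pCons_right)
      qed simp
      finally show "[:- \<alpha>, 1:] ^ ?m dvd map_poly to_ac (g * (g * pcompose u g) - g)"
        using w g[OF \<alpha>] by (auto intro!: dvd_add dvd_mult simp only: dvd_minus_iff split: if_splits)
    qed
    then show ?thesis by (simp add: poly_op_diff poly_op_mult lin)
  qed
  have inv: "poly_op D g x \<in> V" if V: "aut_invariant V" and x: "x \<in> V" for V x
  proof (rule equivariant_character[OF A.finite_eigenvalues A.eigenvalues_stable])
    fix \<chi> :: "'k alg_closure \<Rightarrow> 'k alg_closure"
    assume nz: "\<And>\<alpha>. \<alpha> \<in> ?S \<Longrightarrow> \<chi> \<alpha> \<noteq> 0"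
      and inj: "inj_on \<chi> ?S"
      and equi: "\<And>h \<alpha>. ac_endo h \<Longrightarrow> \<alpha> \<in> ?S \<Longrightarrow> \<chi> (h \<alpha>) = h (\<chi> \<alpha>)"
      and mult: "\<And>\<alpha> \<beta>. \<alpha> \<in> ?S \<Longrightarrow> \<beta> \<in> ?S \<Longrightarrow> \<alpha> + \<beta> \<in> ?S \<Longrightarrow> \<chi> (\<alpha> + \<beta>) = \<chi> \<alpha> * \<chi> \<beta>"
    obtain f where f: "\<And>\<alpha>. \<alpha> \<in> ?S \<Longrightarrow> [:- \<alpha>, 1:] ^ ?m dvd map_poly to_ac f - [:\<chi> \<alpha>:]"
      using A.interpolation[of \<chi>, OF equi] by blast
    have "\<exists>f'. \<forall>\<alpha>\<in>?S. [:- \<alpha>, 1:] ^ ?m dvd map_poly to_ac f' - [:inverse (\<chi> \<alpha>):]"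
    proof (rule A.interpolation[of "\<lambda>\<alpha>. inverse (\<chi> \<alpha>)"])
      show "inverse (\<chi> (h \<alpha>)) = h (inverse (\<chi> \<alpha>))" if "ac_endo h" "\<alpha> \<in> ?S"
        for h :: "'k alg_closure \<Rightarrow> 'k alg_closure" and \<alpha>
      proof -
        interpret ac_endo h by fact
        show ?thesis by (simp add: inverse equi[OF that])
      qed
    qed
    then obtain f' where f': "\<And>\<alpha>. \<alpha> \<in> ?S \<Longrightarrow> [:- \<alpha>, 1:] ^ ?m dvd map_poly to_ac f' - [:inverse (\<chi> \<alpha>):]"
      by blast
    have inv1: "poly_op D (f * f' - 1) x = 0" for x
    proof (rule A.vanishing_rational, rule ballI)
      fix \<alpha> assume \<alpha>: "\<alpha> \<in> ?S"
      let ?f = "map_poly to_ac f" and ?f' = "map_poly to_ac f'"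
      have "[:\<chi> \<alpha>:] * [:inverse (\<chi> \<alpha>):] = 1" using nz[OF \<alpha>] by (simp add: one_pCons)
      then have "map_poly to_ac (f * f' - 1) = (?f - [:\<chi> \<alpha>:]) * ?f' + [:\<chi> \<alpha>:] * (?f' - [:inverse (\<chi> \<alpha>):])"
        by (simp only: to_ac.map_diff to_ac.map_mult to_ac.map_one left_diff_distrib right_diff_distrib) simp
      then show "[:- \<alpha>, 1:] ^ ?m dvd map_poly to_ac (f * f' - 1)"
        using f[OF \<alpha>] f'[OF \<alpha>] by (simp only: dvd_add dvd_mult dvd_mult2)
    qed
    have inverse: "poly_op D f (poly_op D f' x) = x" "poly_op D f' (poly_op D f x) = x" for x
      using inv1[of x] poly_op_mult[OF lin, of f f' x] poly_op_mult[OF lin, of f' f x]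
      by (simp_all add: poly_op_diff lin poly_op_1 mult.commute)
    have "automorphism (poly_op D f)"
      unfolding automorphism_def
    proof (intro conjI allI)
      show "lin_op (poly_op D f)" by (rule lin_poly_op[OF lin])
      show "bij (poly_op D f)" using inverse by (intro o_bij[of "poly_op D f'"]) (auto simp: fun_eq_iff)
      show "poly_op D f (x \<cdot> y) = poly_op D f x \<cdot> poly_op D f y" for x y
        by (rule functional_calculus_of_derivation(1)[OF D P, where \<psi> = \<chi>]) (use f mult in auto)
    qed
    then have Vf: "poly_op D f y \<in> V" if "y \<in> V" for y
      using V that by (simp add: aut_invariant_def)
    \<comment> \<open>injectivity of \<open>\<chi>\<close> allows one to recover the eigenvalues from those of the automorphism\<close>
    let ?inv = "inv_into ?S \<chi>"
    obtain q :: "'k poly" where q: "\<And>\<alpha>. \<alpha> \<in> ?S \<Longrightarrow> poly (map_poly to_ac q) (\<chi> \<alpha>) = \<alpha>"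
    proof -
      have "\<exists>q :: 'k poly. \<forall>\<beta>\<in>\<chi> ` ?S. [:- \<beta>, 1:] ^ 1 dvd map_poly to_ac q - [:?inv \<beta>:]"
      proof (rule rational_interpolation)
        show "finite (\<chi> ` ?S)" using A.finite_eigenvalues by simp
        show "h ` (\<chi> ` ?S) \<subseteq> \<chi> ` ?S" if "ac_endo h" for h :: "'k alg_closure \<Rightarrow> 'k alg_closure"
          using A.eigenvalues_stable[OF that] equi[OF that] by (force simp: image_subset_iff image_iff)
        show "?inv (h \<beta>) = h (?inv \<beta>)" if h: "ac_endo h" and \<beta>: "\<beta> \<in> \<chi> ` ?S"
          for h :: "'k alg_closure \<Rightarrow> 'k alg_closure" and \<beta>
        proof -
          obtain \<alpha> where \<alpha>: "\<alpha> \<in> ?S" "\<beta> = \<chi> \<alpha>" using \<beta> by blast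
          have "h \<alpha> \<in> ?S" using A.eigenvalues_stable[OF h] \<alpha>(1) by blast
          then show ?thesis
            using inv_into_f_f[OF inj] \<alpha> equi[OF h \<alpha>(1)] by metis
        qed
      qed
      then obtain q :: "'k poly" where "\<forall>\<beta>\<in>\<chi> ` ?S. [:- \<beta>, 1:] ^ 1 dvd map_poly to_ac q - [:?inv \<beta>:]" ..
      then have "poly (map_poly to_ac q) (\<chi> \<alpha>) = \<alpha>" if "\<alpha> \<in> ?S" for \<alpha>
        using that inv_into_f_f[OF inj that] by (simp add: poly_eq_0_iff_dvd[symmetric])
      then show ?thesis using that by blast
    qed
    have "poly_op D (g - pcompose q f) x = 0"
    proof (rule A.vanishing_rational, rule ballI)
      fix \<alpha> assume \<alpha>: "\<alpha> \<in> ?S"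
      have "map_poly to_ac (g - pcompose q f)
          = (?g - [:\<alpha>:]) - (pcompose (map_poly to_ac q) (map_poly to_ac f) - [:poly (map_poly to_ac q) (\<chi> \<alpha>):])"
        by (simp add: to_ac.map_diff to_ac.map_pcompose q[OF \<alpha>])
      then show "[:- \<alpha>, 1:] ^ ?m dvd map_poly to_ac (g - pcompose q f)"
        using g[OF \<alpha>] compose[OF f[OF \<alpha>]] by (simp only: dvd_diff)
    qed
    then have "poly_op D g x = poly_op (poly_op D f) q x"
      by (simp add: poly_op_diff lin poly_op_pcompose)
    also have "\<dots> \<in> V"
      by (rule poly_op_mem[OF lin_poly_op[OF lin] _ Vf x]) (use V in \<open>simp add: aut_invariant_def\<close>)
    finally show ?thesis .
  qed
  show ?thesis by (rule that[OF der nil pseudo inv])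
qed

section \<open>Automorphism-invariant subspaces are derivation-invariant\<close>

text \<open>The divided powers \<open>a n\<close> of \<open>N\<close> satisfy the binomial rule, so their sum is multiplicative; it is bijective because it
differs from the identity by a multiple of the nilpotent \<open>N\<close>.\<close>

lemma nilpotent_derivation_exponential:
  assumes N: "derivation N" and nil: "\<And>x. (N ^^ m) x = 0"
  shows "automorphism (\<lambda>x. \<Sum>i<m. scale (inverse (fact i)) ((N ^^ i) x))"
proof -
  have lin: "lin_op N" and leib: "\<And>x y. N (x \<cdot> y) = N x \<cdot> y + x \<cdot> N y"
    using N by (simp_all add: derivation_def)
  define a where "a i x = scale (inverse (fact i)) ((N ^^ i) x)" for i x
  have Na: "N (a i x) = scale (of_nat (Suc i)) (a (Suc i) x)" for i x
    by (simp add: a_def lin_scale[OF lin] field_simps del: of_nat_Suc)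
  have a0: "a i x = 0" if "i \<ge> m" for i x
  proof -
    have "(N ^^ i) x = (N ^^ (i - m)) ((N ^^ m) x)"
      using that by (metis comp_apply funpow_add le_add_diff_inverse2)
    then show ?thesis by (simp add: a_def nil lin_zero[OF lin_funpow[OF lin]])
  qed
  have leibniz_rule: "a n (x \<cdot> y) = (\<Sum>i\<le>n. a i x \<cdot> a (n - i) y)" for n x y
  proof (induction n)
    case 0
    then show ?case by (simp add: a_def)
  next
    case (Suc n)
    let ?t = "\<lambda>i. a i x \<cdot> a (Suc n - i) y"
    have "scale (of_nat (Suc n)) (a (Suc n) (x \<cdot> y)) = N (a n (x \<cdot> y))" by (rule Na[symmetric])
    also have "\<dots> = (\<Sum>i\<le>n. N (a i x) \<cdot> a (n - i) y) + (\<Sum>i\<le>n. a i x \<cdot> N (a (n - i) y))"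
      unfolding Suc.IH by (simp add: lin_sum[OF lin] leib sum.distrib)
    also have "(\<Sum>i\<le>n. N (a i x) \<cdot> a (n - i) y) = (\<Sum>i\<le>n. scale (of_nat (Suc i)) (?t (Suc i)))"
      by (simp add: Na mult_scale_left)
    also have "\<dots> = (\<Sum>i\<le>Suc n. scale (of_nat i) (?t i))"
      unfolding sum.atMost_Suc_shift[of _ n] by simp
    also have "(\<Sum>i\<le>n. a i x \<cdot> N (a (n - i) y)) = (\<Sum>i\<le>n. scale (of_nat (Suc n - i)) (?t i))"
      by (intro sum.cong refl) (simp add: Na mult_scale_right Suc_diff_le)
    also have "\<dots> = (\<Sum>i\<le>Suc n. scale (of_nat (Suc n - i)) (?t i))" by simp
    also have "(\<Sum>i\<le>Suc n. scale (of_nat i) (?t i)) + \<dots> = (\<Sum>i\<le>Suc n. scale (of_nat (Suc n)) (?t i))"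
      unfolding sum.distrib[symmetric] scale_left_distrib[symmetric]
      by (intro sum.cong refl) (simp flip: of_nat_add)
    finally have "scale (of_nat (Suc n)) (a (Suc n) (x \<cdot> y)) = scale (of_nat (Suc n)) (\<Sum>i\<le>Suc n. ?t i)"
      by (simp only: scale_sum_right)
    then show ?case by (simp only: scale_cancel_left) (simp del: of_nat_Suc)
  qed
  let ?e = "\<Sum>i<m. Polynomial.monom (inverse (fact i)) i :: 'k poly"
  have \<theta>: "(\<lambda>x. \<Sum>i<m. a i x) = poly_op N ?e"
    by (rule ext) (simp add: poly_op_sum lin poly_op_monom a_def)
  have "(\<Sum>i<m. a i (x \<cdot> y)) = (\<Sum>i<m. a i x) \<cdot> (\<Sum>i<m. a i y)" for x y
  proof -
    have "(\<Sum>i<m. a i (x \<cdot> y)) = (\<Sum>i<2*m. a i (x \<cdot> y))"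
      by (rule sum.mono_neutral_left) (auto simp: a0)
    also have "\<dots> = (\<Sum>(i, j)\<in>{(i, j). i + j < 2*m}. a i x \<cdot> a j y)"
      by (simp add: leibniz_rule sum.triangle_reindex)
    also have "\<dots> = (\<Sum>(i, j)\<in>{..<m} \<times> {..<m}. a i x \<cdot> a j y)"
    proof (rule sum.mono_neutral_right)
      show "finite {(i, j). i + j < 2*m}"
        by (rule finite_subset[of _ "{..<2*m} \<times> {..<2*m}"]) auto
      show "\<forall>z\<in>{(i, j). i + j < 2*m} - {..<m} \<times> {..<m}. (case z of (i, j) \<Rightarrow> a i x \<cdot> a j y) = 0"
      proof
        fix z assume "z \<in> {(i, j). i + j < 2*m} - {..<m} \<times> {..<m}"
        then obtain i j where "z = (i, j)" "i \<ge> m \<or> j \<ge> m" by (cases z) (auto simp: not_less)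
        then show "(case z of (i, j) \<Rightarrow> a i x \<cdot> a j y) = 0"
          by (auto simp: a0 mult_zero_left mult_zero_right)
      qed
    qed auto
    also have "\<dots> = (\<Sum>i<m. a i x) \<cdot> (\<Sum>i<m. a i y)"
      by (simp only: sum.cartesian_product[symmetric] mult_sum_left) (simp only: mult_sum_right)
    finally show ?thesis .
  qed
  moreover have "bij (poly_op N ?e)"
  proof (cases m)
    case 0
    then have eq: "x = y" for x y :: 'a using nil[of x] nil[of y] by simp
    show ?thesis by (intro bijI injI surjI[of _ id]; rule eq)
  next
    case (Suc k)
    have "poly (1 - ?e) 0 = 0"
      unfolding Suc by (simp add: poly_sum poly_monom sum.lessThan_Suc_shift del: sum.lessThan_Suc)
    then have "[:0, 1:] dvd 1 - ?e" using poly_eq_0_iff_dvd[of "1 - ?e" 0] by simp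
    then have "[:0, 1:] ^ m dvd (1 - ?e) ^ m" by (rule dvd_power_same)
    moreover have "poly_op N ([:0, 1:] ^ m) x = 0" for x
      using poly_op_power[OF lin, of "[:0, 1:]" m x] nil poly_op_X[OF lin] by (metis ext)
    ultimately have "poly_op N ((1 - ?e) ^ m) x = 0" for x
      using poly_op_cong_dvd[OF lin] by blast
    moreover have "(1 - ?e) ^ m = 1 - ?e * (\<Sum>i<m. (1 - ?e) ^ i)"
      using one_diff_power_eq[of "1 - ?e" m] by (simp add: algebra_simps)
    ultimately have r: "poly_op N (?e * (\<Sum>i<m. (1 - ?e) ^ i)) x = x" for x
      by (simp add: poly_op_diff lin poly_op_1)
    have "poly_op N (\<Sum>i<m. (1 - ?e) ^ i) (poly_op N ?e x) = x" for x
      using r[of x] by (simp only: poly_op_mult[OF lin, symmetric] mult.commute)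
    with r show ?thesis
      by (intro o_bij[of "poly_op N (\<Sum>i<m. (1 - ?e) ^ i)"]) (simp_all add: fun_eq_iff poly_op_mult lin)
  qed
  ultimately show ?thesis
    unfolding automorphism_def a_def[symmetric] \<theta> using lin_poly_op[OF lin, of ?e] by (simp flip: \<theta>)
qed

text \<open>Here \<open>exp N - 1 = N w\<close> with a polynomial \<open>w\<close> in \<open>N\<close> that has constant term \<open>1\<close>. Modulo higher powers of \<open>N\<close>, the \<open>j\<close>-th
power of this operator is \<open>N ^^ j\<close>; descending from \<open>N ^^ m = 0\<close>, every positive power of \<open>N\<close>, times any polynomial in
\<open>N\<close>, preserves \<open>V\<close>.\<close>

lemma nilpotent_derivation_invariant:
  assumes N: "derivation N" and nil: "\<And>x. (N ^^ m) x = 0"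
    and V: "aut_invariant V" and x: "x \<in> V"
  shows "N x \<in> V"
proof -
  have lin: "lin_op N" using N by (simp add: derivation_def)
  have sub: "subspace V" using V by (simp add: aut_invariant_def)
  have zero: "poly_op N (q * [:0, 1:] ^ m) y = 0" for q y
  proof -
    have "poly_op N ([:0, 1:] ^ m) x = 0" for x
      using poly_op_power[OF lin, of "[:0, 1:]" m x] nil poly_op_X[OF lin] by (metis ext)
    then show ?thesis by (simp add: poly_op_mult lin lin_zero[OF lin_poly_op[OF lin]])
  qed
  define keeps where "keeps p \<longleftrightarrow> (\<forall>y\<in>V. poly_op N p y \<in> V)" for p
  have keeps_add: "keeps (p + q)" and keeps_diff: "keeps (p - q)" and keeps_mult: "keeps (p * q)"
    if "keeps p" "keeps q" for p q
    using that sub unfolding keeps_def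
    by (simp_all add: poly_op_add poly_op_diff poly_op_mult lin subspace_add subspace_diff)
  have keeps_smult: "keeps ([:c:] * p)" if "keeps p" for p c
    using that subspace_scale[OF sub] unfolding keeps_def poly_op_smult[OF lin] by blast
  let ?X = "[:0, 1:] :: 'k poly"
  show ?thesis
  proof (cases "m \<le> 1")
    case True
    then have "N x = 0" using nil[of x] nil[of "N x"] lin_zero[OF lin] by (cases m) auto
    then show ?thesis using sub subspace_0 by simp
  next
    case False
    then obtain k where m: "m = Suc (Suc k)" by (metis Suc_le_D not_less_eq_eq One_nat_def)
    define w where "w = (\<Sum>i<Suc k. Polynomial.monom (inverse (fact (Suc i))) i :: 'k poly)"
    have "poly_op N (1 + ?X * w) y = (\<Sum>i<m. scale (inverse (fact i)) ((N ^^ i) y))" for y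
    proof -
      have "1 + ?X * w = (\<Sum>i<m. Polynomial.monom (inverse (fact i)) i)"
        unfolding m sum.lessThan_Suc_shift[of _ "Suc k"] w_def sum_distrib_left
        by (simp add: monom_Suc one_pCons[symmetric] monom_0 del: sum.lessThan_Suc fact_Suc)
      then show ?thesis by (simp only: poly_op_sum lin poly_op_monom)
    qed
    moreover have "(\<Sum>i<m. scale (inverse (fact i)) ((N ^^ i) y)) \<in> V" if "y \<in> V" for y
      using nilpotent_derivation_exponential[OF N nil] V that unfolding aut_invariant_def by blast
    ultimately have "keeps (1 + ?X * w)" by (simp add: keeps_def)
    moreover have "keeps 1" by (simp add: keeps_def poly_op_1)
    ultimately have "keeps (1 + ?X * w - 1)" by (rule keeps_diff)
    then have q: "keeps (?X * w)" by simp
    have qpow: "keeps ((?X * w) ^ j)" for j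
      by (induction j) (simp_all add: \<open>keeps 1\<close> keeps_mult q del: mult_pCons_left mult_pCons_right)
    have w0: "?X dvd w ^ j - 1" for j
    proof -
      have "poly w 0 = 1"
        unfolding w_def by (simp add: poly_sum poly_monom sum.lessThan_Suc_shift del: sum.lessThan_Suc)
      then show ?thesis using poly_eq_0_iff_dvd[of "w ^ j - 1" 0] by simp
    qed
    have "keeps (?X ^ j * s)" if "1 \<le> j" "j \<le> m" for j s
      using that(2,1)
    proof (induction j arbitrary: s rule: inc_induct)
      case base
      show ?case using zero[of s] sub by (simp add: keeps_def mult.commute subspace_0)
    next
      case (step j)
      obtain s' where "w ^ j - 1 = ?X * s'" using w0 by blast
      then have "w ^ j = 1 + ?X * s'" by (simp add: diff_eq_eq add.commute)
      then have "(?X * w) ^ j = ?X ^ j * (1 + ?X * s')" by (simp only: power_mult_distrib)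
      then have "(?X * w) ^ j = ?X ^ j + ?X ^ Suc j * s'"
        by (simp only: distrib_left mult_1_right power_Suc2 mult.assoc)
      moreover have "1 \<le> Suc j" by simp
      ultimately have Xj: "keeps (?X ^ j)"
        using keeps_diff[OF qpow[of j] step.IH[of s']] by (simp only: add_diff_cancel_right')
      obtain c s'' where "s = pCons c s''" by (cases s)
      then have "s = [:c:] + ?X * s''" by simp
      then have "?X ^ j * s = [:c:] * ?X ^ j + ?X ^ Suc j * s''"
        by (simp only: distrib_left power_Suc2 mult.assoc mult.commute[of "[:c:]"])
      then show ?case using keeps_add[OF keeps_smult[OF Xj] step.IH] by simp
    qed
    from this[of 1 1] m have "keeps ?X" by simp
    then show ?thesis using x by (simp add: keeps_def poly_op_X lin)
  qed
qed

theorem aut_invariant_imp_derivation_invariant: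
  assumes D: "derivation D" and fin: "finite B" "span B = UNIV"
    and V: "aut_invariant V" and x: "x \<in> V"
  shows "D x \<in> V"
proof (rule jordan_decomposition[OF D fin])
  fix g u m
  assume g: "derivation (poly_op D g)"
    and nil: "\<And>x. poly_op D (([:0, 1:] - g) ^ m) x = 0"
    and inv: "\<And>V x. aut_invariant V \<Longrightarrow> x \<in> V \<Longrightarrow> poly_op D g x \<in> V"
  have lin: "lin_op D" using D by (simp add: derivation_def)
  let ?N = "\<lambda>x. D x - poly_op D g x"
  have N: "?N = poly_op D ([:0, 1:] - g)" by (rule ext) (simp add: poly_op_diff lin poly_op_X)
  have "(?N ^^ m) y = 0" for y
    unfolding N using nil by (simp add: poly_op_power lin)
  then have "?N x \<in> V"
    using nilpotent_derivation_invariant[OF derivation_minus[OF D g] _ V x] by blast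
  moreover have "subspace V" using V by (simp add: aut_invariant_def)
  ultimately have "?N x + poly_op D g x \<in> V"
    using inv[OF V x] subspace_add by blast
  then show ?thesis by simp
qed

end

section \<open>The trace\<close>

context op_space
begin

definition trace :: "'b set \<Rightarrow> ('b \<Rightarrow> 'b) \<Rightarrow> 'a"
  where "trace B T = (\<Sum>b\<in>B. representation B (T b) b)"

lemma trace_commute:
  assumes B: "finite B" "independent B" "span B = UNIV" and lin: "lin_op S" "lin_op T"
  shows "trace B (\<lambda>x. S (T x)) = trace B (\<lambda>x. T (S x))"
proof -
  have expand: "representation B (S (T b)) b = (\<Sum>c\<in>B. representation B (T b) c * representation B (S c) b)"
    if "lin_op S" for S T b
  proof -
    have "T b = (\<Sum>c\<in>B. scale (representation B (T b) c) c)"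
      using sum_representation_eq[OF B(2) _ B(1)] B(3) by simp
    then have "S (T b) = S (\<Sum>c\<in>B. scale (representation B (T b) c) c)" by (rule arg_cong)
    also have "\<dots> = (\<Sum>c\<in>B. scale (representation B (T b) c) (S c))"
      by (simp only: lin_sum[OF that] lin_scale[OF that])
    finally have "representation B (S (T b)) b
        = representation B (\<Sum>c\<in>B. scale (representation B (T b) c) (S c)) b" by simp
    then show ?thesis
      using B by (simp add: representation_sum representation_scale)
  qed
  have "trace B (\<lambda>x. S (T x)) = (\<Sum>b\<in>B. \<Sum>c\<in>B. representation B (T b) c * representation B (S c) b)"
    unfolding trace_def by (intro sum.cong refl expand lin)
  also have "\<dots> = (\<Sum>c\<in>B. \<Sum>b\<in>B. representation B (S c) b * representation B (T b) c)"
    by (subst sum.swap) (simp only: mult.commute)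
  also have "\<dots> = trace B (\<lambda>x. T (S x))"
    unfolding trace_def by (intro sum.cong refl expand[symmetric] lin)
  finally show ?thesis .
qed

lemma trace_add:
  assumes "independent B" "span B = UNIV"
  shows "trace B (\<lambda>x. S x + T x) = trace B S + trace B T"
  using assms by (simp add: trace_def representation_add sum.distrib)

lemma trace_diff:
  assumes "independent B" "span B = UNIV"
  shows "trace B (\<lambda>x. S x - T x) = trace B S - trace B T"
  using assms by (simp add: trace_def representation_diff sum_subtractf)

lemma trace_scale:
  assumes "independent B" "span B = UNIV"
  shows "trace B (\<lambda>x. scale c (T x)) = c * trace B T"
  using assms by (simp add: trace_def representation_scale sum_distrib_left)

lemma trace_zero: "trace B (\<lambda>x. 0) = 0"
  by (simp add: trace_def representation_zero)

lemma projection_exists: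
  assumes "subspace V"
  obtains p where "lin_op p" "\<And>x. p x \<in> V" "\<And>x. x \<in> V \<Longrightarrow> p x = x"
proof -
  interpret pair: vector_space_pair scale scale by unfold_locales
  have "lin_op (\<lambda>x. x)" by (simp add: lin_iff)
  then have "\<exists>g. g ` UNIV \<subseteq> V \<and> lin_op g \<and> (\<forall>v\<in>V. g v = v)"
    using pair.linear_exists_left_inverse_on[of "\<lambda>x. x" V] assms by auto
  then show ?thesis using that by blast
qed

text \<open>If \<open>p\<close> projects onto the image of \<open>N ^^ i\<close>, then the trace of \<open>N p\<close> does not depend on \<open>i\<close>: with \<open>p'\<close> for the next image,
\<open>N p = p' N p\<close> has the same trace as \<open>N p p' = N p'\<close>. For \<open>i = m\<close> the projection is \<open>0\<close>.\<close>

lemma trace_nilpotent: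
  assumes B: "finite B" "independent B" "span B = UNIV"
    and lin: "lin_op N" and nil: "\<And>x. (N ^^ m) x = 0"
  shows "trace B N = 0"
proof -
  have sub: "subspace (range (N ^^ i))" for i
  proof (rule subspaceI)
    note L = lin_funpow[OF lin, of i]
    show "0 \<in> range (N ^^ i)" using lin_zero[OF L] by (intro range_eqI[of _ _ 0]) simp
    show "x + y \<in> range (N ^^ i)" if "x \<in> range (N ^^ i)" "y \<in> range (N ^^ i)" for x y
      using that by (auto simp: lin_add[OF L, symmetric])
    show "scale c x \<in> range (N ^^ i)" if "x \<in> range (N ^^ i)" for c x
      using that by (auto simp: lin_scale[OF L, symmetric])
  qed
  have "\<exists>p. lin_op p \<and> (\<forall>x. p x \<in> range (N ^^ i)) \<and> (\<forall>x\<in>range (N ^^ i). p x = x) \<and>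
      trace B N = trace B (\<lambda>x. N (p x))" for i
  proof (induction i)
    case 0
    show ?case by (rule exI[of _ "\<lambda>x. x"]) (simp add: lin_iff)
  next
    case (Suc i)
    then obtain p where p: "lin_op p" "\<And>x. p x \<in> range (N ^^ i)"
        "\<And>x. x \<in> range (N ^^ i) \<Longrightarrow> p x = x" "trace B N = trace B (\<lambda>x. N (p x))"
      by blast
    obtain p' where p': "lin_op p'" "\<And>x. p' x \<in> range (N ^^ Suc i)"
        "\<And>x. x \<in> range (N ^^ Suc i) \<Longrightarrow> p' x = x"
      using projection_exists[OF sub[of "Suc i"]] by metis
    have "N (p x) \<in> range (N ^^ Suc i)" for x
      using p(2)[of x] by auto
    then have "trace B N = trace B (\<lambda>x. p' (N (p x)))" using p(4) p'(3) by simp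
    also have "\<dots> = trace B (\<lambda>x. N (p (p' x)))"
      by (rule trace_commute[OF B p'(1) lin_comp[OF lin p(1)]])
    also have "(\<lambda>x. N (p (p' x))) = (\<lambda>x. N (p' x))"
    proof
      fix x
      obtain y where "p' x = (N ^^ i) (N y)" using p'(2)[of x] by (auto simp: funpow_swap1)
      then show "N (p (p' x)) = N (p' x)" using p(3) by simp
    qed
    finally show ?case using p' by blast
  qed
  then obtain p where "\<And>x. p x \<in> range (N ^^ m)" "trace B N = trace B (\<lambda>x. N (p x))" by metis
  moreover have "range (N ^^ m) \<subseteq> {0}" using nil by auto
  ultimately have "trace B N = trace B (\<lambda>x. N (p x))" "\<And>x. p x = 0" by blast+
  then show ?thesis by (simp add: lin_zero[OF lin] trace_zero)
qed

end

text \<open>For a basis that extends a basis of the image, the diagonal entries are \<open>1\<close> at the vectors in the image and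
\<open>0\<close> at the others. In characteristic \<open>0\<close> an idempotent of trace \<open>0\<close> is therefore \<open>0\<close>.\<close>

lemma (in op_space) idempotent_trace:
  assumes fin: "finite A" "span A = UNIV" and lin: "lin_op E" and idem: "\<And>x. E (E x) = E x"
  obtains B where "finite B" "independent B" "span B = UNIV"
    and "trace B E = of_nat (card (B \<inter> range E))" "(\<forall>x. E x = 0) \<or> B \<inter> range E \<noteq> {}"
proof -
  obtain C where C: "C \<subseteq> range E" "independent C" "range E \<subseteq> span C"
    by (rule maximal_independent_subset[of "range E"])
  let ?B = "extend_basis C"
  have B: "independent ?B" "span ?B = UNIV" "C \<subseteq> ?B"
    using independent_extend_basis[OF C(2)] span_extend_basis[OF C(2)] extend_basis_superset[OF C(2)]
    by auto
  have finB: "finite ?B" using independent_span_bound[OF fin(1) B(1)] fin(2) by simp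
  have "representation ?B (E b) b = (if b \<in> range E then 1 else 0)" if "b \<in> ?B" for b
  proof (cases "b \<in> range E")
    case True
    then have "E b = b" using idem by auto
    then show ?thesis using True that B(1) by (simp add: representation_basis)
  next
    case False
    then have "b \<notin> C" using C(1) by blast
    have "representation ?B (E b) = representation C (E b)"
      by (rule representation_extend) (use B C(3) in auto)
    moreover have "representation C (E b) b = 0"
      using \<open>b \<notin> C\<close> representation_ne_zero[of C "E b" b] by blast
    ultimately show ?thesis using False by simp
  qed
  then have "trace ?B E = (\<Sum>b\<in>?B. if b \<in> range E then 1 else 0)"
    unfolding trace_def by (rule sum.cong[OF refl])
  also have "\<dots> = of_nat (card (?B \<inter> range E))"
    using finB by (simp add: sum.If_cases)
  finally have "trace ?B E = of_nat (card (?B \<inter> range E))" .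
  moreover have "(\<forall>x. E x = 0) \<or> ?B \<inter> range E \<noteq> {}"
  proof (cases "C = {}")
    case True
    then have "E x = 0" for x using C(3) by auto
    then show ?thesis by blast
  next
    case False
    then show ?thesis using C(1) B(3) by blast
  qed
  ultimately show ?thesis using that finB B by blast
qed

section \<open>Leibniz algebras of finite dimension\<close>

locale fd_leibniz = leibniz_algebra scale mult
  for scale :: "'k::field_char_0 \<Rightarrow> 'a::ab_group_add \<Rightarrow> 'a"
    and mult :: "'a \<Rightarrow> 'a \<Rightarrow> 'a"  (infixl \<open>\<cdot>\<close> 70) +
  assumes fd: "finite_dimensional"

sublocale fd_leibniz \<subseteq> bilinear_algebra scale mult
  by (intro bilinear_algebra.intro op_space.intro vector_space_axioms
      bilinear_algebra_axioms.intro linear_mult_left linear_mult_right)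

sublocale fd_leibniz \<subseteq> finite_dimensional_vector_space scale "extend_basis {}"
proof
  obtain A where A: "finite A" "span A = UNIV" using fd by (auto simp: finite_dimensional_def)
  show ind: "independent (extend_basis {})" using independent_extend_basis independent_empty by blast
  show "span (extend_basis {}) = UNIV" using span_extend_basis independent_empty by blast
  show "finite (extend_basis {})" using independent_span_bound[OF A(1) ind] A(2) by simp
qed

context fd_leibniz
begin

text \<open>This ideal measures the failure of anticommutativity: it contains all squares, and the quotient by it is a Lie algebra.\<close>

definition left_ann :: "'a set"
  where "left_ann = {z. \<forall>y. z \<cdot> y = 0}"

lemma left_ann_mult: "z \<in> left_ann \<Longrightarrow> z \<cdot> y = 0"
  by (simp add: left_ann_def)

lemma subspace_left_ann: "subspace left_ann"
  by (rule subspaceI) (simp_all add: left_ann_def mult_zero_left mult_add_left mult_scale_left)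

lemma mult_left_ann: "z \<in> left_ann \<Longrightarrow> a \<cdot> z \<in> left_ann"
  unfolding left_ann_def
proof (clarify)
  fix y assume "\<forall>y. z \<cdot> y = 0"
  then show "a \<cdot> z \<cdot> y = 0" using leibniz[of a z y] by (simp add: mult_zero_right)
qed

lemma square_left_ann: "a \<cdot> a \<in> left_ann"
  unfolding left_ann_def
proof (clarify)
  fix y
  show "a \<cdot> a \<cdot> y = 0" using leibniz[of a a y] by (metis add_cancel_left_left)
qed

lemma anticommutator_left_ann: "a \<cdot> b + b \<cdot> a \<in> left_ann"
proof -
  have "a \<cdot> b + b \<cdot> a = (a + b) \<cdot> (a + b) - a \<cdot> a - b \<cdot> b"
    by (simp add: mult_add_left mult_add_right)
  then show ?thesis using square_left_ann subspace_left_ann by (simp add: subspace_diff)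
qed

lemma derivation_left_mult: "derivation (\<lambda>y. a \<cdot> y)"
  unfolding derivation_def using lin_mult_left leibniz by blast

lemma subalgebra_subspace: "subalgebra S \<Longrightarrow> subspace S"
  and subalgebra_mult: "subalgebra S \<Longrightarrow> x \<in> S \<Longrightarrow> y \<in> S \<Longrightarrow> x \<cdot> y \<in> S"
  by (simp_all add: subalgebra_def)

lemma subalgebra_left_ann: "subalgebra left_ann"
  by (simp add: subalgebra_def subspace_left_ann mult_left_ann)

text \<open>A member of greatest dimension has no proper extension.\<close>

lemma maximal_subspace_with_property:
  assumes "P S0" and "\<And>S. P S \<Longrightarrow> subspace S"
  obtains S where "P S" "\<And>T. P T \<Longrightarrow> S \<subseteq> T \<Longrightarrow> T = S"
proof -
  have "\<exists>S. P S \<and> (\<forall>T. P T \<longrightarrow> dim T \<le> dim S)"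
    by (rule ex_has_greatest_nat[where P = P and k = S0 and f = dim and b = "Suc dimension"])
      (simp_all add: assms(1) dim_subset_UNIV less_Suc_eq_le)
  then obtain S where S: "P S" "\<And>T. P T \<Longrightarrow> dim T \<le> dim S" by blast
  have "T = S" if "P T" "S \<subseteq> T" for T
    using subspace_dim_equal[OF assms(2)[OF S(1)] assms(2)[OF \<open>P T\<close>] \<open>S \<subseteq> T\<close>] S(2)[OF \<open>P T\<close>] by simp
  with S(1) show ?thesis using that by blast
qed

lemma proper_subalgebra_in_maximal:
  assumes "subalgebra S" "S \<noteq> UNIV"
  obtains M where "maximal_subalgebra M" "S \<subseteq> M"
proof (rule maximal_subspace_with_property[of "\<lambda>T. subalgebra T \<and> S \<subseteq> T \<and> T \<noteq> UNIV"])
  fix M assume M: "subalgebra M \<and> S \<subseteq> M \<and> M \<noteq> UNIV"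
    and max: "\<And>T. subalgebra T \<and> S \<subseteq> T \<and> T \<noteq> UNIV \<Longrightarrow> M \<subseteq> T \<Longrightarrow> T = M"
  have "T = M \<or> T = UNIV" if "subalgebra T" "M \<subseteq> T" for T
    using max[of T] that M by blast
  with M have "maximal_subalgebra M" by (simp add: maximal_subalgebra_def)
  then show ?thesis using that M by blast
qed (use assms subalgebra_subspace in auto)

lemma frattini_subset_maximal: "maximal_subalgebra M \<Longrightarrow> frattini \<subseteq> M"
  by (auto simp: frattini_def)

lemma subspace_frattini: "subspace frattini"
  unfolding frattini_def
  by (rule subspace_Inter) (simp add: maximal_subalgebra_def subalgebra_def)

lemma automorphism_preserves_maximal:
  assumes \<theta>: "automorphism \<theta>" and M: "maximal_subalgebra M"
  shows "maximal_subalgebra (\<theta> -` M)"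
proof -
  have lin: "lin_op \<theta>" and bij: "bij \<theta>" and mult: "\<And>x y. \<theta> (x \<cdot> y) = \<theta> x \<cdot> \<theta> y"
    using \<theta> by (simp_all add: automorphism_def)
  have surj: "surj \<theta>" using bij by (rule bij_is_surj)
  have subM: "subalgebra M" using M by (simp add: maximal_subalgebra_def)
  have "subalgebra (\<theta> -` M)"
    using subM
    by (simp add: subalgebra_def subspace_def lin_zero[OF lin] lin_add[OF lin] lin_scale[OF lin] mult)
  moreover have "\<theta> -` M \<noteq> UNIV"
    using M surj by (metis maximal_subalgebra_def surj_image_vimage_eq)
  moreover have "S = \<theta> -` M \<or> S = UNIV" if S: "subalgebra S" "\<theta> -` M \<subseteq> S" for S
  proof -
    have "subalgebra (\<theta> ` S)"
      unfolding subalgebra_def subspace_def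
    proof (intro conjI ballI allI)
      have "0 \<in> S" using S(1) by (simp add: subalgebra_def subspace_0)
      then show "0 \<in> \<theta> ` S" using lin_zero[OF lin] by (metis imageI)
    qed (use S(1) in \<open>auto simp: subalgebra_def subspace_add subspace_scale
      lin_add[OF lin, symmetric] lin_scale[OF lin, symmetric] mult[symmetric]\<close>)
    moreover have "M \<subseteq> \<theta> ` S" using S(2) surj by (metis image_mono surj_image_vimage_eq)
    ultimately have "\<theta> ` S = M \<or> \<theta> ` S = UNIV" using M by (simp add: maximal_subalgebra_def)
    moreover have "\<theta> -` (\<theta> ` S) = S" using bij by (simp add: bij_is_inj inj_vimage_image_eq)
    ultimately show ?thesis by (metis vimage_UNIV)
  qed
  ultimately show ?thesis by (simp add: maximal_subalgebra_def)
qed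

lemma aut_invariant_frattini: "aut_invariant frattini"
  unfolding aut_invariant_def
proof (intro conjI allI impI ballI)
  fix \<theta> x assume \<theta>: "automorphism \<theta>" and x: "x \<in> frattini"
  show "\<theta> x \<in> frattini"
    unfolding frattini_def
  proof (rule InterI)
    fix M assume "M \<in> {M. maximal_subalgebra M}"
    then have "maximal_subalgebra (\<theta> -` M)" using automorphism_preserves_maximal[OF \<theta>] by simp
    then show "\<theta> x \<in> M" using x frattini_subset_maximal by blast
  qed
qed (rule subspace_frattini)

lemma frattini_left_ideal: "x \<in> frattini \<Longrightarrow> a \<cdot> x \<in> frattini"
  using aut_invariant_imp_derivation_invariant[OF derivation_left_mult finite_Basis span_Basis
      aut_invariant_frattini] .

text \<open>Every subspace above the span of all products is a subalgebra. A vector outside this span lies outside some hyperplane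
above it, and hyperplanes that are subalgebras are maximal.\<close>

lemma frattini_subset_products: "frattini \<subseteq> span {a \<cdot> b | a b. True}"
proof
  fix x assume x: "x \<in> frattini"
  let ?P = "span {a \<cdot> b | a b. True}"
  show "x \<in> ?P"
  proof (rule ccontr)
    assume nx: "x \<notin> ?P"
    obtain C where C: "C \<subseteq> ?P" "independent C" "?P \<subseteq> span C"
      by (rule maximal_independent_subset[of ?P])
    have spanC: "span C = ?P" using span_minimal[OF C(1) subspace_span] C(3) by (rule subset_antisym)
    have ind: "independent (insert x C)" using C(2) nx by (simp add: independent_insert spanC)
    let ?B = "extend_basis (insert x C)"
    have B: "independent ?B" "span ?B = UNIV" "insert x C \<subseteq> ?B"
      using independent_extend_basis[OF ind] span_extend_basis[OF ind] extend_basis_superset[OF ind]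
      by auto
    define \<phi> where "\<phi> v = representation ?B v x" for v
    have \<phi>: "\<phi> (v + w) = \<phi> v + \<phi> w" "\<phi> (scale c v) = c * \<phi> v" "\<phi> 0 = 0" for v w c
      using B by (simp_all add: \<phi>_def representation_add representation_scale representation_zero)
    have \<phi>x: "\<phi> x = 1" using B by (simp add: \<phi>_def representation_basis)
    have \<phi>P: "\<phi> v = 0" if "v \<in> ?P" for v
    proof -
      have "representation ?B v = representation C v"
        by (rule representation_extend) (use B that spanC in auto)
      moreover have "x \<notin> C" using nx C(1) by blast
      ultimately show ?thesis unfolding \<phi>_def using representation_ne_zero[of C v x] by metis
    qed
    let ?H = "{v. \<phi> v = 0}"
    have prod: "a \<cdot> b \<in> ?H" for a b using \<phi>P by (auto intro: span_base)
    have "subalgebra ?H"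
      using prod by (simp add: subalgebra_def subspace_def \<phi>)
    moreover have "?H \<noteq> UNIV"
    proof
      assume "?H = UNIV"
      then have "x \<in> ?H" by simp
      then show False using \<phi>x by simp
    qed
    moreover have "S = ?H \<or> S = UNIV" if S: "subalgebra S" "?H \<subseteq> S" for S
    proof (cases "S = ?H")
      case False
      then obtain s where s: "s \<in> S" "\<phi> s \<noteq> 0" using S(2) by blast
      have "v \<in> S" for v
      proof -
        let ?c = "\<phi> v / \<phi> s"
        have "\<phi> (v + scale (- ?c) s) = 0" using s(2) by (simp only: \<phi>) simp
        then have "v + scale (- ?c) s \<in> S" using S(2) by blast
        moreover have "scale ?c s \<in> S" using S(1) s(1) by (simp add: subalgebra_def subspace_scale)
        ultimately have "v + scale (- ?c) s + scale ?c s \<in> S"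
          using S(1) subspace_add by (simp only: subalgebra_def)
        then show ?thesis by (simp add: scale_minus_left)
      qed
      then show ?thesis by blast
    qed simp
    ultimately have "maximal_subalgebra ?H" by (simp add: maximal_subalgebra_def)
    then have "x \<in> ?H" using x frattini_subset_maximal by blast
    then show False using \<phi>x by simp
  qed
qed

section \<open>Left multiplications by Frattini elements are nilpotent\<close>

text \<open>Let \<open>E\<close> be the projection onto the image of the semisimple part \<open>S\<close> of \<open>L\<^sub>x\<close> along its kernel and \<open>G\<close> the inverse of \<open>S\<close> on
the image, extended by \<open>0\<close>. Both are polynomials in \<open>S\<close> and commute with all left multiplications. As \<open>x\<close> is a sum of
products, \<open>L\<^sub>x G\<close> is a sum of commutators and has trace \<open>0\<close>; but it is \<open>E\<close> plus a nilpotent operator. So the trace of \<open>E\<close>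
is \<open>0\<close>, which forces \<open>E = 0\<close> and \<open>S = 0\<close>.\<close>

lemma nilpotent_if_semisimple_part_commutes:
  assumes x: "x \<in> span {a \<cdot> b | a b. True}"
    and g: "\<And>v. poly_op (\<lambda>y. x \<cdot> y) (([:0, 1:] - g) ^ m) v = 0"
    and pseudo: "\<And>v. poly_op (\<lambda>y. x \<cdot> y) g (poly_op (\<lambda>y. x \<cdot> y) g (poly_op (\<lambda>y. x \<cdot> y) (pcompose u g) v))
      = poly_op (\<lambda>y. x \<cdot> y) g v"
    and comm: "\<And>a v. a \<cdot> poly_op (\<lambda>y. x \<cdot> y) g v = poly_op (\<lambda>y. x \<cdot> y) g (a \<cdot> v)"
  shows "((\<lambda>y. x \<cdot> y) ^^ m) v = 0"
proof -
  let ?D = "\<lambda>y. x \<cdot> y"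
  let ?S = "poly_op ?D g" and ?h = "pcompose u g"
  let ?H = "poly_op ?D ?h" and ?e = "g * ?h" and ?n = "[:0, 1:] - g"
  let ?E = "poly_op ?D ?e"
  note lin = lin_mult_left[of x]
  have linp: "lin_op (poly_op ?D p)" for p by (rule lin_poly_op[OF lin])
  have mul: "poly_op ?D (p * q) v = poly_op ?D p (poly_op ?D q v)" for p q v by (rule poly_op_mult[OF lin])
  have swap: "poly_op ?D p (poly_op ?D q v) = poly_op ?D q (poly_op ?D p v)" for p q v
    by (simp only: mul[symmetric] mult.commute)
  have SE: "?S (?E v) = ?S v" for v using pseudo[of v] by (simp only: mul)
  have E: "?E v = ?H (?S v)" for v by (simp only: mul swap[of g])
  have idem: "?E (?E v) = ?E v" for v
    using SE[of v] by (simp only: E[of "?E v"]) (simp only: E)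
  have commH: "a \<cdot> ?H v = ?H (a \<cdot> v)" for a v
    unfolding poly_op_pcompose[OF lin]
    by (rule poly_op_commute[OF linp lin_mult_left]) (rule comm)
  let ?G = "poly_op ?D (?h * ?e)"
  have commG: "a \<cdot> ?G v = ?G (a \<cdot> v)" for a v
    by (simp only: mul commH comm)
  obtain B where B: "finite B" "independent B" "span B = UNIV"
    and trE: "trace B ?E = of_nat (card (B \<inter> range ?E))" "(\<forall>v. ?E v = 0) \<or> B \<inter> range ?E \<noteq> {}"
    using idempotent_trace[OF finite_Basis span_Basis linp idem] by metis
  note B' = B(2,3)
  have tr_y: "trace B (\<lambda>v. y \<cdot> ?G v) = 0" if "y \<in> span {a \<cdot> b | a b. True}" for y
    using that
  proof (induction rule: span_induct_alt)
    case base
    then show ?case by (simp add: mult_zero_left trace_zero)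
  next
    case (step c z y)
    then obtain a b where z: "z = a \<cdot> b" by blast
    have "z \<cdot> ?G v = a \<cdot> (b \<cdot> ?G v) - b \<cdot> ?G (a \<cdot> v)" for v
      using leibniz[of a b "?G v"] by (simp add: z commG)
    then have "trace B (\<lambda>v. z \<cdot> ?G v) = trace B (\<lambda>v. a \<cdot> (b \<cdot> ?G v)) - trace B (\<lambda>v. b \<cdot> ?G (a \<cdot> v))"
      by (simp only: trace_diff[OF B'])
    also have "trace B (\<lambda>v. a \<cdot> (b \<cdot> ?G v)) = trace B (\<lambda>v. b \<cdot> ?G (a \<cdot> v))"
      by (rule trace_commute[OF B lin_mult_left lin_comp[OF lin_mult_left linp]])
    finally show ?case
      using step.IH by (simp add: mult_add_left mult_scale_left trace_add[OF B'] trace_scale[OF B'])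
  qed
  \<comment> \<open>\<open>L\<^sub>x = S + N\<close> with \<open>S G = E\<close>\<close>
  have split: "x \<cdot> ?G v = ?E v + poly_op ?D (?n * (?h * ?e)) v" for v
  proof -
    have "[:0, 1:] * (?h * ?e) = g * (?h * ?e) + ?n * (?h * ?e)" by (simp only: left_diff_distrib) simp
    then have "x \<cdot> ?G v = poly_op ?D (g * (?h * ?e)) v + poly_op ?D (?n * (?h * ?e)) v"
      using mul[of "[:0, 1:]" "?h * ?e" v] by (simp only: poly_op_X[OF lin] poly_op_add[OF lin])
    moreover have "g * (?h * ?e) = ?e * ?e" by (simp only: mult.assoc)
    ultimately show ?thesis by (simp only: mul[of ?e ?e] idem)
  qed
  have "trace B (poly_op ?D (?n * (?h * ?e))) = 0"
  proof (rule trace_nilpotent[OF B linp])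
    show "(poly_op ?D (?n * (?h * ?e)) ^^ m) v = 0" for v
      unfolding poly_op_power[OF lin, symmetric] power_mult_distrib
      by (rule poly_op_cong_dvd[OF lin g]) simp
  qed
  then have "trace B ?E = 0"
    using tr_y[OF x] by (simp only: split trace_add[OF B']) simp
  then have "?E v = 0" for v using trE B(1) by auto
  then have "?S v = 0" for v using SE lin_zero[OF linp] by metis
  then have "?D = poly_op ?D ?n"
    by (intro ext) (simp add: poly_op_diff[OF lin] poly_op_X[OF lin])
  then have "(?D ^^ m) v = (poly_op ?D ?n ^^ m) v" by (rule arg_cong)
  then show ?thesis using g[of v] by (simp only: poly_op_power[OF lin])
qed

text \<open>What remains is that all left multiplications commute with the semisimple part \<open>S\<close> of \<open>L\<^sub>x\<close>. This holds for those by
elements of \<open>ker S\<close>, as \<open>S\<close> is a derivation, and these are all left multiplications if \<open>ker S + left_ann\<close> is everything.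
The latter is the non-generator property of the Frattini subalgebra: a maximal subalgebra above \<open>ker S + left_ann\<close> would
contain the image of \<open>S\<close> too.\<close>

lemma frattini_left_mult_nilpotent:
  assumes x: "x \<in> frattini"
  shows "\<exists>m. \<forall>v. ((\<lambda>y. x \<cdot> y) ^^ m) v = 0"
proof (rule jordan_decomposition[OF derivation_left_mult[of x] finite_Basis span_Basis])
  let ?D = "\<lambda>y. x \<cdot> y"
  fix g u m
  assume der: "derivation (poly_op ?D g)"
    and nil: "\<And>v. poly_op ?D (([:0, 1:] - g) ^ m) v = 0"
    and pseudo: "\<And>v. poly_op ?D g (poly_op ?D g (poly_op ?D (pcompose u g) v)) = poly_op ?D g v"
  let ?S = "poly_op ?D g" and ?H = "poly_op ?D (pcompose u g)"
  note lin = lin_mult_left[of x]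
  have linS: "lin_op ?S" by (rule lin_poly_op[OF lin])
  have SH: "?H (?S v) = ?S (?H v)" for v
    by (simp only: poly_op_mult[OF lin, symmetric] mult.commute)
  let ?T = "{y. \<exists>z\<in>left_ann. ?S (y - z) = 0}"
  have T: "subalgebra ?T"
    unfolding subalgebra_def
  proof (intro conjI ballI)
    show "subspace ?T"
    proof (rule subspaceI)
      show "0 \<in> ?T" using subspace_0[OF subspace_left_ann] by (auto intro!: bexI[of _ 0] simp: lin_zero[OF linS])
      fix v w assume "v \<in> ?T" "w \<in> ?T"
      then obtain y z where "y \<in> left_ann" "?S (v - y) = 0" "z \<in> left_ann" "?S (w - z) = 0" by blast
      moreover from this have "?S (v + w - (y + z)) = 0"
        using lin_add[OF linS, of "v - y" "w - z"] by (simp add: algebra_simps)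
      ultimately show "v + w \<in> ?T" using subspace_add[OF subspace_left_ann] by blast
    next
      fix c v assume "v \<in> ?T"
      then obtain y where "y \<in> left_ann" "?S (v - y) = 0" by blast
      moreover from this have "?S (scale c v - scale c y) = 0"
        using lin_scale[OF linS, of c "v - y"] by (simp add: scale_right_diff_distrib)
      ultimately show "scale c v \<in> ?T" using subspace_scale[OF subspace_left_ann] by blast
    qed
    fix v w assume "v \<in> ?T" "w \<in> ?T"
    then obtain y z where yz: "y \<in> left_ann" "?S (v - y) = 0" "z \<in> left_ann" "?S (w - z) = 0" by blast
    have "v \<cdot> w - (v - y) \<cdot> z = (v - y) \<cdot> (w - z)"
      using left_ann_mult[OF yz(1)] by (simp add: mult_diff_left mult_diff_right)
    then have "?S (v \<cdot> w - (v - y) \<cdot> z) = 0"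
      using der yz by (simp add: derivation_def mult_zero_left mult_zero_right)
    then show "v \<cdot> w \<in> ?T" using mult_left_ann[OF yz(3)] by blast
  qed
  have "?T = UNIV"
  proof (rule ccontr)
    assume "?T \<noteq> UNIV"
    then obtain M where M: "maximal_subalgebra M" "?T \<subseteq> M"
      using proper_subalgebra_in_maximal[OF T] by blast
    have subM: "subspace M" using M(1) by (simp add: maximal_subalgebra_def subalgebra_def)
    have annM: "left_ann \<subseteq> M"
    proof
      fix z assume "z \<in> left_ann"
      then have "z \<in> ?T" using lin_zero[OF linS] by (auto intro!: bexI[of _ z])
      then show "z \<in> M" using M(2) by blast
    qed
    have DM: "x \<cdot> v \<in> M" for v
    proof -
      have "v \<cdot> x + x \<cdot> v \<in> M" using anticommutator_left_ann annM by blast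
      moreover have "v \<cdot> x \<in> M" using frattini_left_ideal[OF x] frattini_subset_maximal[OF M(1)] by blast
      ultimately have "(v \<cdot> x + x \<cdot> v) - v \<cdot> x \<in> M" using subspace_diff[OF subM] by blast
      then show ?thesis by simp
    qed
    \<comment> \<open>modulo \<open>D\<close> the operator \<open>S\<close> is the nilpotent \<open>S - D\<close>\<close>
    have SmM: "(?S ^^ m) v \<in> M" for v
    proof -
      have "g - (g - [:0, 1:]) dvd g ^ m - (g - [:0, 1:]) ^ m"
        unfolding power_diff_sumr2 by (rule dvd_triv_left)
      then obtain r where r: "g ^ m - (g - [:0, 1:]) ^ m = [:0, 1:] * r"
        by (auto elim!: dvdE simp del: mult_pCons_left)
      have "[:0, 1:] - g dvd g - [:0, 1:]" by (metis dvd_refl dvd_minus_iff minus_diff_eq)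
      then have "poly_op ?D ((g - [:0, 1:]) ^ m) v = 0"
        by (intro poly_op_cong_dvd[OF lin nil] dvd_power_same)
      moreover have "poly_op ?D (g ^ m - (g - [:0, 1:]) ^ m) v = x \<cdot> poly_op ?D r v"
        unfolding r poly_op_mult[OF lin] by (rule poly_op_X[OF lin])
      ultimately have "poly_op ?D (g ^ m) v = x \<cdot> poly_op ?D r v"
        by (simp only: poly_op_diff[OF lin]) simp
      then show ?thesis using DM by (simp only: poly_op_power[OF lin])
    qed
    \<comment> \<open>the image of \<open>S\<close> equals the image of every positive power of \<open>S\<close>\<close>
    have "\<exists>w. ?S v = (?S ^^ Suc j) w" for v j
    proof (induction j)
      case (Suc j)
      then obtain w where "?S v = (?S ^^ j) (?S w)" by (auto simp: funpow_swap1)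
      also have "?S w = ?S (?S (?H w))" by (simp only: pseudo)
      finally have "?S v = (?S ^^ Suc (Suc j)) (?H w)" by (simp add: funpow_swap1)
      then show ?case by blast
    qed auto
    then have SM: "?S v \<in> M" for v using SmM by (metis funpow_Suc_right comp_apply)
    have "v \<in> M" for v
    proof -
      have "?S (v - ?H (?S v)) = 0"
        using pseudo[of v] by (simp add: lin_diff[OF linS] SH)
      then have "v - ?H (?S v) \<in> ?T" using subspace_0[OF subspace_left_ann] by (auto intro!: bexI[of _ 0])
      then have "v - ?H (?S v) \<in> M" using M(2) by blast
      moreover have "?H (?S v) \<in> M" using SM by (simp only: SH)
      ultimately have "v - ?H (?S v) + ?H (?S v) \<in> M" using subspace_add[OF subM] by blast
      then show ?thesis by simp
    qed
    then show False using M(1) by (auto simp: maximal_subalgebra_def)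
  qed
  have comm: "a \<cdot> ?S v = ?S (a \<cdot> v)" for a v
  proof -
    obtain z where z: "z \<in> left_ann" "?S (a - z) = 0" using \<open>?T = UNIV\<close> by blast
    have eq: "a \<cdot> w = (a - z) \<cdot> w" for w by (simp add: mult_diff_left left_ann_mult[OF z(1)])
    show ?thesis
      unfolding eq using der z(2) by (simp add: derivation_def mult_zero_left)
  qed
  have "((\<lambda>y. x \<cdot> y) ^^ m) v = 0" for v
    using nilpotent_if_semisimple_part_commutes[OF _ nil pseudo comm] frattini_subset_products x by blast
  then show ?thesis by blast
qed

section \<open>Engel's theorem for left multiplications\<close>

text \<open>Engel's theorem for the action on \<open>Y / Z\<close>. Subalgebras above \<open>left_ann\<close> correspond to Lie subalgebras of the quotient
Lie algebra, so the classical proof applies: the induction hypothesis, for a maximal proper \<open>C\<close> acting on \<open>B / C\<close>, provides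
\<open>b\<close> that normalizes \<open>C\<close>, so that \<open>B = C + k b\<close>; for \<open>C\<close> acting on \<open>Y / Z\<close> it provides a nonzero space of vectors killed by
\<open>C\<close>, on which \<open>b\<close> is nilpotent.\<close>

lemma engel:
  assumes "subalgebra B" "left_ann \<subseteq> B"
    and "\<And>b. b \<in> B \<Longrightarrow> \<exists>m. \<forall>v. ((\<lambda>y. b \<cdot> y) ^^ m) v = 0"
    and "subspace Y" "subspace Z" "\<not> Y \<subseteq> Z"
    and "\<And>b y. b \<in> B \<Longrightarrow> y \<in> Y \<Longrightarrow> b \<cdot> y \<in> Y"
    and "\<And>b z. b \<in> B \<Longrightarrow> z \<in> Z \<Longrightarrow> b \<cdot> z \<in> Z"
  shows "\<exists>y. y \<in> Y \<and> y \<notin> Z \<and> (\<forall>b\<in>B. b \<cdot> y \<in> Z)"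
  using assms
proof (induction "dim B" arbitrary: B Y Z rule: less_induct)
  case less
  note B = less.prems(1) and ann = less.prems(2) and nil = less.prems(3)
    and Y = less.prems(4) and Z = less.prems(5) and BY = less.prems(7) and BZ = less.prems(8)
  have subB: "subspace B" by (rule subalgebra_subspace[OF B])
  show ?case
  proof (cases "B = left_ann")
    case True
    obtain y where "y \<in> Y" "y \<notin> Z" using less.prems(6) by blast
    then show ?thesis using True left_ann_mult subspace_0[OF Z] by auto
  next
    case False
    let ?P = "\<lambda>C. subalgebra C \<and> left_ann \<subseteq> C \<and> C \<subseteq> B \<and> C \<noteq> B"
    have "?P left_ann" using subalgebra_left_ann ann False by blast
    then obtain C where C: "?P C" and max: "\<And>C'. ?P C' \<Longrightarrow> C \<subseteq> C' \<Longrightarrow> C' = C"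
      using maximal_subspace_with_property[of ?P left_ann] subalgebra_subspace by metis
    have subC: "subspace C" using C subalgebra_subspace by blast
    have "dim C < dim B"
      using C subspace_dim_equal[OF subC subB] by (meson not_less)
    note IH = less.hyps[OF this]
    \<comment> \<open>\<open>C\<close> acting on \<open>B / C\<close>\<close>
    have "\<exists>b. b \<in> B \<and> b \<notin> C \<and> (\<forall>c\<in>C. c \<cdot> b \<in> C)"
      by (rule IH) (use C nil subB subC B subalgebra_mult in auto)
    then obtain b where b: "b \<in> B" "b \<notin> C" "\<And>c. c \<in> C \<Longrightarrow> c \<cdot> b \<in> C" by blast
    have bC: "b \<cdot> c \<in> C" if "c \<in> C" for c
    proof -
      have "(c \<cdot> b + b \<cdot> c) - c \<cdot> b \<in> C"
        using anticommutator_left_ann C b(3)[OF that] subspace_diff[OF subC] by blast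
      then show ?thesis by simp
    qed
    let ?C = "{c + scale s b | c s. c \<in> C}"
    have C_sub: "C \<subseteq> ?C" by (force intro: exI[of _ "0 :: 'k"])
    have b_C: "b \<in> ?C" using subspace_0[OF subC] by (force intro: exI[of _ "1 :: 'k"])
    have "subalgebra ?C"
      unfolding subalgebra_def
    proof (intro conjI ballI)
      show "subspace ?C"
      proof (rule subspaceI)
        show "0 \<in> ?C" using C_sub subspace_0[OF subC] by blast
        fix v w assume "v \<in> ?C" "w \<in> ?C"
        then obtain c s d t where vw: "v = c + scale s b" "w = d + scale t b" "c \<in> C" "d \<in> C" by blast
        have "v + w = (c + d) + scale (s + t) b" by (simp add: vw scale_left_distrib algebra_simps)
        then show "v + w \<in> ?C" using vw subspace_add[OF subC] by blast
      next
        fix r v assume "v \<in> ?C"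
        then obtain c s where v: "v = c + scale s b" "c \<in> C" by blast
        have "scale r v = scale r c + scale (r * s) b" by (simp add: v scale_right_distrib)
        then show "scale r v \<in> ?C" using v subspace_scale[OF subC] by blast
      qed
      fix v w assume "v \<in> ?C" "w \<in> ?C"
      then obtain c s d t where vw: "v = c + scale s b" "w = d + scale t b" "c \<in> C" "d \<in> C" by blast
      have "v \<cdot> w = c \<cdot> d + scale t (c \<cdot> b) + scale s (b \<cdot> d) + scale s (scale t (b \<cdot> b))"
        by (simp add: vw mult_add_left mult_add_right mult_scale_left mult_scale_right scale_right_distrib algebra_simps)
      also have "\<dots> \<in> C"
      proof -
        have "c \<cdot> d \<in> C" using C subalgebra_mult vw(3,4) by blast
        moreover have "b \<cdot> b \<in> C" using C square_left_ann by blast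
        ultimately show ?thesis
          using b(3)[OF vw(3)] bC[OF vw(4)] by (intro subspace_add[OF subC] subspace_scale[OF subC])
      qed
      finally show "v \<cdot> w \<in> ?C" using C_sub by blast
    qed
    moreover have "?C \<subseteq> B" using b(1) C subspace_add[OF subB] subspace_scale[OF subB] by auto
    moreover have "?C \<noteq> C" using b_C b(2) by blast
    ultimately have CB: "?C = B" using max[of ?C] C C_sub by blast
    let ?Z = "{z \<in> Y. \<forall>c\<in>C. c \<cdot> z \<in> Z}"
    have "\<exists>y. y \<in> Y \<and> y \<notin> Z \<and> (\<forall>c\<in>C. c \<cdot> y \<in> Z)"
      by (rule IH) (use C nil Y Z less.prems(6) BY BZ in auto)
    then obtain z where z: "z \<in> ?Z" "z \<notin> Z" by blast
    let ?L = "\<lambda>y. b \<cdot> y"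
    have stable: "?L y \<in> ?Z" if y: "y \<in> ?Z" for y
    proof -
      have "c \<cdot> (b \<cdot> y) \<in> Z" if c: "c \<in> C" for c
        using y b(3)[OF c] BZ[OF b(1)] c subspace_add[OF Z] by (simp add: leibniz[of c b y])
      then show ?thesis using BY[OF b(1)] y by simp
    qed
    obtain m where "(?L ^^ m) z = 0" using nil[OF b(1)] by blast
    then have ex: "(?L ^^ m) z \<in> Z" using subspace_0[OF Z] by simp
    \<comment> \<open>the last iterate of \<open>z\<close> under \<open>b\<close> outside \<open>Z\<close>\<close>
    define k where "k = (LEAST k. (?L ^^ k) z \<in> Z)"
    have k: "(?L ^^ k) z \<in> Z" unfolding k_def using ex by (rule LeastI)
    then have "k \<noteq> 0" using z(2) by (cases k) auto
    then obtain j where j: "k = Suc j" by (cases k) auto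
    let ?y = "(?L ^^ j) z"
    have yZ: "?y \<notin> Z" unfolding k_def using not_less_Least[of j "\<lambda>k. (?L ^^ k) z \<in> Z"] j k_def by simp
    have "(?L ^^ i) z \<in> ?Z" for i
      by (induction i) (use z(1) stable in auto)
    then have y: "?y \<in> ?Z" .
    have "a \<cdot> ?y \<in> Z" if aB: "a \<in> B" for a
    proof -
      obtain c s where a: "a = c + scale s b" "c \<in> C" using aB CB by blast
      have "a \<cdot> ?y = c \<cdot> ?y + scale s (b \<cdot> ?y)" by (simp add: a(1) mult_add_left mult_scale_left)
      moreover have "c \<cdot> ?y \<in> Z" using y a(2) by blast
      moreover have "b \<cdot> ?y \<in> Z" using k j by simp
      ultimately show ?thesis using subspace_add[OF Z] subspace_scale[OF Z] by simp
    qed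
    then show ?thesis using y yZ by blast
  qed
qed

section \<open>The Frattini subalgebra is an ideal\<close>

text \<open>If \<open>left_ann\<close> lies in \<open>M\<close>, then \<open>x \<cdot> a\<close> agrees with \<open>- a \<cdot> x\<close> up to an element of \<open>M\<close>. Otherwise let \<open>Z\<close> be the space of
those \<open>z\<close> in \<open>left_ann\<close> that the Frattini subalgebra maps into \<open>M\<close>. Engel's theorem shows that \<open>Z\<close> is not contained in \<open>M\<close>,
so the subalgebra \<open>M + Z\<close> is the whole algebra, and left multiplication by \<open>x\<close> maps both summands into \<open>M\<close>.\<close>

lemma frattini_right_mult:
  assumes x: "x \<in> frattini" and M: "maximal_subalgebra M"
  shows "x \<cdot> a \<in> M"
proof (cases "left_ann \<subseteq> M")
  have subM: "subspace M" using M by (simp add: maximal_subalgebra_def subalgebra_def)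
  case True
  have "a \<cdot> x + x \<cdot> a \<in> M" using anticommutator_left_ann True by blast
  moreover have "a \<cdot> x \<in> M" using frattini_left_ideal[OF x] frattini_subset_maximal[OF M] by blast
  ultimately have "(a \<cdot> x + x \<cdot> a) - a \<cdot> x \<in> M" using subspace_diff[OF subM] by blast
  then show ?thesis by simp
next
  case False
  have algM: "subalgebra M" using M by (simp add: maximal_subalgebra_def)
  then have subM: "subspace M" by (rule subalgebra_subspace)
  have FM: "f \<in> M" if "f \<in> frattini" for f using that frattini_subset_maximal[OF M] by blast
  let ?K = "left_ann"
  note subK = subspace_left_ann
  let ?B = "{f + z | f z. f \<in> frattini \<and> z \<in> ?K}"
  have Bmult: "(f + z) \<cdot> v = f \<cdot> v" if "z \<in> ?K" for f z v
    by (simp add: mult_add_left left_ann_mult[OF that])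
  have "subalgebra ?B"
    unfolding subalgebra_def
  proof (intro conjI ballI)
    show "subspace ?B" by (rule subspace_sums[OF subspace_frattini subK])
    fix v w assume "v \<in> ?B" "w \<in> ?B"
    then obtain f y f' z where vw: "v = f + y" "w = f' + z" "f \<in> frattini" "y \<in> ?K" "f' \<in> frattini" "z \<in> ?K"
      by blast
    have "v \<cdot> w = f \<cdot> f' + f \<cdot> z" by (simp add: vw(1,2) Bmult[OF vw(4)] mult_add_right)
    then show "v \<cdot> w \<in> ?B" using frattini_left_ideal[OF vw(5)] mult_left_ann[OF vw(6)] by blast
  qed
  moreover have "?K \<subseteq> ?B" using subspace_0[OF subspace_frattini] by force
  moreover have "\<exists>m. \<forall>v. ((\<lambda>y. b \<cdot> y) ^^ m) v = 0" if b: "b \<in> ?B" for b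
  proof -
    obtain f z where fz: "b = f + z" "f \<in> frattini" "z \<in> ?K" using b by blast
    have "(\<lambda>y. b \<cdot> y) = (\<lambda>y. f \<cdot> y)" using Bmult[OF fz(3)] fz(1) by auto
    then show ?thesis using frattini_left_mult_nilpotent[OF fz(2)] by simp
  qed
  moreover have "\<not> ?K \<subseteq> ?K \<inter> M" using False by blast
  moreover have "b \<cdot> v \<in> ?K" if "v \<in> ?K" for b v using mult_left_ann[OF that] .
  moreover have "b \<cdot> v \<in> ?K \<inter> M" if b: "b \<in> ?B" and v: "v \<in> ?K \<inter> M" for b v
  proof -
    obtain f z where fz: "b = f + z" "f \<in> frattini" "z \<in> ?K" using b by blast
    have "b \<cdot> v = f \<cdot> v" using Bmult[OF fz(3)] fz(1) by simp
    moreover have "f \<cdot> v \<in> M" using subalgebra_mult[OF algM FM[OF fz(2)]] v by blast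
    ultimately show ?thesis using mult_left_ann v by auto
  qed
  ultimately have "\<exists>y. y \<in> ?K \<and> y \<notin> ?K \<inter> M \<and> (\<forall>b\<in>?B. b \<cdot> y \<in> ?K \<inter> M)"
    by (intro engel subK subspace_inter subM)
  then obtain y where y: "y \<in> ?K" "y \<notin> M" "\<And>b. b \<in> ?B \<Longrightarrow> b \<cdot> y \<in> M" by blast
  let ?Z = "{z \<in> ?K. \<forall>f\<in>frattini. f \<cdot> z \<in> M}"
  have FB: "frattini \<subseteq> ?B" using subspace_0[OF subK] by force
  have yZ: "y \<in> ?Z" using y FB by blast
  have subZ: "subspace ?Z"
    using subK subM by (simp add: subspace_def mult_zero_right mult_add_right mult_scale_right)
  have MZ: "m \<cdot> z \<in> ?Z" if m: "m \<in> M" and z: "z \<in> ?Z" for m z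
  proof -
    have "f \<cdot> (m \<cdot> z) \<in> M" if f: "f \<in> frattini" for f
    proof -
      have "(f \<cdot> m) \<cdot> z + (m \<cdot> f) \<cdot> z = 0"
        using anticommutator_left_ann[of f m] left_ann_mult by (simp add: mult_add_left[symmetric])
      then have "f \<cdot> (m \<cdot> z) = m \<cdot> (f \<cdot> z) - (m \<cdot> f) \<cdot> z"
        using leibniz[of f m z] by (simp add: eq_neg_iff_add_eq_0 algebra_simps)
      moreover have "(m \<cdot> f) \<cdot> z \<in> M" using z frattini_left_ideal[OF f] by blast
      moreover have "m \<cdot> (f \<cdot> z) \<in> M" using z f subalgebra_mult[OF algM m] by blast
      ultimately show ?thesis using subspace_diff[OF subM] by simp
    qed
    then show ?thesis using mult_left_ann z by blast
  qed
  let ?T = "{m + z | m z. m \<in> M \<and> z \<in> ?Z}"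
  have "subalgebra ?T"
    unfolding subalgebra_def
  proof (intro conjI ballI)
    show "subspace ?T" by (rule subspace_sums[OF subM subZ])
    fix v w assume "v \<in> ?T" "w \<in> ?T"
    then obtain m y' n z where vw: "v = m + y'" "w = n + z" "m \<in> M" "y' \<in> ?Z" "n \<in> M" "z \<in> ?Z" by blast
    have "v \<cdot> w = m \<cdot> n + m \<cdot> z"
      using vw(4) by (simp add: vw(1,2) mult_add_left mult_add_right left_ann_mult)
    then show "v \<cdot> w \<in> ?T" using subalgebra_mult[OF algM vw(3,5)] MZ[OF vw(3,6)] by blast
  qed
  moreover have "M \<subseteq> ?T" using subspace_0[OF subZ] by force
  moreover have "y \<in> ?T" using subspace_0[OF subM] yZ by force
  ultimately have "?T = UNIV" using M y(2) unfolding maximal_subalgebra_def by blast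
  then obtain m z where a: "a = m + z" "m \<in> M" "z \<in> ?Z" by blast
  have "x \<cdot> m \<in> M" "x \<cdot> z \<in> M" using subalgebra_mult[OF algM FM[OF x] a(2)] a(3) x by auto
  then show ?thesis using subspace_add[OF subM] by (simp add: a(1) mult_add_right)
qed

lemma frattini_two_sided_ideal: "two_sided_ideal frattini"
  unfolding two_sided_ideal_def
proof (intro conjI allI ballI)
  show "x \<cdot> a \<in> frattini" if "x \<in> frattini" for a x
    unfolding frattini_def using frattini_right_mult[OF that] by blast
qed (auto simp: subspace_frattini frattini_left_ideal)

end

theorem theorem2p10:
  fixes scale :: "'k::field_char_0 \<Rightarrow> 'a::ab_group_add \<Rightarrow> 'a"
    and mult :: "'a \<Rightarrow> 'a \<Rightarrow> 'a"
  assumes "leibniz_algebra scale mult"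
    and "leibniz_algebra.finite_dimensional scale"
  shows "leibniz_algebra.two_sided_ideal scale mult (leibniz_algebra.frattini scale mult)"
proof -
  interpret leibniz_algebra scale mult by (rule assms(1))
  interpret fd_leibniz scale mult
    by (intro fd_leibniz.intro fd_leibniz_axioms.intro assms)
  show ?thesis by (rule frattini_two_sided_ideal)
qed

end
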